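(* For $t\in\overline{\mathbb{Q}}$ let $f_t(z)=g_t(z)=z^2+t$. Let $a,b\in\overline{\mathbb{Q}}$ be such that exactly one of $a$ and $b$ is an algebraic integer. Then the set $$S:=\{t\in\overline{\mathbb{Q}} : f_t^m(a)=g_t^n(b)\ \text{for some } m,n\in\mathbb{N}\}$$ has bounded height.
   Context: Here $\mathbb{N}$ is the set of positive integers and $f_t^m$ denotes the $m$-th iterate of $f_t$ under composition. A subset of $\overline{\mathbb{Q}}\subset\mathbb{P}^1(\overline{\mathbb{Q}})$ has bounded height if the absolute logarithmic Weil height $h$ is bounded on it. *)

theory Defs
  imports "HOL-Analysis.Analysis" "HOL-Computational_Algebra.Computational_Algebra"
begin

text \<open>
  The field \<open>\<rat>\<close>-bar is the set of complex numbers satisfying \<open>algebraic\<close>.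
\<close>

definition padic_abs :: "nat \<Rightarrow> rat \<Rightarrow> real" where
  "padic_abs p r = (if r = 0 then 0 else
     real p powi (int (multiplicity (int p) (snd (quotient_of r)))
                - int (multiplicity (int p) (fst (quotient_of r)))))"

definition is_padic_extension :: "nat \<Rightarrow> (complex \<Rightarrow> real) \<Rightarrow> bool" where
  "is_padic_extension p v \<longleftrightarrow>
     (\<forall>x. algebraic x \<longrightarrow> v x \<ge> 0) \<and>
     (\<forall>x. algebraic x \<longrightarrow> (v x = 0 \<longleftrightarrow> x = 0)) \<and>
     (\<forall>x y. algebraic x \<longrightarrow> algebraic y \<longrightarrow> v (x * y) = v x * v y) \<and>
     (\<forall>x y. algebraic x \<longrightarrow> algebraic y \<longrightarrow> v (x + y) \<le> max (v x) (v y)) \<and>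
     (\<forall>r. v (of_rat r) = padic_abs p r)"

text \<open>
  For each prime \<open>p\<close> one extension of the \<open>p\<close>-adic absolute value to the algebraic numbers is
  fixed; equivalently, one embedding of the algebraic numbers into the completed algebraic
  closure of the \<open>p\<close>-adic numbers.  Any two extensions differ by a Galois automorphism, so the
  height below does not depend on the choice.
\<close>

definition padic_abs_ext :: "nat \<Rightarrow> complex \<Rightarrow> real" where
  "padic_abs_ext p = (SOME v. is_padic_extension p v)"

text \<open>
  The conjugates of an algebraic \<open>x\<close> over \<open>\<rat>\<close> are the numbers with the same minimal polynomial,
  that is, those annihilated by the same rational polynomials.
\<close>

definition conjugates :: "complex \<Rightarrow> complex set" where
  "conjugates x = {y. \<forall>p :: rat poly.
     poly (map_poly of_rat p) y = 0 \<longleftrightarrow> poly (map_poly of_rat p) x = 0}"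

text \<open>
  The absolute logarithmic Weil height
  \<open>h(x) = 1/[K:\<rat>] \<Sum>\<^sub>w [K\<^sub>w:\<rat>\<^sub>v] log max(1, |x|\<^sub>w)\<close> for \<open>K = \<rat>(x)\<close>, where \<open>w\<close> runs over the places
  of \<open>K\<close> and \<open>v\<close> is the place of \<open>\<rat>\<close> below \<open>w\<close>.  The places \<open>w\<close> above \<open>v\<close> are the restrictions
  of the fixed absolute value at \<open>v\<close> along the embeddings of \<open>K\<close> into the algebraic numbers, and
  \<open>w\<close> arises from exactly \<open>[K\<^sub>w:\<rat>\<^sub>v]\<close> embeddings.  An embedding is determined by the conjugate of
  \<open>x\<close> to which it sends \<open>x\<close>, so the inner sum is written over conjugates, and \<open>[K:\<rat>]\<close> is their
  number.  The first summand is the infinite place; only finitely many primes contribute to the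
  second.
\<close>

definition weil_height :: "complex \<Rightarrow> real" where
  "weil_height x =
     ((\<Sum>y\<in>conjugates x. ln (max 1 (cmod y))) +
      (\<Sum>\<^sub>\<infinity>p\<in>{p::nat. prime p}. \<Sum>y\<in>conjugates x. ln (max 1 (padic_abs_ext p y))))
     / real (card (conjugates x))"

definition bounded_height :: "complex set \<Rightarrow> bool" where
  "bounded_height S \<longleftrightarrow> (\<forall>x\<in>S. algebraic x) \<and> bounded (weil_height ` S)"

definition quad_map :: "complex \<Rightarrow> complex \<Rightarrow> complex" where
  "quad_map t z = z\<^sup>2 + t"

end

theory Submission
  imports Defs
begin

text \<open>Let \<open>a\<close> be the point that is not an algebraic integer, \<open>b\<close> the integral one, and write \<open>u\<^sub>i\<close> and
  \<open>w\<^sub>i\<close> for their \<open>i\<close>-th iterates under \<open>z\<^sup>2 + t\<close>. Suppose \<open>u\<^sub>m = w\<^sub>n\<close>.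

  At a p-adic place where \<open>t\<close> is large compared with \<open>a\<close>, \<open>b\<close> and \<open>1/2\<close>, both orbits escape at the
  speed \<open>\<bar>u\<^sub>i\<bar> = \<bar>w\<^sub>i\<bar> = \<bar>t\<bar> ^ 2\<^sup>i\<^sup>-\<^sup>1\<close>. This forces \<open>m = n\<close>, and then the relative difference \<open>u\<^sub>i / w\<^sub>i - 1\<close> stays
  below \<open>\<bar>2\<bar>\<close> in size without ever vanishing, because \<open>a\<^sup>2 \<noteq> b\<^sup>2\<close>; so the orbits cannot meet. Hence \<open>\<bar>t\<bar>\<close>
  is bounded at every p-adic place, and by \<open>1\<close> at all but finitely many primes
  (\<open>nonarchimedean_bound\<close>). At the archimedean place the same growth argument bounds \<open>\<bar>t\<bar>\<close> when
  \<open>m \<noteq> n\<close> (\<open>archimedean_bound\<close>). When \<open>m = n\<close> it breaks down, since there squaring doubles a small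
  relative difference, and the conjugates of \<open>t\<close> are bounded only on average.

  For that average, \<open>m = n\<close> and \<open>a\<^sup>2 \<noteq> b\<^sup>2\<close> give an index \<open>j\<close> with \<open>u\<^sub>j\<^sub>+\<^sub>1 = - w\<^sub>j\<^sub>+\<^sub>1\<close>. As a polynomial in
  \<open>t\<close>, \<open>u\<^sub>j\<^sub>+\<^sub>1 + w\<^sub>j\<^sub>+\<^sub>1\<close> has degree \<open>N = 2\<^sup>j\<close>, leading coefficient \<open>2\<close> and coefficients of size \<open>exp (O(N))\<close>;
  by Landau's inequality the sum of \<open>log max(1, \<bar>\<cdot>\<bar>)\<close> over its roots is \<open>O(N)\<close>
  (\<open>sum_ln_opposite_roots\<close>). It remains to see that \<open>t\<close> has degree at least \<open>c N\<close>, and this is where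
  the non-integrality of \<open>a\<close> enters: some conjugate of \<open>a\<close> has p-adic absolute value above \<open>1\<close> for
  some prime \<open>p\<close>, while the conjugates of \<open>b\<close> have absolute value at most \<open>1\<close>. If \<open>p = 2\<close>, the
  relative difference can be followed exactly, which gives \<open>\<bar>t\<bar> ^ N = 2 \<bar>a\<bar> ^ 2N\<close>, so \<open>t\<close> is ramified of
  order about \<open>N\<close>. If \<open>p\<close> is odd, \<open>1 + a\<^sup>2 / t\<close> reduces to a primitive \<open>2N\<close>-th root of unity of
  the residue field, and the orbit of such a root under Frobenius has length at least \<open>c N\<close>. Both
  cases bound the degree of \<open>t\<close> from below (\<open>opposite_orbits_degree_bound\<close>).

  Two algebraic ingredients make these arguments available. The height is a sum over all conjugates
  of \<open>t\<close>, so each conjugate \<open>y\<close> needs conjugates of \<open>a\<close> and \<open>b\<close> that satisfy the same relations;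
  they come from a field embedding with \<open>t \<mapsto> y\<close> (\<open>exists_embedding\<close>). Integrality is invariant under
  conjugation, so the squares of the new points are still different. And the absolute values that
  enter the height are well defined because p-adic absolute values extend to all algebraic numbers
  (\<open>exists_padic_extension\<close>), which is shown by Chevalley's method of maximal subrings.\<close>

section \<open>The field of algebraic numbers\<close>

interpretation rat_vs: vector_space "\<lambda>(r::rat) (x::'a::field_char_0). of_rat r * x"
  by unfold_locales (auto simp: algebra_simps of_rat_add of_rat_mult)

lemma algebraic_iff_rat_poly:
  "algebraic (x::'a::field_char_0) \<longleftrightarrow> (\<exists>p::rat poly. p \<noteq> 0 \<and> poly (map_poly of_rat p) x = 0)"
proof
  assume "algebraic x"
  then obtain p :: "int poly" where p: "p \<noteq> 0" "poly (map_poly of_int p) x = 0"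
    by (erule algebraicE')
  have "map_poly of_rat (map_poly of_int p :: rat poly) = (map_poly of_int p :: 'a poly)"
    by (simp add: poly_eq_iff coeff_map_poly)
  moreover have "map_poly of_int p \<noteq> (0::rat poly)"
    using p(1) by (simp add: poly_eq_iff coeff_map_poly)
  ultimately show "\<exists>p::rat poly. p \<noteq> 0 \<and> poly (map_poly of_rat p) x = 0"
    using p(2) by metis
next
  assume "\<exists>p::rat poly. p \<noteq> 0 \<and> poly (map_poly of_rat p) x = 0"
  then obtain p :: "rat poly" where "p \<noteq> 0" "poly (map_poly of_rat p) x = 0" by blast
  then show "algebraic x"
    by (intro algebraicI'[of "map_poly of_rat p"]) (auto simp: coeff_map_poly poly_eq_iff)
qed

text \<open>More powers than the dimension of the span satisfy a linear relation, which is a polynomial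
  equation. This criterion yields the closure of the algebraic numbers under addition and
  multiplication without constructing the polynomials of sums and products.\<close>

lemma algebraic_if_powers_in_span:
  fixes x :: "'a::field_char_0"
  assumes "finite B" and B: "\<And>n. x ^ n \<in> rat_vs.span B"
  shows "algebraic x"
proof (cases "inj_on (\<lambda>n. x ^ n) {..card B}")
  case False
  then obtain m n where mn: "m \<noteq> n" "x ^ m = x ^ n"
    by (auto simp: inj_on_def)
  show ?thesis
  proof (rule algebraicI')
    show "monom 1 m - monom 1 n \<noteq> (0::'a poly)"
      using mn(1) by (metis coeff_monom eq_iff_diff_eq_0 zero_neq_one)
    show "poly (monom 1 m - monom 1 n) x = 0"
      using mn(2) by (simp add: poly_monom)
  qed (auto simp: coeff_monom)
next
  case True
  let ?S = "(\<lambda>n. x ^ n) ` {..card B}"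
  have card: "card ?S = card B + 1"
    using True by (simp add: card_image)
  have "rat_vs.dependent ?S"
  proof (rule ccontr)
    assume "rat_vs.independent ?S"
    then have "card ?S \<le> card B"
      using rat_vs.independent_span_bound[OF \<open>finite B\<close>, of ?S] B by auto
    with card show False by simp
  qed
  then obtain u where u: "\<exists>v\<in>?S. u v \<noteq> 0" "(\<Sum>v\<in>?S. of_rat (u v) * v) = 0"
    by (subst (asm) rat_vs.dependent_finite) auto
  define p where "p = (\<Sum>n\<le>card B. monom (u (x ^ n)) n)"
  have coeff_p: "coeff p n = u (x ^ n)" if "n \<le> card B" for n
    using that by (simp add: p_def coeff_sum if_distrib cong: if_cong)
  have "p \<noteq> 0"
    using u(1) coeff_p by fastforce
  moreover have "map_poly of_rat p = (\<Sum>n\<le>card B. monom (of_rat (u (x ^ n)) :: 'a) n)"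
    by (rule poly_eqI) (simp add: p_def coeff_map_poly coeff_sum of_rat_sum if_distrib cong: if_cong)
  then have "poly (map_poly of_rat p) x = (\<Sum>n\<le>card B. of_rat (u (x ^ n)) * x ^ n)"
    by (simp add: poly_sum poly_monom)
  then have "poly (map_poly of_rat p) x = (\<Sum>v\<in>?S. of_rat (u v) * v)"
    using True by (simp add: sum.reindex)
  ultimately show ?thesis
    using u(2) algebraic_iff_rat_poly by metis
qed

lemma algebraic_power_reduction:
  fixes x :: "'a::field_char_0"
  assumes "algebraic x"
  obtains d where "d > 0" "x ^ d \<in> rat_vs.span ((\<lambda>k. x ^ k) ` {..<d})"
proof -
  obtain p :: "rat poly" where p: "p \<noteq> 0" "poly (map_poly of_rat p) x = 0"
    using assms algebraic_iff_rat_poly by blast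
  define d where "d = degree p"
  have sum0: "(\<Sum>k\<le>d. of_rat (coeff p k) * x ^ k) = 0"
    using p(2) by (simp add: poly_altdef coeff_map_poly degree_map_poly d_def)
  have lc: "coeff p d \<noteq> 0" using p(1) d_def by simp
  have "d > 0"
    using sum0 lc by (cases d) auto
  moreover have "x ^ d = (\<Sum>k<d. of_rat (- coeff p k / coeff p d) * x ^ k)"
  proof -
    have "(\<Sum>k\<le>d. of_rat (coeff p k) * x ^ k)
        = of_rat (coeff p d) * x ^ d + (\<Sum>k<d. of_rat (coeff p k) * x ^ k)"
      by (simp add: lessThan_Suc_atMost[symmetric])
    with sum0 have "of_rat (coeff p d) * x ^ d = - (\<Sum>k<d. of_rat (coeff p k) * x ^ k)"
      by (simp add: add_eq_0_iff2)
    then have "x ^ d = - (\<Sum>k<d. of_rat (coeff p k) * x ^ k) / of_rat (coeff p d)"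
      using lc by (simp add: field_simps)
    also have "\<dots> = (\<Sum>k<d. of_rat (- coeff p k / coeff p d) * x ^ k)"
      by (simp add: sum_divide_distrib of_rat_divide of_rat_minus sum_negf)
    finally show ?thesis .
  qed
  then have "x ^ d \<in> rat_vs.span ((\<lambda>k. x ^ k) ` {..<d})"
    by (simp only:) (intro rat_vs.span_sum rat_vs.span_scale rat_vs.span_base; auto)
  ultimately show thesis by (rule that)
qed

text \<open>The span of the finitely many \<open>x\<^sup>i y\<^sup>j\<close> below the degrees of \<open>x\<close> and \<open>y\<close> is stable under multiplication by
  \<open>x\<close> and by \<open>y\<close>, so it contains all powers of \<open>x + y\<close> and of \<open>x y\<close>.\<close>

lemma algebraic_add_mult:
  fixes x y :: "'a::field_char_0"
  assumes "algebraic x" "algebraic y"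
  shows "algebraic (x + y)" and "algebraic (x * y)"
proof -
  obtain m where m: "m > 0" "x ^ m \<in> rat_vs.span ((\<lambda>k. x ^ k) ` {..<m})"
    using assms(1) by (rule algebraic_power_reduction)
  obtain n where n: "n > 0" "y ^ n \<in> rat_vs.span ((\<lambda>k. y ^ k) ` {..<n})"
    using assms(2) by (rule algebraic_power_reduction)
  define B where "B = (\<lambda>(i,j). x ^ i * y ^ j) ` ({..<m} \<times> {..<n})"
  have fin: "finite B" by (simp add: B_def)
  have inB: "x ^ i * y ^ j \<in> rat_vs.span B" if "i < m" "j < n" for i j
    using that by (intro rat_vs.span_base) (auto simp: B_def)
  have span_mult: "c * z \<in> rat_vs.span D" if "z \<in> rat_vs.span C" "\<And>b. b \<in> C \<Longrightarrow> c * b \<in> rat_vs.span D"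
    for z c and C D :: "'a set"
    using that(1)
  proof (induction rule: rat_vs.span_induct_alt)
    case (step r b z)
    have "c * (of_rat r * b + z) = of_rat r * (c * b) + c * z" by (simp add: algebra_simps)
    with step that(2) show ?case by (auto intro!: rat_vs.span_add rat_vs.span_scale)
  qed (auto intro: rat_vs.span_zero)
  have X: "x * z \<in> rat_vs.span B" if z: "z \<in> rat_vs.span B" for z
  proof (rule span_mult[OF z])
    fix b assume "b \<in> B"
    then obtain i j where ij: "b = x ^ i * y ^ j" "i < m" "j < n" by (auto simp: B_def)
    show "x * b \<in> rat_vs.span B"
    proof (cases "Suc i < m")
      case True
      then show ?thesis using inB[of "Suc i" j] ij by (simp add: mult.assoc)
    next
      case False
      then have "m = Suc i" using ij by simp
      then have "x * b = y ^ j * x ^ m" using ij by (simp add: algebra_simps)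
      moreover have "y ^ j * x ^ m \<in> rat_vs.span B"
        using inB ij by (intro span_mult[OF m(2)]) (auto simp: mult.commute)
      ultimately show ?thesis by simp
    qed
  qed
  have Y: "y * z \<in> rat_vs.span B" if z: "z \<in> rat_vs.span B" for z
  proof (rule span_mult[OF z])
    fix b assume "b \<in> B"
    then obtain i j where ij: "b = x ^ i * y ^ j" "i < m" "j < n" by (auto simp: B_def)
    show "y * b \<in> rat_vs.span B"
    proof (cases "Suc j < n")
      case True
      then show ?thesis using inB[of i "Suc j"] ij by (simp add: mult_ac)
    next
      case False
      then have "n = Suc j" using ij by simp
      then have "y * b = x ^ i * y ^ n" using ij by (simp add: algebra_simps)
      moreover have "x ^ i * y ^ n \<in> rat_vs.span B"
        using inB ij by (intro span_mult[OF n(2)]) auto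
      ultimately show ?thesis by simp
    qed
  qed
  have one: "1 \<in> rat_vs.span B" using inB[of 0 0] m n by simp
  have "(x + y) ^ k \<in> rat_vs.span B" for k
  proof (induction k)
    case (Suc k)
    have "(x + y) ^ Suc k = x * (x + y) ^ k + y * (x + y) ^ k" by (simp add: algebra_simps)
    with Suc X Y show ?case by (auto intro: rat_vs.span_add)
  qed (use one in simp)
  then show "algebraic (x + y)" by (rule algebraic_if_powers_in_span[OF fin])
  have "(x * y) ^ k \<in> rat_vs.span B" for k
  proof (induction k)
    case (Suc k)
    have "(x * y) ^ Suc k = x * (y * (x * y) ^ k)" by (simp add: algebra_simps)
    then show ?case using X[OF Y[OF Suc]] by (simp only:)
  qed (use one in simp)
  then show "algebraic (x * y)" by (rule algebraic_if_powers_in_span[OF fin])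
qed

lemma algebraic_of_rat [simp]: "algebraic (of_rat r)"
  by (intro rat_imp_algebraic) auto

lemma algebraic_power: "algebraic (x::'a::field_char_0) \<Longrightarrow> algebraic (x ^ n)"
  by (induction n) (auto intro: algebraic_add_mult(2))

text \<open>A type for the algebraic numbers makes p-adic absolute values total functions on a field, so that
  their calculus needs no side conditions.\<close>

typedef qbar = "{x::complex. algebraic x}" morphisms complex_of_qbar Abs_qbar
  by (rule exI[of _ 0]) simp

setup_lifting type_definition_qbar

instantiation qbar :: field
begin
lift_definition zero_qbar :: qbar is 0 by simp
lift_definition one_qbar :: qbar is 1 by simp
lift_definition plus_qbar :: "qbar \<Rightarrow> qbar \<Rightarrow> qbar" is "(+)" by (simp add: algebraic_add_mult)
lift_definition uminus_qbar :: "qbar \<Rightarrow> qbar" is uminus by simp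
lift_definition minus_qbar :: "qbar \<Rightarrow> qbar \<Rightarrow> qbar" is "(-)"
  by (metis algebraic_add_mult(1) algebraic_minus_iff diff_conv_add_uminus)
lift_definition times_qbar :: "qbar \<Rightarrow> qbar \<Rightarrow> qbar" is "(*)" by (simp add: algebraic_add_mult)
lift_definition inverse_qbar :: "qbar \<Rightarrow> qbar" is inverse by auto
lift_definition divide_qbar :: "qbar \<Rightarrow> qbar \<Rightarrow> qbar" is "(/)"
  by (auto simp: divide_inverse intro: algebraic_add_mult(2))
instance
  by standard (transfer; simp add: algebra_simps divide_inverse; fail)+
end

lemma complex_of_qbar_of_nat [simp]: "complex_of_qbar (of_nat n) = of_nat n"
  by (induction n) (auto simp: zero_qbar.rep_eq one_qbar.rep_eq plus_qbar.rep_eq)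

instance qbar :: field_char_0
proof
  show "inj (of_nat :: nat \<Rightarrow> qbar)"
    by (metis complex_of_qbar_of_nat injI of_nat_eq_iff)
qed

lemma complex_of_qbar_of_int [simp]: "complex_of_qbar (of_int n) = of_int n"
  by (cases n) (simp_all add: uminus_qbar.rep_eq one_qbar.rep_eq plus_qbar.rep_eq minus_qbar.rep_eq)

lemma complex_of_qbar_of_rat [simp]: "complex_of_qbar (of_rat r) = of_rat r"
  by (cases r) (simp add: of_rat_rat divide_qbar.rep_eq)

lemma complex_of_qbar_power [simp]: "complex_of_qbar (x ^ n) = complex_of_qbar x ^ n"
  by (induction n) (simp_all add: one_qbar.rep_eq times_qbar.rep_eq)

lemma algebraic_complex_of_qbar [simp]: "algebraic (complex_of_qbar x)"
  using complex_of_qbar by auto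

lemma complex_of_qbar_poly:
  "complex_of_qbar (poly (map_poly of_rat p) x) = poly (map_poly of_rat p) (complex_of_qbar x)"
  by (induction p) (simp_all add: map_poly_pCons zero_qbar.rep_eq plus_qbar.rep_eq times_qbar.rep_eq)

lemma algebraic_qbar: "algebraic (x :: qbar)"
proof -
  obtain p :: "rat poly" where "p \<noteq> 0" "poly (map_poly of_rat p) (complex_of_qbar x) = 0"
    using algebraic_complex_of_qbar algebraic_iff_rat_poly by blast
  then have "p \<noteq> 0" "poly (map_poly of_rat p) x = 0"
    by (auto simp flip: complex_of_qbar_poly complex_of_qbar_inject simp: zero_qbar.rep_eq)
  then show ?thesis using algebraic_iff_rat_poly by blast
qed

section \<open>Extending the p-adic absolute value\<close>

definition subring_set :: "'a::comm_ring_1 set \<Rightarrow> bool" where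
  "subring_set A \<longleftrightarrow> 1 \<in> A \<and> (\<forall>x\<in>A. \<forall>y\<in>A. x - y \<in> A \<and> x * y \<in> A)"

definition adjoin :: "'a::comm_ring_1 set \<Rightarrow> 'a \<Rightarrow> 'a set" where
  "adjoin A x = {poly q x | q. \<forall>i. coeff q i \<in> A}"

context
  fixes A :: "'a::comm_ring_1 set"
  assumes A: "subring_set A"
begin

lemma subring_set_closed:
  shows "1 \<in> A" and "0 \<in> A"
    and "x \<in> A \<Longrightarrow> y \<in> A \<Longrightarrow> x - y \<in> A"
    and "x \<in> A \<Longrightarrow> y \<in> A \<Longrightarrow> x * y \<in> A"
    and "x \<in> A \<Longrightarrow> - x \<in> A"
    and "x \<in> A \<Longrightarrow> y \<in> A \<Longrightarrow> x + y \<in> A"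
proof -
  have m: "x \<in> A \<Longrightarrow> y \<in> A \<Longrightarrow> x - y \<in> A" for x y
    using A by (auto simp: subring_set_def)
  show "1 \<in> A" using A by (auto simp: subring_set_def)
  from m[OF this this] show z: "0 \<in> A" by simp
  have n: "- x \<in> A" if "x \<in> A" for x using m[OF z that] by simp
  then show "x \<in> A \<Longrightarrow> - x \<in> A" .
  show "x \<in> A \<Longrightarrow> y \<in> A \<Longrightarrow> x + y \<in> A" using m[of x "- y"] n by simp
qed (use A in \<open>auto simp: subring_set_def\<close>)

lemma subring_set_power: "x \<in> A \<Longrightarrow> x ^ n \<in> A"
  by (induction n) (auto intro: subring_set_closed)

lemma subring_set_sum: "(\<And>i. i \<in> I \<Longrightarrow> f i \<in> A) \<Longrightarrow> sum f I \<in> A"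
  by (induction I rule: infinite_finite_induct) (auto intro: subring_set_closed)

lemma subring_set_of_nat: "of_nat n \<in> A"
  by (induction n) (auto intro: subring_set_closed)

lemma subring_set_of_int: "of_int n \<in> A"
  by (cases n) (auto intro!: subring_set_closed subring_set_of_nat)

lemma subring_set_adjoin: "subring_set (adjoin A x)"
  unfolding subring_set_def
proof (intro conjI ballI)
  show "1 \<in> adjoin A x"
    unfolding adjoin_def by (intro CollectI exI[of _ 1]) (auto simp: coeff_1 subring_set_closed)
  fix y z assume "y \<in> adjoin A x" "z \<in> adjoin A x"
  then obtain q r where q: "y = poly q x" "\<forall>i. coeff q i \<in> A" and r: "z = poly r x" "\<forall>i. coeff r i \<in> A"
    unfolding adjoin_def by blast
  show "y - z \<in> adjoin A x"
    unfolding adjoin_def using q r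
    by (intro CollectI exI[of _ "q - r"]) (auto intro: subring_set_closed)
  show "y * z \<in> adjoin A x"
    unfolding adjoin_def using q r
    by (intro CollectI exI[of _ "q * r"])
       (auto simp: coeff_mult intro!: subring_set_closed subring_set_sum)
qed

lemma adjoin_superset: "A \<subseteq> adjoin A x"
proof
  fix y assume "y \<in> A"
  then show "y \<in> adjoin A x"
    unfolding adjoin_def
    by (intro CollectI exI[of _ "[:y:]"]) (auto simp: coeff_pCons subring_set_closed split: nat.splits)
qed

lemma adjoin_self: "x \<in> adjoin A x"
  unfolding adjoin_def
  by (intro CollectI exI[of _ "[:0, 1:]"]) (auto simp: coeff_pCons subring_set_closed split: nat.splits)

end

text \<open>Zorn's lemma, starting from the ring of integers. For \<open>u = 1/p\<close> the maximal ring turns out to be a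
  valuation ring above \<open>p\<close>.\<close>

lemma exists_maximal_subring:
  fixes u :: "'a::comm_ring_1"
  assumes "u \<notin> \<int>"
  obtains A where "subring_set A" "u \<notin> A" "\<And>B. subring_set B \<Longrightarrow> A \<subseteq> B \<Longrightarrow> u \<notin> B \<Longrightarrow> B = A"
proof -
  let ?S = "{A. subring_set A \<and> u \<notin> A}"
  have "\<int> \<in> ?S" using assms by (auto simp: subring_set_def)
  moreover have "\<Union>C \<in> ?S" if C: "C \<noteq> {}" "subset.chain ?S C" for C
  proof -
    have sub: "subring_set B" "u \<notin> B" if "B \<in> C" for B
      using C(2) that by (auto simp: subset.chain_def)
    obtain B0 where B0: "B0 \<in> C" using C(1) by blast
    have "subring_set (\<Union>C)"
      unfolding subring_set_def
    proof (intro conjI ballI)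
      show "1 \<in> \<Union>C" using B0 sub subring_set_closed(1) by blast
      fix x y assume "x \<in> \<Union>C" "y \<in> \<Union>C"
      then obtain X Y where XY: "X \<in> C" "Y \<in> C" "x \<in> X" "y \<in> Y" by blast
      then have "X \<subseteq> Y \<or> Y \<subseteq> X"
        using C(2) by (auto simp: subset.chain_def subset_iff)
      then obtain Z where "Z \<in> C" "x \<in> Z" "y \<in> Z" using XY by blast
      then show "x - y \<in> \<Union>C" "x * y \<in> \<Union>C"
        using sub subring_set_closed by blast+
    qed
    with sub show ?thesis by auto
  qed
  ultimately obtain A where "A \<in> ?S" "\<forall>B\<in>?S. A \<subseteq> B \<longrightarrow> B = A"
    using subset_Zorn_nonempty[of ?S] by blast
  then show thesis by (intro that[of A]) auto
qed

lemma poly_eq_sum: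
  fixes q :: "'a::comm_semiring_1 poly"
  assumes "degree q \<le> m"
  shows "poly q x = (\<Sum>i\<le>m. coeff q i * x ^ i)"
  unfolding poly_altdef using assms
  by (intro sum.mono_neutral_left) (auto simp: coeff_eq_0)

text \<open>Chevalley's construction. The ring \<open>A\<close> is local and \<open>p\<close> lies in its maximal ideal; the facts below
  show that it is a valuation ring and that its value group embeds into the reals.\<close>

locale maximal_without_inverse =
  fixes p :: nat and A :: "'a::field_char_0 set"
  assumes prime: "prime p"
    and subring: "subring_set A"
    and inverse_notin: "inverse (of_nat p) \<notin> A"
    and algebraic: "\<And>x::'a. algebraic x"
    and maximal: "\<And>B. subring_set B \<Longrightarrow> A \<subseteq> B \<Longrightarrow> inverse (of_nat p) \<notin> B \<Longrightarrow> B = A"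
begin

abbreviation \<pi> :: 'a where "\<pi> \<equiv> of_nat p"

lemmas A_closed = subring_set_closed[OF subring] subring_set_power[OF subring]
  subring_set_of_nat[OF subring] subring_set_of_int[OF subring]
lemmas A_sum = subring_set_sum[OF subring]

lemma p_nonzero [simp]: "p \<noteq> 0"
  using prime by (auto simp: prime_gt_0_nat)

lemma \<pi>_nonzero: "\<pi> \<noteq> 0"
  by simp

lemma inverse_in_adjoin:
  assumes "x \<notin> A"
  obtains q where "\<And>i. coeff q i \<in> A" "poly q x = inverse \<pi>"
proof -
  have "inverse \<pi> \<in> adjoin A x"
    using maximal[OF subring_set_adjoin[OF subring] adjoin_superset[OF subring]]
      adjoin_self[OF subring] assms by blast
  then show thesis using that unfolding adjoin_def by force
qed

text \<open>If \<open>s = 1 - p a\<close> were no unit, adjoining \<open>1/s\<close> would bring in \<open>1/p\<close>, that is \<open>s\<^sup>n / p \<in> A\<close> for some \<open>n\<close>. But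
  \<open>s\<^sup>n\<close> is again of the form \<open>1 - p c\<close>, so \<open>1/p\<close> would already lie in \<open>A\<close>.\<close>

lemma inverse_one_minus:
  assumes a: "a \<in> A"
  shows "inverse (1 - \<pi> * a) \<in> A"
proof (rule ccontr)
  define s where "s = 1 - \<pi> * a"
  assume "inverse (1 - \<pi> * a) \<notin> A"
  then obtain q where q: "\<And>i. coeff q i \<in> A" "poly q (inverse s) = inverse \<pi>"
    using inverse_in_adjoin unfolding s_def by blast
  have "s \<noteq> 0"
  proof
    assume "s = 0"
    then have "inverse \<pi> = a" by (intro inverse_unique) (simp add: s_def)
    with a inverse_notin show False by simp
  qed
  have sA: "s \<in> A" unfolding s_def by (intro A_closed a)
  define n where "n = degree q"
  have "s ^ n * inverse \<pi> = (\<Sum>i\<le>n. coeff q i * s ^ (n - i))"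
    unfolding q(2)[symmetric] poly_altdef sum_distrib_left n_def
    by (rule sum.cong) (use \<open>s \<noteq> 0\<close> in \<open>auto simp: power_diff field_simps\<close>)
  then have 1: "s ^ n * inverse \<pi> \<in> A"
    by (auto intro!: A_sum A_closed q sA)
  have "\<exists>c\<in>A. s ^ k = 1 - \<pi> * c" for k
  proof (induction k)
    case 0
    then show ?case by (intro bexI[of _ 0]) (auto intro: A_closed)
  next
    case (Suc k)
    then obtain c where c: "c \<in> A" "s ^ k = 1 - \<pi> * c" by blast
    show ?case
      by (rule bexI[of _ "a + c - \<pi> * a * c"])
         (use c a in \<open>auto simp: s_def[symmetric] intro!: A_closed\<close>, simp add: s_def algebra_simps)
  qed
  then obtain c where c: "c \<in> A" "s ^ n = 1 - \<pi> * c" by blast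
  have "inverse \<pi> = s ^ n * inverse \<pi> + c"
    using c(2) by (simp add: field_simps)
  with 1 c(1) have "inverse \<pi> \<in> A" by (metis A_closed(6))
  with inverse_notin show False by simp
qed

text \<open>The core of the valuation property. Of two representations of \<open>1/p\<close>, as polynomials in \<open>x\<close> and in
  \<open>1/x\<close>, the one of larger degree can be shortened: the other one, divided by its invertible
  constant part, expresses the leading power through lower ones. The descent ends in a constant
  representation, which is impossible. The situation is symmetric in \<open>x\<close> and \<open>1/x\<close>.\<close>

lemma no_two_representations:
  assumes "degree q \<le> m" "\<And>i. coeff q i \<in> A" "poly q x = inverse \<pi>"
    and "degree r \<le> n" "\<And>i. coeff r i \<in> A" "poly r (inverse x) = inverse \<pi>"
  shows False
  using assms
proof (induction "m + n" arbitrary: m n q r x rule: less_induct)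
  case less
  have reduce: False
    if "n \<le> m" and q: "degree q \<le> m" "\<And>i. coeff q i \<in> A" "poly q x = inverse \<pi>"
      and r: "degree r \<le> n" "\<And>i. coeff r i \<in> A" "poly r (inverse x) = inverse \<pi>"
      and IH: "\<And>q'. degree q' \<le> m - 1 \<Longrightarrow> m > 0 \<Longrightarrow> (\<And>i. coeff q' i \<in> A) \<Longrightarrow> poly q' x = inverse \<pi> \<Longrightarrow> False"
    for m n q r and x :: 'a
  proof (cases "m = 0 \<or> x = 0")
    case True
    then have "poly q x = coeff q 0"
      using q(1) by (auto simp: poly_0_coeff_0 poly_altdef)
    with q inverse_notin show False by metis
  next
    case False
    then have m: "m > 0" and x: "x \<noteq> 0" by auto
    define w where "w = inverse (1 - \<pi> * coeff r 0)"
    have wA: "w \<in> A" unfolding w_def by (intro inverse_one_minus r)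
    have u0: "1 - \<pi> * coeff r 0 \<noteq> 0"
    proof
      assume "1 - \<pi> * coeff r 0 = 0"
      then have "inverse \<pi> = coeff r 0" by (intro inverse_unique) simp
      with r inverse_notin show False by metis
    qed
    have "inverse \<pi> = (\<Sum>j\<le>n. coeff r j * inverse x ^ j)"
      using r(3) poly_eq_sum[OF r(1), of "inverse x"] by simp
    then have "1 = \<pi> * (\<Sum>j\<le>n. coeff r j * inverse x ^ j)"
      by (metis \<pi>_nonzero right_inverse)
    also have "{..n} = insert 0 {1..n}" by auto
    also have "\<pi> * (\<Sum>j\<in>insert 0 {1..n}. coeff r j * inverse x ^ j)
      = \<pi> * coeff r 0 + \<pi> * (\<Sum>j=1..n. coeff r j * inverse x ^ j)"
      by (simp add: algebra_simps)
    finally have "1 - \<pi> * coeff r 0 = \<pi> * (\<Sum>j=1..n. coeff r j * inverse x ^ j)"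
      by (simp add: algebra_simps)
    then have one: "1 = w * (\<pi> * (\<Sum>j=1..n. coeff r j * inverse x ^ j))"
      using u0 unfolding w_def by (metis left_inverse)
    define q' where "q' = (\<Sum>i<m. monom (coeff q i) i)
       + (\<Sum>j=1..n. monom (coeff q m * w * \<pi> * coeff r j) (m - j))"
    have deg: "degree q' \<le> m - 1"
      unfolding q'_def using m \<open>n \<le> m\<close>
      by (intro degree_add_le degree_sum_le order.trans[OF degree_monom_le]) auto
    have co: "coeff q' i \<in> A" for i
      unfolding q'_def coeff_add coeff_sum coeff_monom
      by (auto intro!: A_sum A_closed(6) A_closed q r wA)
    have "poly q' x = (\<Sum>i<m. coeff q i * x ^ i)
        + (\<Sum>j=1..n. coeff q m * w * \<pi> * coeff r j * x ^ (m - j))"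
      by (simp add: q'_def poly_sum poly_monom)
    also have "(\<Sum>j=1..n. coeff q m * w * \<pi> * coeff r j * x ^ (m - j))
        = coeff q m * x ^ m * (w * (\<pi> * (\<Sum>j=1..n. coeff r j * inverse x ^ j)))"
      unfolding sum_distrib_left
    proof (intro sum.cong refl)
      fix j assume "j \<in> {1..n}"
      then have "x ^ (m - j) = x ^ m * inverse x ^ j"
        using x \<open>n \<le> m\<close> by (simp add: power_diff field_simps)
      then show "coeff q m * w * \<pi> * coeff r j * x ^ (m - j)
        = coeff q m * x ^ m * (w * (\<pi> * (coeff r j * inverse x ^ j)))"
        by simp
    qed
    also have "\<dots> = coeff q m * x ^ m" using one by simp
    also have "(\<Sum>i<m. coeff q i * x ^ i) + coeff q m * x ^ m = poly q x"
      using poly_eq_sum[OF q(1), of x] by (simp add: lessThan_Suc_atMost[symmetric])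
    finally show False using IH[OF deg m co] q(3) by simp
  qed
  show False
  proof (cases "n \<le> m")
    case True
    show False
      by (rule reduce[OF True less.prems(1-6)])
         (use less.hyps[of "m - 1" n] less.prems in \<open>auto\<close>)
  next
    case False
    have "poly q (inverse (inverse x)) = inverse \<pi>" using less.prems by simp
    from reduce[OF _ less.prems(4-6,1,2) this] show False
      using less.hyps[of m "n - 1"] less.prems False by (auto simp: less_imp_le)
  qed
qed

lemma mem_or_inverse_mem: "x \<in> A \<or> inverse x \<in> A"
proof (rule ccontr)
  assume "\<not> (x \<in> A \<or> inverse x \<in> A)"
  then obtain q r where "\<And>i. coeff q i \<in> A" "poly q x = inverse \<pi>"
    "\<And>i. coeff r i \<in> A" "poly r (inverse x) = inverse \<pi>"
    by (metis inverse_in_adjoin)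
  then show False using no_two_representations[of q _ x r] by blast
qed

lemma mem_if_power_mem:
  assumes "y ^ n \<in> A" "n > 0"
  shows "y \<in> A"
proof (rule ccontr)
  assume y: "y \<notin> A"
  have "y \<noteq> 0" using y A_closed(2) by metis
  from y have "inverse y \<in> A" using mem_or_inverse_mem by blast
  then have "y ^ n * inverse y ^ (n - 1) \<in> A" using assms by (intro A_closed(4) A_closed(7)[of "inverse y"])
  moreover have "y ^ n * inverse y ^ (n - 1) = y"
    using assms(2) \<open>y \<noteq> 0\<close> by (cases n) (auto simp: field_simps)
  ultimately show False using y by simp
qed

lemma inverse_of_int_mem:
  assumes "\<not> int p dvd n"
  shows "inverse (of_int n) \<in> A"
proof -
  have "coprime n (int p)"
    using prime assms by (metis coprime_commute prime_imp_coprime_int prime_nat_int_transfer)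
  then obtain u v where uv: "u * n + v * int p = 1"
    by (metis bezout_int coprime_iff_gcd_eq_1)
  then have "of_int u * of_int n = 1 - \<pi> * (of_int v :: 'a)"
    by (metis add_diff_cancel_right' mult.commute of_int_1 of_int_add of_int_mult of_int_of_nat_eq)
  then have "inverse (of_int u * of_int n) \<in> A"
    using inverse_one_minus[of "of_int v"] A_closed by metis
  then have "of_int u * inverse (of_int u * of_int n) \<in> A" by (intro A_closed)
  moreover have u: "u \<noteq> 0"
  proof
    assume "u = 0"
    then have "int p dvd 1" using uv by (metis add_0 dvd_triv_right mult_zero_left)
    then show False using prime by (auto simp: prime_nat_iff)
  qed
  have "of_int u * inverse (of_int u * of_int n) = inverse (of_int n :: 'a)"
    using u by (simp add: mult.assoc[symmetric])
  ultimately show ?thesis by (simp only:)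
qed

text \<open>A valuation ring contains the roots of monic equations over itself, and of an integral leading
  coefficient only the power of \<open>p\<close> is not a unit. This makes the valuation real valued: every
  element is comparable with powers of \<open>p\<close>.\<close>

lemma scaled_algebraic_mem:
  obtains k where "\<pi> ^ k * x \<in> A"
proof (cases "x \<in> A")
  case True
  then show thesis using that[of 0] by simp
next
  case False
  then have y: "inverse x \<in> A" using mem_or_inverse_mem by blast
  have x: "x \<noteq> 0" using False A_closed(2) by auto
  obtain P :: "int poly" where P: "P \<noteq> 0" "poly (map_poly of_int P) x = 0"
    using algebraic by (rule algebraicE')
  define d where "d = degree P"
  have lc: "coeff P d \<noteq> 0" using P by (simp add: d_def)
  obtain N' where N': "coeff P d = int p ^ multiplicity (int p) (coeff P d) * N'" "\<not> int p dvd N'"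
    using multiplicity_decompose'[OF lc, of "int p"] prime
    by (metis mult.commute not_prime_unit prime_nat_int_transfer)
  define k where "k = multiplicity (int p) (coeff P d)"
  have "N' \<noteq> 0" using N'(2) by auto
  have "(\<Sum>i\<le>d. of_int (coeff P i) * x ^ i) = 0"
    using P(2) by (simp add: poly_altdef degree_map_poly coeff_map_poly d_def)
  then have "of_int (coeff P d) * x ^ d = - (\<Sum>i<d. of_int (coeff P i) * x ^ i)"
    by (simp add: lessThan_Suc_atMost[symmetric] add_eq_0_iff)
  moreover have "d > 0"
  proof (rule ccontr)
    assume "\<not> d > 0"
    then have "degree P = 0" by (simp add: d_def)
    then obtain c where "P = [:c:]" by (rule degree_eq_zeroE)
    with P show False by (simp add: map_poly_pCons)
  qed
  ultimately have "of_int (coeff P d) * x = - (\<Sum>i<d. of_int (coeff P i) * x ^ i) * inverse x ^ (d - 1)"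
    using x by (cases d) (auto simp: field_simps)
  also have "\<dots> = - (\<Sum>i<d. of_int (coeff P i) * inverse x ^ (d - 1 - i))"
    unfolding sum_distrib_right minus_mult_left[symmetric]
    by (intro arg_cong[of _ _ uminus] sum.cong refl) (use x in \<open>auto simp: power_diff field_simps\<close>)
  also have "\<dots> \<in> A" by (intro A_closed A_sum y)
  finally have "inverse (of_int N') * (of_int (coeff P d) * x) \<in> A"
    using inverse_of_int_mem[OF N'(2)] by (rule A_closed(4)[rotated])
  moreover have "of_int (coeff P d) = (of_int N' :: 'a) * \<pi> ^ k"
    by (subst N'(1)) (simp add: k_def)
  then have "inverse (of_int N') * (of_int (coeff P d) * x) = \<pi> ^ k * x"
    using \<open>N' \<noteq> 0\<close> by (simp add: field_simps)
  ultimately show thesis using that by metis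
qed

text \<open>The lower Dedekind cut of the valuation of \<open>x\<close>, normalised by \<open>val p = 1\<close>: the rational numbers
  \<open>k/n\<close> for which \<open>x\<^sup>n / p\<^sup>k\<close> lies in \<open>A\<close>.\<close>

definition exponents :: "'a \<Rightarrow> real set" where
  "exponents x = {real_of_int k / real n | k n. n > 0 \<and> x ^ n * \<pi> powi (- k) \<in> A}"

definition val :: "'a \<Rightarrow> real" where
  "val x = Sup (exponents x)"

lemma pi_powi_add: "\<pi> powi (k + l) = \<pi> powi k * \<pi> powi l"
  by (simp add: power_int_add)

lemma pi_powi_power: "(\<pi> powi k) ^ n = \<pi> powi (k * int n)"
  by (simp add: power_int_mult)

lemma pi_powi_mem_iff: "\<pi> powi k \<in> A \<longleftrightarrow> k \<ge> 0"
proof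
  assume k: "\<pi> powi k \<in> A"
  show "k \<ge> 0"
  proof (rule ccontr)
    assume "\<not> k \<ge> 0"
    then have "\<pi> powi k * \<pi> ^ nat (- k - 1) = \<pi> powi (k + int (nat (- k - 1)))"
      by (simp only: pi_powi_add power_int_of_nat)
    also have "\<dots> = inverse \<pi>" using \<open>\<not> k \<ge> 0\<close> by (simp add: power_int_minus)
    finally have "\<pi> powi k * \<pi> ^ nat (- k - 1) = inverse \<pi>" .
    moreover have "\<pi> powi k * \<pi> ^ nat (- k - 1) \<in> A" using k by (intro A_closed)
    ultimately show False using inverse_notin by simp
  qed
next
  assume "k \<ge> 0"
  then show "\<pi> powi k \<in> A" by (simp add: power_int_def A_closed)
qed

lemma exponents_bounds:
  assumes "x \<noteq> 0"
  obtains K L :: nat where "- real K \<in> exponents x" "\<And>e. e \<in> exponents x \<Longrightarrow> e \<le> real L"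
proof -
  obtain K where K: "\<pi> ^ K * x \<in> A" using scaled_algebraic_mem by blast
  obtain L where L: "\<pi> ^ L * inverse x \<in> A" using scaled_algebraic_mem by blast
  have "- real K \<in> exponents x"
    unfolding exponents_def using K
    by (intro CollectI exI[of _ "- int K"] exI[of _ 1]) (auto simp: mult.commute)
  moreover have "e \<le> real L" if e_mem: "e \<in> exponents x" for e
  proof -
    obtain k n where e: "e = real_of_int k / real n" "n > 0" "x ^ n * \<pi> powi (- k) \<in> A"
      using e_mem unfolding exponents_def by blast
    have "(\<pi> ^ L * inverse x) ^ n * x ^ n = (\<pi> ^ L * inverse x * x) ^ n"
      by (simp only: power_mult_distrib)
    also have "\<dots> = \<pi> ^ (L * n)" using assms by (simp add: power_mult mult.assoc)
    finally have "(\<pi> ^ L * inverse x) ^ n * (x ^ n * \<pi> powi (- k)) = \<pi> ^ (L * n) * \<pi> powi (- k)"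
      by (simp only: mult.assoc[symmetric])
    also have "\<dots> = \<pi> powi (int (L * n) - k)"
      by (simp only: diff_conv_add_uminus pi_powi_add power_int_of_nat)
    finally have "(\<pi> ^ L * inverse x) ^ n * (x ^ n * \<pi> powi (- k)) = \<pi> powi (int (L * n) - k)" .
    moreover have "(\<pi> ^ L * inverse x) ^ n * (x ^ n * \<pi> powi (- k)) \<in> A"
      by (intro A_closed(4) A_closed(7)[OF L] e(3))
    ultimately have "k \<le> int (L * n)" by (simp only: pi_powi_mem_iff)
    then have "real_of_int k \<le> real L * real n" by (metis of_int_le_iff of_int_of_nat_eq of_nat_mult)
    then show ?thesis using e(1,2) by (simp add: divide_le_eq)
  qed
  ultimately show thesis by (rule that)
qed

lemma exponents_nonempty: "x \<noteq> 0 \<Longrightarrow> exponents x \<noteq> {}"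
  by (metis empty_iff exponents_bounds)

lemma bdd_above_exponents: "x \<noteq> 0 \<Longrightarrow> bdd_above (exponents x)"
  by (metis bdd_aboveI exponents_bounds)

lemma le_val:
  assumes "x \<noteq> 0" "n > 0" "x ^ n * \<pi> powi (- k) \<in> A"
  shows "real_of_int k \<le> real n * val x"
proof -
  have "real_of_int k / real n \<le> val x"
    unfolding val_def using assms by (intro cSup_upper bdd_above_exponents) (auto simp: exponents_def)
  then show ?thesis using assms(2) by (simp add: field_simps)
qed

text \<open>The set of exponents is closed downwards: if \<open>k/n\<close> is below an exponent \<open>l/m\<close>, then the \<open>m\<close>-th power
  of \<open>x\<^sup>n / p\<^sup>k\<close> lies in \<open>A\<close>, hence so does the element itself.\<close>

lemma mem_if_less_val:
  assumes "x \<noteq> 0" "real_of_int k < real n * val x" "n > 0"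
  shows "x ^ n * \<pi> powi (- k) \<in> A"
proof -
  have "real_of_int k / real n < val x" using assms by (simp add: field_simps)
  moreover have "exponents x \<noteq> {}" using assms(1) by (rule exponents_nonempty)
  ultimately obtain e where "e \<in> exponents x" "real_of_int k / real n < e"
    unfolding val_def using less_cSup_iff bdd_above_exponents[OF assms(1)] by blast
  then obtain l m where l: "real_of_int k / real n < real_of_int l / real m" "m > 0" "x ^ m * \<pi> powi (- l) \<in> A"
    unfolding exponents_def by blast
  have "real_of_int k * real m < real_of_int l * real n"
    using l(1,2) assms(3) by (simp add: field_simps)
  then have kl: "k * int m < l * int n" by (metis of_int_less_iff of_int_mult of_int_of_nat_eq)
  have "(x ^ n * \<pi> powi (- k)) ^ m = (x ^ m * \<pi> powi (- l)) ^ n * \<pi> powi (l * int n - k * int m)"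
  proof -
    have "(x ^ n * \<pi> powi (- k)) ^ m = x ^ (n * m) * \<pi> powi (- k * int m)"
      by (simp only: power_mult_distrib power_mult[symmetric] pi_powi_power)
    moreover have "(x ^ m * \<pi> powi (- l)) ^ n = x ^ (n * m) * \<pi> powi (- l * int n)"
      by (simp only: power_mult_distrib power_mult[symmetric] pi_powi_power mult.commute[of m n])
    moreover have "\<pi> powi (- k * int m) = \<pi> powi (- l * int n) * \<pi> powi (l * int n - k * int m)"
      by (simp flip: pi_powi_add)
    ultimately show ?thesis by simp
  qed
  also have "\<dots> \<in> A" 
    using kl by (intro A_closed(4) A_closed(7)[OF l(3)]) (simp add: pi_powi_mem_iff)
  finally show ?thesis using mem_if_power_mem l(2) by blast
qed

text \<open>Passes from approximations with denominator \<open>n\<close>, up to \<open>O(1/n)\<close>, to real inequalities.\<close>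

lemma real_le_if_multiples_bounded:
  fixes X Y C :: real
  assumes "\<And>n::nat. n > 0 \<Longrightarrow> real n * X \<le> real n * Y + C"
  shows "X \<le> Y"
proof (rule ccontr)
  assume "\<not> X \<le> Y"
  then obtain n :: nat where n: "C < real n * (X - Y)"
    using reals_Archimedean3[of "X - Y"] by auto
  have "C < real (Suc n) * (X - Y)" using n \<open>\<not> X \<le> Y\<close> by (simp add: algebra_simps)
  then show False using assms[of "Suc n"] by (simp add: algebra_simps)
qed

lemma val_mult_ge:
  assumes "x \<noteq> 0" "y \<noteq> 0"
  shows "val x + val y \<le> val (x * y)"
proof (rule real_le_if_multiples_bounded[where C = 2])
  fix n :: nat assume n: "n > 0"
  \<comment> \<open>The largest integers strictly below \<open>n val x\<close> and \<open>n val y\<close>; each loses at most \<open>1\<close>.\<close>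
  define k l where "k = \<lceil>real n * val x\<rceil> - 1" and "l = \<lceil>real n * val y\<rceil> - 1"
  have k: "real_of_int k < real n * val x" "real n * val x \<le> k + 1" unfolding k_def by linarith+
  have l: "real_of_int l < real n * val y" "real n * val y \<le> l + 1" unfolding l_def by linarith+
  have "(x ^ n * \<pi> powi (- k)) * (y ^ n * \<pi> powi (- l)) \<in> A"
    using assms k l n by (intro A_closed(4) mem_if_less_val)
  also have "(x ^ n * \<pi> powi (- k)) * (y ^ n * \<pi> powi (- l)) = (x * y) ^ n * (\<pi> powi (- k) * \<pi> powi (- l))"
    by (simp only: power_mult_distrib ac_simps)
  also have "\<pi> powi (- k) * \<pi> powi (- l) = \<pi> powi (- (k + l))"
    by (simp flip: pi_powi_add)
  finally have "(x * y) ^ n * \<pi> powi (- (k + l)) \<in> A" .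
  then have "real_of_int (k + l) \<le> real n * val (x * y)"
    using assms n by (intro le_val) auto
  with k l show "real n * (val x + val y) \<le> real n * val (x * y) + 2"
    by (simp add: algebra_simps)
qed

text \<open>If \<open>k/n\<close> exceeds the valuation of \<open>x\<close>, then \<open>x\<^sup>n / p\<^sup>k\<close> is not in \<open>A\<close>, so its inverse is.\<close>

lemma val_inverse_ge:
  assumes "x \<noteq> 0"
  shows "- val x \<le> val (inverse x)"
proof (rule real_le_if_multiples_bounded[where C = 1])
  fix n :: nat assume n: "n > 0"
  define k where "k = \<lfloor>real n * val x\<rfloor> + 1"
  have k: "real_of_int k > real n * val x" "real_of_int k \<le> real n * val x + 1" unfolding k_def by linarith+
  then have "x ^ n * \<pi> powi (- k) \<notin> A" using le_val[OF assms n, of k] by linarith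
  then have "inverse (x ^ n * \<pi> powi (- k)) \<in> A" using mem_or_inverse_mem by blast
  then have "inverse x ^ n * \<pi> powi (- (- k)) \<in> A"
    by (simp add: power_int_minus power_inverse)
  then have "real_of_int (- k) \<le> real n * val (inverse x)"
    using assms n by (intro le_val) auto
  with k show "real n * - val x \<le> real n * val (inverse x) + 1"
    by (simp add: algebra_simps)
qed

lemma val_nonneg:
  assumes "x \<in> A" "x \<noteq> 0"
  shows "val x \<ge> 0"
  using le_val[of x 1 0] assms by simp

lemma val_one: "val 1 = 0"
proof (rule antisym)
  show "val 1 \<le> 0"
    unfolding val_def
  proof (rule cSup_least)
    show "exponents 1 \<noteq> {}" by (intro exponents_nonempty) simp
    fix e assume "e \<in> exponents 1"
    then obtain k n where "e = real_of_int k / real n" "n > 0" "\<pi> powi (- k) \<in> A"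
      unfolding exponents_def by auto
    then show "e \<le> 0" using pi_powi_mem_iff[of "- k"] by (simp add: divide_nonpos_pos)
  qed
qed (use A_closed in \<open>auto intro: val_nonneg\<close>)

lemma val_inverse: "x \<noteq> 0 \<Longrightarrow> val (inverse x) = - val x"
  using val_inverse_ge[of x] val_mult_ge[of x "inverse x"] val_one by simp

lemma val_mult: "x \<noteq> 0 \<Longrightarrow> y \<noteq> 0 \<Longrightarrow> val (x * y) = val x + val y"
  using val_mult_ge[of x y] val_mult_ge[of "x * y" "inverse y"] val_inverse[of y]
  by (simp add: mult.assoc)

lemma val_power: "x \<noteq> 0 \<Longrightarrow> val (x ^ n) = real n * val x"
  by (induction n) (auto simp: val_one val_mult algebra_simps)

lemma val_pi: "val \<pi> = 1"
proof (rule antisym)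
  show "1 \<le> val \<pi>" using le_val[of \<pi> 1 1] A_closed by (simp add: power_int_minus)
  have "- 1 \<le> val (inverse \<pi>)" using le_val[of "inverse \<pi>" 1 "-1"] A_closed by simp
  then show "val \<pi> \<le> 1" using val_inverse[of \<pi>] by simp
qed

lemma val_add:
  assumes "x \<noteq> 0" "y \<noteq> 0" "x + y \<noteq> 0"
  shows "min (val x) (val y) \<le> val (x + y)"
proof -
  have *: "val y \<le> val (x + y)" if "x * inverse y \<in> A" "y \<noteq> 0" "x + y \<noteq> 0" for x y :: 'a
  proof -
    have "1 + x * inverse y \<in> A" by (rule A_closed(6)[OF A_closed(1) that(1)])
    moreover have eq: "x + y = y * (1 + x * inverse y)" using that by (simp add: field_simps)
    then have "1 + x * inverse y \<noteq> 0" using that(3) by auto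
    ultimately show ?thesis using that(2) by (subst eq) (simp add: val_mult val_nonneg)
  qed
  have "inverse (x * inverse y) = y * inverse x" by (simp add: mult.commute)
  then have "x * inverse y \<in> A \<or> y * inverse x \<in> A" using mem_or_inverse_mem by metis
  then show ?thesis using *[of x y] *[of y x] assms by (auto simp: add.commute)
qed

lemma val_of_int:
  assumes "n \<noteq> 0"
  shows "val (of_int n) = real (multiplicity (int p) n)"
proof -
  obtain m where m: "n = int p ^ multiplicity (int p) n * m" "\<not> int p dvd m"
    using multiplicity_decompose'[OF assms, of "int p"] prime
    by (metis mult.commute not_prime_unit prime_nat_int_transfer)
  then have m0: "of_int m \<noteq> (0::'a)" by auto
  have "val (of_int m) \<ge> 0" "val (inverse (of_int m)) \<ge> 0"
    using inverse_of_int_mem[OF m(2)] m0 by (auto intro!: val_nonneg A_closed)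
  then have "val (of_int m) = 0" using val_inverse[OF m0] by simp
  moreover have "of_int n = \<pi> ^ multiplicity (int p) n * of_int m"
    by (subst m(1)) simp
  ultimately show ?thesis using m0 by (simp add: val_mult val_power val_pi)
qed

lemma val_of_rat:
  assumes "r \<noteq> 0"
  shows "val (of_rat r) = real (multiplicity (int p) (fst (quotient_of r)))
     - real (multiplicity (int p) (snd (quotient_of r)))"
proof -
  define n d where "n = fst (quotient_of r)" and "d = snd (quotient_of r)"
  have r: "r = of_int n / of_int d" "d > 0"
    using quotient_of_div[of r n d] quotient_of_denom_pos[of r n d] by (auto simp: n_def d_def)
  then have "n \<noteq> 0" using assms by auto
  have "of_rat r = of_int n * inverse (of_int d :: 'a)"
    by (simp add: r of_rat_divide divide_inverse of_rat_mult of_rat_inverse)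
  then show ?thesis
    using \<open>n \<noteq> 0\<close> \<open>d > 0\<close> by (simp add: val_mult val_inverse val_of_int flip: n_def d_def)
qed

definition absval :: "'a \<Rightarrow> real" where
  "absval x = (if x = 0 then 0 else real p powr (- val x))"

lemma absval_nonneg: "absval x \<ge> 0"
  by (simp add: absval_def)

lemma p_gt_1: "real p > 1"
  using prime prime_gt_1_nat by auto

lemma absval_eq_0: "absval x = 0 \<longleftrightarrow> x = 0"
  using p_gt_1 by (simp add: absval_def)

lemma absval_mult: "absval (x * y) = absval x * absval y"
  by (simp add: absval_def val_mult flip: powr_add)

lemma absval_add: "absval (x + y) \<le> max (absval x) (absval y)"
proof (cases "x = 0 \<or> y = 0 \<or> x + y = 0")
  case False
  then have "min (val x) (val y) \<le> val (x + y)" by (intro val_add) auto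
  then have "real p powr (- val (x + y)) \<le> real p powr (- min (val x) (val y))"
    using p_gt_1 by (intro powr_mono) auto
  also have "\<dots> \<le> max (real p powr (- val x)) (real p powr (- val y))"
    by (simp add: min_def)
  finally show ?thesis using False by (simp add: absval_def)
qed (auto simp: absval_def le_max_iff_disj)

lemma absval_of_rat: "absval (of_rat r) = padic_abs p r"
proof (cases "r = 0")
  case False
  then show ?thesis
    using p_gt_1 by (simp add: absval_def padic_abs_def val_of_rat flip: powr_real_of_int')
qed (simp add: absval_def padic_abs_def)

end

lemma inverse_prime_notin_Ints:
  assumes "prime (p::nat)"
  shows "inverse (of_nat p :: 'a::field_char_0) \<notin> \<int>"
proof
  assume "inverse (of_nat p :: 'a) \<in> \<int>"
  then obtain k where k: "inverse (of_nat p :: 'a) = of_int k" by (auto elim: Ints_cases)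
  have "of_nat p * inverse (of_nat p :: 'a) = 1" using assms by (auto simp: prime_gt_0_nat)
  then have "of_int (int p * k) = (of_int 1 :: 'a)" by (simp add: k)
  then have "int p * k = 1" by (simp only: of_int_eq_iff)
  then have "int p dvd 1" by (metis dvd_triv_left)
  then show False using assms by (auto simp: prime_nat_iff)
qed

text \<open>The functions in \<open>is_padic_extension\<close> live on all complex numbers but are constrained only at the
  algebraic ones, hence the detour through \<open>qbar\<close>.\<close>

theorem exists_padic_extension:
  assumes "prime p"
  shows "\<exists>v. is_padic_extension p v"
proof -
  obtain A :: "qbar set" where A: "subring_set A" "inverse (of_nat p) \<notin> A"
      "\<And>B. subring_set B \<Longrightarrow> A \<subseteq> B \<Longrightarrow> inverse (of_nat p) \<notin> B \<Longrightarrow> B = A"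
    using exists_maximal_subring[OF inverse_prime_notin_Ints[OF assms]] by metis
  interpret maximal_without_inverse p A
    by unfold_locales (use A assms algebraic_qbar in auto)
  define v where "v x = absval (Abs_qbar x)" for x
  have "is_padic_extension p v"
    unfolding is_padic_extension_def
  proof (intro conjI allI impI)
    fix x y :: complex and r :: rat
    assume x: "algebraic x"
    show "v x \<ge> 0" by (simp add: v_def absval_nonneg)
    have "Abs_qbar x = 0 \<longleftrightarrow> x = 0"
      using x Abs_qbar_inject[of x 0] by (simp add: zero_qbar_def)
    then show "v x = 0 \<longleftrightarrow> x = 0" by (simp add: v_def absval_eq_0)
    assume y: "algebraic y"
    have "Abs_qbar (x * y) = Abs_qbar x * Abs_qbar y" "Abs_qbar (x + y) = Abs_qbar x + Abs_qbar y"
      using x y by (simp_all add: times_qbar.abs_eq plus_qbar.abs_eq eq_onp_def)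
    then show "v (x * y) = v x * v y" "v (x + y) \<le> max (v x) (v y)"
      by (simp_all add: v_def absval_mult absval_add)
  next
    fix r :: rat
    have "Abs_qbar (of_rat r) = of_rat r"
      by (metis complex_of_qbar_of_rat complex_of_qbar_inverse)
    then show "v (of_rat r) = padic_abs p r" by (simp add: v_def absval_of_rat)
  qed
  then show ?thesis by blast
qed

lemma is_padic_extension_padic_abs_ext: "prime p \<Longrightarrow> is_padic_extension p (padic_abs_ext p)"
  unfolding padic_abs_ext_def using exists_padic_extension by (metis someI_ex)

section \<open>Embeddings and conjugates\<close>

lemma algebraic_poly:
  assumes "\<And>i. algebraic (coeff p i)" "algebraic x"
  shows "algebraic (poly p x)"
  using assms(1)
proof (induction p)
  case (pCons c p)
  have "algebraic c" using pCons(3)[of 0] by simp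
  moreover have "algebraic (coeff p i)" for i using pCons(3)[of "Suc i"] by simp
  ultimately show ?case using pCons(2) assms(2) by (auto intro!: algebraic_add_mult)
qed simp

text \<open>A ring homomorphism, defined on a ring \<open>K\<close> of algebraic numbers that contains the rationals; such a
  ring is automatically a field. Values outside of \<open>K\<close> are arbitrary.\<close>

definition embedding :: "complex set \<Rightarrow> (complex \<Rightarrow> complex) \<Rightarrow> bool" where
  "embedding K \<phi> \<longleftrightarrow> subring_set K \<and> (\<forall>x\<in>K. algebraic x) \<and>
     (\<forall>r. of_rat r \<in> K \<and> \<phi> (of_rat r) = of_rat r) \<and>
     (\<forall>x\<in>K. \<forall>y\<in>K. \<phi> (x + y) = \<phi> x + \<phi> y \<and> \<phi> (x * y) = \<phi> x * \<phi> y)"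

locale embed =
  fixes K :: "complex set" and \<phi> :: "complex \<Rightarrow> complex"
  assumes emb: "embedding K \<phi>"
begin

lemma K_subring: "subring_set K" using emb by (simp add: embedding_def)
lemmas K_closed = subring_set_closed[OF K_subring] subring_set_power[OF K_subring]
lemmas K_sum = subring_set_sum[OF K_subring]
lemma K_algebraic: "x \<in> K \<Longrightarrow> algebraic x" using emb by (simp add: embedding_def)
lemma K_rat: "of_rat r \<in> K" and phi_rat [simp]: "\<phi> (of_rat r) = of_rat r"
  using emb by (simp_all add: embedding_def)
lemma phi_add: "x \<in> K \<Longrightarrow> y \<in> K \<Longrightarrow> \<phi> (x + y) = \<phi> x + \<phi> y"
  and phi_mult: "x \<in> K \<Longrightarrow> y \<in> K \<Longrightarrow> \<phi> (x * y) = \<phi> x * \<phi> y"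
  using emb by (simp_all add: embedding_def)
lemma phi_0 [simp]: "\<phi> 0 = 0" and phi_1 [simp]: "\<phi> 1 = 1"
  using phi_rat[of 0] phi_rat[of 1] by simp_all
lemma phi_minus: "x \<in> K \<Longrightarrow> \<phi> (- x) = - \<phi> x"
  using phi_add[of x "- x"] K_closed by (simp add: eq_neg_iff_add_eq_0 add.commute)
lemma phi_diff: "x \<in> K \<Longrightarrow> y \<in> K \<Longrightarrow> \<phi> (x - y) = \<phi> x - \<phi> y"
  using phi_add[of x "- y"] phi_minus[of y] K_closed by simp
lemma phi_power: "x \<in> K \<Longrightarrow> \<phi> (x ^ n) = \<phi> x ^ n"
  by (induction n) (simp_all add: phi_mult K_closed)
lemma phi_sum: "(\<And>i. i \<in> I \<Longrightarrow> f i \<in> K) \<Longrightarrow> \<phi> (sum f I) = (\<Sum>i\<in>I. \<phi> (f i))"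
  by (induction I rule: infinite_finite_induct) (auto simp: phi_add K_sum)

lemma K_rat_poly: "x \<in> K \<Longrightarrow> poly (map_poly of_rat p) x \<in> K"
  by (induction p) (auto simp: map_poly_pCons intro!: K_closed K_rat)

lemma phi_rat_poly:
  "x \<in> K \<Longrightarrow> \<phi> (poly (map_poly of_rat p) x) = poly (map_poly of_rat p) (\<phi> x)"
  by (induction p) (simp_all add: map_poly_pCons phi_add phi_mult K_closed K_rat K_rat_poly)

text \<open>A polynomial equation with nonzero constant term expresses \<open>1/x\<close> as a polynomial in \<open>x\<close>.\<close>

lemma K_inverse:
  assumes "x \<in> K" "x \<noteq> 0"
  shows "inverse x \<in> K"
proof -
  obtain P :: "rat poly" where P: "P \<noteq> 0" "poly (map_poly of_rat P) x = 0"
    using K_algebraic[OF assms(1)] algebraic_iff_rat_poly by blast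
  then show ?thesis
  proof (induction P)
    case (pCons c Q)
    have eq: "of_rat c + x * poly (map_poly of_rat Q) x = 0"
      using pCons by (simp add: map_poly_pCons)
    show ?case
    proof (cases "c = 0")
      case True
      then show ?thesis using pCons eq assms by auto
    next
      case False
      then have "x * (of_rat (- 1 / c) * poly (map_poly of_rat Q) x) = 1"
        using eq by (simp add: of_rat_divide of_rat_minus field_simps add_eq_0_iff)
      then have "inverse x = of_rat (- 1 / c) * poly (map_poly of_rat Q) x"
        by (rule inverse_unique)
      then show ?thesis using K_rat_poly[OF assms(1)] K_closed K_rat by metis
    qed
  qed simp
qed

lemma phi_eq_0_iff: "x \<in> K \<Longrightarrow> \<phi> x = 0 \<longleftrightarrow> x = 0"
  using phi_mult[of x "inverse x"] K_inverse[of x] by (cases "x = 0") auto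

lemma phi_conjugates:
  assumes "x \<in> K"
  shows "\<phi> x \<in> conjugates x"
  unfolding conjugates_def using assms
  by (auto simp flip: phi_rat_poly simp: phi_eq_0_iff K_rat_poly)

lemma map_poly_phi_ring_ops:
  assumes "\<And>i. coeff g i \<in> K" "\<And>i. coeff h i \<in> K"
  shows "map_poly \<phi> (g + h) = map_poly \<phi> g + map_poly \<phi> h"
    and "map_poly \<phi> (g - h) = map_poly \<phi> g - map_poly \<phi> h"
    and "map_poly \<phi> (g * h) = map_poly \<phi> g * map_poly \<phi> h"
  using assms
  by (auto simp: poly_eq_iff coeff_map_poly phi_add phi_diff coeff_mult phi_sum phi_mult K_closed)

text \<open>The extension sends \<open>g(a)\<close> to \<open>g\<^sup>\<phi>(a')\<close>. The hypothesis on \<open>a'\<close> is what makes this independent of the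
  polynomial \<open>g\<close> that represents the element.\<close>

lemma extension_if_root:
  assumes a: "algebraic a"
    and root: "\<And>g. (\<And>i. coeff g i \<in> K) \<Longrightarrow> poly g a = 0 \<Longrightarrow> poly (map_poly \<phi> g) a' = 0"
  obtains \<psi> where "embedding (adjoin K a) \<psi>" "\<And>x. x \<in> K \<Longrightarrow> \<psi> x = \<phi> x" "\<psi> a = a'"
proof -
  define rep where "rep x = (SOME g. (\<forall>i. coeff g i \<in> K) \<and> poly g a = x)" for x
  define \<psi> where "\<psi> x = poly (map_poly \<phi> (rep x)) a'" for x
  have \<psi>: "\<psi> (poly g a) = poly (map_poly \<phi> g) a'" if g: "\<And>i. coeff g i \<in> K" for g
  proof -
    have "(\<forall>i. coeff (rep (poly g a)) i \<in> K) \<and> poly (rep (poly g a)) a = poly g a"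
      unfolding rep_def by (rule someI[of _ g]) (use g in auto)
    then have r: "\<And>i. coeff (rep (poly g a)) i \<in> K" "poly (rep (poly g a)) a = poly g a" by auto
    have "poly (map_poly \<phi> (rep (poly g a) - g)) a' = 0"
      by (rule root) (use r g in \<open>auto intro: K_closed\<close>)
    then show ?thesis using map_poly_phi_ring_ops(2)[OF r(1) g] by (simp add: \<psi>_def)
  qed
  have const: "\<psi> x = \<phi> x" if "x \<in> K" for x
    using \<psi>[of "[:x:]"] that K_closed by (simp add: coeff_pCons map_poly_pCons split: nat.splits)
  have "embedding (adjoin K a) \<psi>"
    unfolding embedding_def
  proof (intro conjI ballI allI)
    show "subring_set (adjoin K a)" by (rule subring_set_adjoin[OF K_subring])
    show "algebraic x" if "x \<in> adjoin K a" for x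
    proof -
      obtain q where q: "\<forall>i. coeff q i \<in> K" "x = poly q a"
        using \<open>x \<in> adjoin K a\<close> by (auto simp: adjoin_def)
      show ?thesis unfolding q(2) using q(1) a K_algebraic by (intro algebraic_poly) auto
    qed
    show "of_rat r \<in> adjoin K a" "\<psi> (of_rat r) = of_rat r" for r
      using K_rat adjoin_superset[OF K_subring] const by auto
    fix x y assume "x \<in> adjoin K a" "y \<in> adjoin K a"
    then obtain g h where g: "\<And>i. coeff g i \<in> K" "x = poly g a" and h: "\<And>i. coeff h i \<in> K" "y = poly h a"
      by (auto simp: adjoin_def)
    have gh: "coeff (g + h) i \<in> K" "coeff (g * h) i \<in> K" for i
      using g h by (auto simp: coeff_mult intro!: K_closed K_sum)
    show "\<psi> (x + y) = \<psi> x + \<psi> y" "\<psi> (x * y) = \<psi> x * \<psi> y"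
      using \<psi>[OF g(1)] \<psi>[OF h(1)] \<psi>[OF gh(1)] \<psi>[OF gh(2)] map_poly_phi_ring_ops[OF g(1) h(1)] g(2) h(2)
      by simp_all
  qed
  moreover have "\<psi> a = a'"
    using \<psi>[of "[:0, 1:]"] K_closed by (simp add: coeff_pCons map_poly_pCons split: nat.splits)
  ultimately show thesis using that const by blast
qed

text \<open>Take for \<open>a'\<close> a root of the image of the minimal polynomial of \<open>a\<close> over \<open>K\<close>. Every other polynomial
  that vanishes at \<open>a\<close> reduces to it by division with remainder.\<close>

lemma common_root_exists:
  assumes a: "algebraic a"
  obtains a' where "\<And>g. (\<And>i. coeff g i \<in> K) \<Longrightarrow> poly g a = 0 \<Longrightarrow> poly (map_poly \<phi> g) a' = 0"
proof -
  define D where "D d \<longleftrightarrow> (\<exists>g. (\<forall>i. coeff g i \<in> K) \<and> g \<noteq> 0 \<and> poly g a = 0 \<and> degree g = d)" for d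
  obtain P :: "rat poly" where P: "P \<noteq> 0" "poly (map_poly of_rat P) a = 0"
    using a algebraic_iff_rat_poly by blast
  have "D (degree P)"
    unfolding D_def using P
    by (intro exI[of _ "map_poly of_rat P"]) (auto simp: coeff_map_poly K_rat degree_map_poly map_poly_eq_0_iff)
  then have "D (Least D)" by (rule LeastI)
  then obtain m where m: "\<And>i. coeff m i \<in> K" "m \<noteq> 0" "poly m a = 0" "degree m = Least D"
    unfolding D_def by blast
  have least: "degree m \<le> degree g" if "\<And>i. coeff g i \<in> K" "g \<noteq> 0" "poly g a = 0" for g
  proof -
    have "D (degree g)" unfolding D_def using that by blast
    then show ?thesis using m(4) by (simp add: Least_le)
  qed
  have lc: "lead_coeff m \<noteq> 0" using m(2) by simp
  have deg: "degree (map_poly \<phi> m) = degree m"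
    using m(1) phi_eq_0_iff lc by (metis map_poly_degree_eq)
  have "degree m \<noteq> 0"
  proof
    assume "degree m = 0"
    then obtain c where "m = [:c:]" by (rule degree_eq_zeroE)
    with m(2,3) show False by simp
  qed
  then have "\<not> constant (poly (map_poly \<phi> m))"
    by (simp add: constant_degree deg)
  then obtain a' where a': "poly (map_poly \<phi> m) a' = 0"
    using fundamental_theorem_of_algebra by blast
  have "poly (map_poly \<phi> g) a' = 0" if "\<And>i. coeff g i \<in> K" "poly g a = 0" for g
    using that
  proof (induction "degree g" arbitrary: g rule: less_induct)
    case less
    show ?case
    proof (cases "g = 0")
      case False
      then have le: "degree m \<le> degree g" using least less.prems by blast
      define c where "c = lead_coeff g * inverse (lead_coeff m)"
      define q where "q = monom c (degree g - degree m)"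
      have cK: "c \<in> K" unfolding c_def using lc by (intro K_closed less.prems K_inverse m) auto
      then have qK: "coeff q i \<in> K" for i by (auto simp: q_def coeff_monom K_closed)
      then have qmK: "coeff (q * m) i \<in> K" for i by (auto simp: coeff_mult intro!: K_sum K_closed m)
      define h where "h = g - q * m"
      have hK: "coeff h i \<in> K" for i using qmK less.prems by (auto simp: h_def intro!: K_closed)
      have ha: "poly h a = 0" using less.prems m by (simp add: h_def)
      have c0: "c \<noteq> 0" using False lc by (simp add: c_def)
      have q: "q \<noteq> 0" "degree q = degree g - degree m" "lead_coeff q = c"
        using c0 by (simp_all add: q_def degree_monom_eq monom_eq_0_iff)
      then have "degree (q * m) = degree g"
        using degree_mult_eq[OF q(1) m(2)] le by simp
      moreover have "lead_coeff (q * m) = lead_coeff g"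
        using lc q(3) by (simp only: lead_coeff_mult) (simp add: c_def)
      ultimately have "h = 0 \<or> degree h < degree g"
        unfolding h_def by (intro eq_zero_or_degree_less degree_diff_le) auto
      then have "poly (map_poly \<phi> h) a' = 0"
        using less.hyps[of h] hK ha by auto
      moreover have "map_poly \<phi> g = map_poly \<phi> h + map_poly \<phi> q * map_poly \<phi> m"
        using map_poly_phi_ring_ops(1)[OF hK qmK] map_poly_phi_ring_ops(3)[OF qK m(1)] by (simp add: h_def)
      ultimately show ?thesis using a' by simp
    qed simp
  qed
  then show thesis by (rule that)
qed

lemma extension_exists:
  assumes "algebraic a"
  obtains L \<psi> where "embedding L \<psi>" "K \<subseteq> L" "a \<in> L" "\<And>x. x \<in> K \<Longrightarrow> \<psi> x = \<phi> x"
proof -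
  obtain a' where a': "\<And>g. (\<And>i. coeff g i \<in> K) \<Longrightarrow> poly g a = 0 \<Longrightarrow> poly (map_poly \<phi> g) a' = 0"
    by (rule common_root_exists[OF assms]) blast
  from extension_if_root[OF assms this] that show thesis
    using adjoin_superset[OF K_subring] adjoin_self[OF K_subring] by metis
qed

end

lemma embedding_rationals: "embedding (range of_rat) id"
  unfolding embedding_def subring_set_def
  by (auto simp flip: of_rat_add of_rat_mult of_rat_diff intro: range_eqI[of _ _ 1])

text \<open>A conjugate of \<open>t\<close> satisfies every rational equation of \<open>t\<close>, so \<open>t \<mapsto> y\<close> extends from the rationals to
  the field of \<open>t\<close>; then \<open>a\<close> and \<open>b\<close> are adjoined one after the other.\<close>

lemma exists_embedding:
  assumes t: "algebraic t" and a: "algebraic a" and b: "algebraic b" and y: "y \<in> conjugates t"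
  obtains K \<phi> where "embedding K \<phi>" "t \<in> K" "a \<in> K" "b \<in> K" "\<phi> t = y"
proof -
  interpret Q: embed "range of_rat" id by unfold_locales (rule embedding_rationals)
  have "poly (map_poly id g) y = 0"
    if g: "\<And>i. coeff g i \<in> range of_rat" "poly g t = 0" for g :: "complex poly"
  proof -
    define P where "P = map_poly (inv of_rat :: complex \<Rightarrow> rat) g"
    have inv: "inv of_rat (of_rat r :: complex) = r" for r by (simp add: inv_f_f inj_def)
    from inv[of 0] have "map_poly of_rat P = g"
      using g(1) by (auto simp: P_def poly_eq_iff coeff_map_poly f_inv_into_f)
    then show ?thesis using y g(2) by (auto simp: conjugates_def)
  qed
  then obtain \<psi> where \<psi>: "embedding (adjoin (range of_rat) t) \<psi>" "\<psi> t = y"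
    using Q.extension_if_root[OF t, of y] by metis
  interpret E: embed "adjoin (range of_rat) t" \<psi> by unfold_locales (rule \<psi>)
  obtain L \<rho> where L: "embedding L \<rho>" "adjoin (range of_rat) t \<subseteq> L" "a \<in> L"
      "\<And>x. x \<in> adjoin (range of_rat) t \<Longrightarrow> \<rho> x = \<psi> x"
    using E.extension_exists[OF a] by metis
  interpret F: embed L \<rho> by unfold_locales (rule L)
  obtain M \<sigma> where M: "embedding M \<sigma>" "L \<subseteq> M" "b \<in> M" "\<And>x. x \<in> L \<Longrightarrow> \<sigma> x = \<rho> x"
    using F.extension_exists[OF b] by metis
  have "t \<in> adjoin (range of_rat) t" by (rule adjoin_self[OF Q.K_subring])
  then have "t \<in> L" "\<rho> t = y" using L \<psi> by auto
  then show thesis using that[OF M(1)] M L by auto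
qed

lemma conjugates_self: "x \<in> conjugates x"
  by (simp add: conjugates_def)

lemma conjugates_eq: "y \<in> conjugates x \<Longrightarrow> conjugates y = conjugates x"
  by (auto simp: conjugates_def)

lemma algebraic_conjugate: "y \<in> conjugates x \<Longrightarrow> algebraic x \<Longrightarrow> algebraic y"
  by (auto simp: conjugates_def algebraic_iff_rat_poly)

lemma map_poly_of_rat_mult:
  "map_poly of_rat (p * q) = (map_poly of_rat p * map_poly of_rat q :: complex poly)"
  by (rule poly_eqI) (simp add: coeff_map_poly coeff_mult of_rat_sum of_rat_mult)

lemma minimal_polynomial_dvd:
  fixes x :: complex
  assumes "algebraic x"
  obtains P :: "rat poly" where "P \<noteq> 0" "lead_coeff P = 1" "poly (map_poly of_rat P) x = 0"
    "\<And>Q. poly (map_poly of_rat Q) x = 0 \<Longrightarrow> P dvd Q"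
proof -
  define D where "D d \<longleftrightarrow> (\<exists>P::rat poly. P \<noteq> 0 \<and> poly (map_poly of_rat P) x = 0 \<and> degree P = d)" for d
  have "\<exists>d. D d" using assms algebraic_iff_rat_poly unfolding D_def by blast
  then have "D (Least D)" by (rule LeastI_ex)
  then obtain P0 :: "rat poly" where P0: "P0 \<noteq> 0" "poly (map_poly of_rat P0) x = 0" "degree P0 = Least D"
    unfolding D_def by blast
  define P where "P = smult (inverse (lead_coeff P0)) P0"
  have mp_add: "map_poly of_rat (p + q) = (map_poly of_rat p + map_poly of_rat q :: complex poly)" for p q
    by (rule poly_eqI) (simp add: coeff_map_poly of_rat_add)
  have P: "P \<noteq> 0" "lead_coeff P = 1" "degree P = Least D"
    unfolding P0(3)[symmetric] using P0(1) by (simp_all add: P_def)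
  have Px: "poly (map_poly of_rat P) x = 0"
    using P0(2) by (simp add: P_def map_poly_smult of_rat_mult)
  have "P dvd Q" if "poly (map_poly of_rat Q) x = 0" for Q
  proof -
    have "map_poly of_rat Q = (map_poly of_rat (Q div P) * map_poly of_rat P + map_poly of_rat (Q mod P) :: complex poly)"
      by (simp flip: map_poly_of_rat_mult mp_add)
    then have Qx: "poly (map_poly of_rat (Q mod P)) x = 0" using that Px by simp
    have "Q mod P = 0"
    proof (rule ccontr)
      assume nz: "Q mod P \<noteq> 0"
      then have "D (degree (Q mod P))" unfolding D_def using Qx by blast
      then have "degree P \<le> degree (Q mod P)" using P(3) by (simp add: Least_le)
      then show False using nz degree_mod_less[OF P(1), of Q] by auto
    qed
    then show ?thesis by (simp add: dvd_eq_mod_eq_0)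
  qed
  with that[OF P(1,2) Px] show thesis by blast
qed

text \<open>The roots of the minimal polynomial \<open>P\<close> are the conjugates: the minimal polynomial of another root
  \<open>y\<close> divides \<open>P\<close>, and the cofactor cannot vanish at \<open>x\<close> by minimality. The roots are simple because
  the derivative of \<open>P\<close> has smaller degree, so their number is the degree of \<open>P\<close>.\<close>

lemma minimal_polynomial:
  assumes "algebraic x"
  obtains P :: "rat poly" where "P \<noteq> 0" "lead_coeff P = 1" "poly (map_poly of_rat P) x = 0"
    "conjugates x = {y. poly (map_poly of_rat P) y = 0}"
    "map_poly of_rat P = (\<Prod>y\<in>conjugates x. [:- y, 1:])" "degree P = card (conjugates x)"
    "finite (conjugates x)"
proof -
  obtain P :: "rat poly" where P: "P \<noteq> 0" "lead_coeff P = 1" and Px: "poly (map_poly of_rat P) x = 0"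
    and dvd: "\<And>Q. poly (map_poly of_rat Q) x = 0 \<Longrightarrow> P dvd Q"
    by (rule minimal_polynomial_dvd[OF assms]) blast
  have conj: "conjugates x = {y. poly (map_poly of_rat P) y = 0}"
  proof (intro equalityI subsetI)
    fix y :: complex assume "y \<in> {y. poly (map_poly of_rat P) y = 0}"
    then have y: "poly (map_poly of_rat P) y = 0" by simp
    then have "algebraic y" using P(1) algebraic_iff_rat_poly by blast
    then obtain R where R: "poly (map_poly of_rat R) y = 0" "R \<noteq> 0"
      and dvdR: "\<And>Q. poly (map_poly of_rat Q) y = 0 \<Longrightarrow> R dvd Q"
      by (rule minimal_polynomial_dvd) blast
    obtain H where H: "P = R * H" using dvdR[OF y] by (elim dvdE)
    have Rx: "poly (map_poly of_rat R) x = 0"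
    proof (rule ccontr)
      assume "poly (map_poly of_rat R) x \<noteq> 0"
      then have "poly (map_poly of_rat H) x = 0" using Px by (simp add: H map_poly_of_rat_mult)
      then have "P dvd H" by (rule dvd)
      moreover have "H \<noteq> 0" using H P(1) by auto
      ultimately have "degree P \<le> degree H" by (rule dvd_imp_degree_le)
      then have "degree R = 0" using H P(1) by (auto simp: degree_mult_eq)
      then obtain c where "R = [:c:]" by (rule degree_eq_zeroE)
      with R show False by (simp add: map_poly_pCons)
    qed
    have "poly (map_poly of_rat Q) y = 0 \<longleftrightarrow> poly (map_poly of_rat Q) x = 0" for Q
    proof
      assume "poly (map_poly of_rat Q) x = 0"
      from dvd[OF this] y show "poly (map_poly of_rat Q) y = 0"
        by (auto simp: map_poly_of_rat_mult elim!: dvdE)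
    next
      assume "poly (map_poly of_rat Q) y = 0"
      from dvdR[OF this] Rx show "poly (map_poly of_rat Q) x = 0"
        by (auto simp: map_poly_of_rat_mult elim!: dvdE)
    qed
    then show "y \<in> conjugates x" by (simp add: conjugates_def)
  qed (use Px in \<open>auto simp: conjugates_def\<close>)
  define C where "C = (map_poly of_rat P :: complex poly)"
  have C: "lead_coeff C = 1" "degree C = degree P"
    using P(2) by (simp_all add: C_def degree_map_poly coeff_map_poly)
  have "rsquarefree C"
    unfolding rsquarefree_roots
  proof (intro allI notI)
    fix y assume y: "poly C y = 0 \<and> poly (pderiv C) y = 0"
    have "pderiv C = map_poly of_rat (pderiv P)"
      by (rule poly_eqI) (simp add: C_def coeff_pderiv coeff_map_poly of_rat_mult of_rat_add)
    then have "poly (map_poly of_rat (pderiv P)) x = 0"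
      using y conj by (auto simp: C_def conjugates_def)
    moreover have "degree P \<noteq> 0"
    proof
      assume "degree P = 0"
      then obtain c where "P = [:c:]" by (rule degree_eq_zeroE)
      with P(1) Px show False by (simp add: map_poly_pCons)
    qed
    ultimately show False
      using dvd_imp_degree_le[OF dvd, of "pderiv P"] by (auto simp: degree_pderiv pderiv_eq_0_iff)
  qed
  from complex_poly_decompose_rsquarefree[OF this]
  have prod: "C = (\<Prod>y\<in>conjugates x. [:- y, 1:])"
    using C(1) conj by (simp add: C_def)
  have fin: "finite (conjugates x)"
    unfolding conj using P(1) by (intro poly_roots_finite) (simp add: map_poly_eq_0_iff)
  have "degree C = card (conjugates x)"
    unfolding prod by (subst degree_prod_eq_sum_degree) auto
  with that[OF P(1,2) Px conj _ _ fin] prod C show thesis by (simp add: C_def)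
qed

section \<open>Orbits at a p-adic place\<close>

text \<open>The iterates over an arbitrary ring, because they are needed over the complex numbers, over \<open>qbar\<close>
  and, with \<open>t\<close> as an indeterminate, over polynomials.\<close>

definition orbit :: "'a::comm_ring_1 \<Rightarrow> nat \<Rightarrow> 'a \<Rightarrow> 'a" where
  "orbit t n = ((\<lambda>z. z\<^sup>2 + t) ^^ n)"

lemma orbit_0 [simp]: "orbit t 0 a = a"
  and orbit_Suc [simp]: "orbit t (Suc n) a = (orbit t n a)\<^sup>2 + t"
  by (simp_all add: orbit_def)

locale padic_abs_value =
  fixes p :: nat and v :: "'a::field_char_0 \<Rightarrow> real"
  assumes prime: "prime p"
    and v_nonneg [simp]: "v x \<ge> 0"
    and v_eq_0_iff [simp]: "v x = 0 \<longleftrightarrow> x = 0"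
    and v_mult: "v (x * y) = v x * v y"
    and v_add: "v (x + y) \<le> max (v x) (v y)"
    and v_of_rat: "v (of_rat r) = padic_abs p r"
begin

lemma p_gt_1: "p > 1" using prime by (rule prime_gt_1_nat)

lemma v_0 [simp]: "v 0 = 0" by simp

lemma v_1 [simp]: "v 1 = 1"
proof -
  have "v 1 * v 1 = v 1" by (metis mult_1 v_mult)
  then show ?thesis by (metis mult_cancel_right2 v_eq_0_iff zero_neq_one)
qed

lemma v_pos_iff [simp]: "v x > 0 \<longleftrightarrow> x \<noteq> 0"
  by (metis less_le v_eq_0_iff v_nonneg)

lemma v_power: "v (x ^ n) = v x ^ n"
  by (induction n) (simp_all add: v_mult)

lemma v_minus [simp]: "v (- x) = v x"
proof -
  have "v (- 1) ^ 2 = 1" by (simp flip: v_power)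
  then have "v (- 1) = 1" by (metis power2_eq_1_iff v_nonneg neg_0_le_iff_le zero_neq_one not_one_le_zero)
  then show ?thesis using v_mult[of "- 1" x] by simp
qed

lemma v_diff_commute: "v (x - y) = v (y - x)"
  by (metis minus_diff_eq v_minus)

lemma v_diff: "v (x - y) \<le> max (v x) (v y)"
  using v_add[of x "- y"] by simp

lemma v_inverse: "v (inverse x) = inverse (v x)"
proof (cases "x = 0")
  case False
  then have "v x * v (inverse x) = 1" by (simp flip: v_mult)
  then show ?thesis by (metis inverse_unique)
qed simp

lemma v_divide: "v (x / y) = v x / v y"
  by (simp add: divide_inverse v_mult v_inverse)

lemma v_power_int: "v (x powi k) = v x powi k"
  by (simp add: power_int_def v_power v_inverse)

lemma v_add_eq:
  assumes "v x < v y"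
  shows "v (x + y) = v y"
  using v_add[of x y] v_diff[of "x + y" x] assms by auto

lemma v_add_eq': "v y < v x \<Longrightarrow> v (x + y) = v x"
  using v_add_eq[of y x] by (simp add: add.commute)

lemma v_sum_less:
  assumes "\<And>i. i \<in> I \<Longrightarrow> v (f i) < M" "M > 0"
  shows "v (sum f I) < M"
  using assms(1)
  by (induction I rule: infinite_finite_induct)
     (use assms(2) in \<open>auto intro: le_less_trans[OF v_add]\<close>)

lemma v_sum_le:
  assumes "\<And>i. i \<in> I \<Longrightarrow> v (f i) \<le> M" "M \<ge> 0"
  shows "v (sum f I) \<le> M"
  using assms(1)
  by (induction I rule: infinite_finite_induct)
     (use assms(2) in \<open>auto intro: order.trans[OF v_add]\<close>)

lemma v_of_int: "n \<noteq> 0 \<Longrightarrow> v (of_int n) = 1 / real p ^ multiplicity (int p) n"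
  using v_of_rat[of "of_int n"] by (simp add: padic_abs_def power_int_minus field_simps)

lemma v_of_int_le_1: "v (of_int n) \<le> 1"
  using p_gt_1 by (cases "n = 0") (auto simp: v_of_int)

lemma v_of_nat_le_1: "v (of_nat n) \<le> 1"
  using v_of_int_le_1[of "int n"] by simp

lemma v_of_int_less_1_iff: "v (of_int n) < 1 \<longleftrightarrow> int p dvd n"
proof (cases "n = 0")
  case False
  have "\<not> is_unit (int p)" using p_gt_1 by simp
  then have "multiplicity (int p) n > 0 \<longleftrightarrow> int p dvd n"
    using False by (simp add: multiplicity_gt_zero_iff)
  moreover have "v (of_int n) < 1 \<longleftrightarrow> multiplicity (int p) n > 0"
    using False p_gt_1 one_less_power[of "real p"]
    by (cases "multiplicity (int p) n = 0") (auto simp: v_of_int)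
  ultimately show ?thesis by simp
qed simp

lemma v_of_int_eq_1_iff: "v (of_int n) = 1 \<longleftrightarrow> \<not> int p dvd n"
  using v_of_int_less_1_iff[of n] v_of_int_le_1[of n] by linarith

lemma v_p: "v (of_nat p) = 1 / real p"
proof -
  have "multiplicity (int p) (int p) = 1"
    using p_gt_1 by (intro multiplicity_self) auto
  then show ?thesis using v_of_int[of "int p"] p_gt_1 by simp
qed

lemma v_2: "v 2 = (if p = 2 then 1 / 2 else 1)"
proof (cases "p = 2")
  case False
  have "\<not> int p dvd 2"
  proof
    assume "int p dvd 2"
    then have "p dvd 2" by (metis int_dvd_int_iff of_nat_numeral)
    then show False using False p_gt_1 by (metis prime primes_dvd_imp_eq two_is_prime_nat)
  qed
  then show ?thesis using False v_of_int_eq_1_iff[of 2] by simp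
qed (use v_p in simp)

lemma v_of_rat_power: "r \<noteq> 0 \<Longrightarrow> \<exists>k. v (of_rat r) = real p powi k"
  by (auto simp: v_of_rat padic_abs_def)

lemma powi_p_inject: "real p powi k = real p powi l \<longleftrightarrow> k = l"
proof -
  have "real p powi k < real p powi l" if "k < l" for k l
  proof -
    have "real p powi l = real p powi k * real p ^ nat (l - k)"
      using that p_gt_1 by (simp add: power_int_add[symmetric] flip: power_int_of_nat)
    moreover have "1 < real p ^ nat (l - k)" using that p_gt_1 by (intro one_less_power) auto
    ultimately show ?thesis using p_gt_1 by simp
  qed
  then show ?thesis by (metis less_irrefl linorder_less_linear)
qed

text \<open>In a vanishing sum the largest absolute value occurs at least twice, by the ultrametric
  inequality.\<close>

lemma two_maximal_terms:
  assumes "finite I" "(\<Sum>i\<in>I. x i) = 0" "i0 \<in> I" "x i0 \<noteq> 0"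
  obtains i j where "i \<in> I" "j \<in> I" "i \<noteq> j" "v (x i) = v (x j)" "x i \<noteq> 0" "x j \<noteq> 0"
proof -
  obtain i where i: "i \<in> I" "\<And>j. j \<in> I \<Longrightarrow> v (x j) \<le> v (x i)"
  proof -
    have "Max ((\<lambda>i. v (x i)) ` I) \<in> (\<lambda>i. v (x i)) ` I" using assms(1,3) by (intro Max_in) auto
    then obtain i where "i \<in> I" "Max ((\<lambda>i. v (x i)) ` I) = v (x i)" by auto
    moreover have "v (x j) \<le> Max ((\<lambda>i. v (x i)) ` I)" if "j \<in> I" for j
      using assms(1) that by (intro Max_ge) auto
    ultimately show thesis using that by auto
  qed
  have xi: "x i \<noteq> 0" using i(2)[OF assms(3)] assms(4) by (metis less_le_trans v_pos_iff)
  have "(\<Sum>j\<in>I - {i}. x j) = - x i"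
    using assms(1,2) i(1) by (simp add: sum.remove add_eq_0_iff)
  then have "\<not> (\<forall>j\<in>I - {i}. v (x j) < v (x i))"
    using v_sum_less[of "I - {i}" x "v (x i)"] xi by auto
  then obtain j where j: "j \<in> I" "j \<noteq> i" "\<not> v (x j) < v (x i)" by auto
  then have "v (x j) = v (x i)" using i(2)[of j] by simp
  then show thesis using that[of i j] i j xi by (metis v_eq_0_iff)
qed

text \<open>Two terms of equal absolute value in a polynomial equation for \<open>a\<close> express a power of \<open>\<bar>a\<bar>\<close> through
  the absolute values of two rational coefficients.\<close>

lemma algebraic_abs_value_power:
  assumes "algebraic a" "a \<noteq> 0"
  obtains e k where "e > 0" "v a ^ e = real p powi k"
proof -
  obtain P :: "rat poly" where P: "P \<noteq> 0" "poly (map_poly of_rat P) a = 0"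
    using assms algebraic_iff_rat_poly by blast
  have sum: "(\<Sum>i\<le>degree P. of_rat (coeff P i) * a ^ i) = 0"
    using P(2) by (simp add: poly_altdef degree_map_poly coeff_map_poly)
  obtain i j where ij: "i \<noteq> j" "v (of_rat (coeff P i) * a ^ i) = v (of_rat (coeff P j) * a ^ j)"
      "of_rat (coeff P i) * a ^ i \<noteq> 0" "of_rat (coeff P j) * a ^ j \<noteq> 0"
    by (rule two_maximal_terms[OF _ sum, of "degree P"]) (use P assms in auto)
  have "\<exists>e k. e > 0 \<and> v a ^ e = real p powi k"
    if ij: "i < j" "v (of_rat (coeff P i) * a ^ i) = v (of_rat (coeff P j) * a ^ j)"
      "of_rat (coeff P i) * a ^ i \<noteq> 0" "of_rat (coeff P j) * a ^ j \<noteq> 0" for i j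
  proof -
    obtain k l where kl: "v (of_rat (coeff P i)) = real p powi k" "v (of_rat (coeff P j)) = real p powi l"
      using ij(3,4) v_of_rat_power by (metis mult_eq_0_iff of_rat_0)
    have "v a ^ j = v a ^ (j - i) * v a ^ i" using ij(1) by (simp flip: power_add)
    then have "real p powi k = real p powi l * v a ^ (j - i)"
      using ij kl assms(2) by (simp add: v_mult v_power)
    then have "v a ^ (j - i) = real p powi (k - l)"
      using p_gt_1 by (simp add: power_int_diff field_simps)
    then show ?thesis using ij(1) by (metis zero_less_diff)
  qed
  from this[of i j] this[of j i] ij that show thesis by (metis linorder_neqE_nat)
qed

lemma v_orbit_escape:
  assumes "v t > 1" "v (a\<^sup>2) < v t"
  shows "v (orbit t (Suc n) a) = v t ^ (2 ^ n)"
proof (induction n)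
  case (Suc n)
  have "v t ^ 1 < v t ^ (2 ^ Suc n)"
    using assms(1) by (intro power_strict_increasing one_less_power) auto
  moreover have "v ((orbit t (Suc n) a)\<^sup>2) = v t ^ (2 ^ Suc n)"
    unfolding v_power Suc by (simp add: mult.commute flip: power_mult)
  ultimately show ?case by (subst orbit_Suc, subst v_add_eq') simp_all
qed (use assms in \<open>simp add: v_add_eq\<close>)

text \<open>For larger \<open>t\<close> both orbits escape, which forces \<open>m = n\<close>. From then on \<open>u\<close> and \<open>w\<close> stay so close that
  \<open>u + w = 2 u - (u - w)\<close> has exactly the absolute value of \<open>2 u\<close>; so \<open>u\<^sup>2 - w\<^sup>2 = (u - w)(u + w)\<close> is nonzero and
  relatively no larger than \<open>u - w\<close>.\<close>

lemma nonarchimedean_bound: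
  assumes "a\<^sup>2 \<noteq> b\<^sup>2" "m \<ge> 1" "n \<ge> 1" "orbit t m a = orbit t n b"
    and B: "B \<ge> 1" "v a ^ 2 \<le> B" "v b ^ 2 \<le> B"
  shows "v t \<le> B / v 2"
proof (rule ccontr)
  assume "\<not> v t \<le> B / v 2"
  then have t: "B < v t * v 2" by (simp add: field_simps)
  have v2: "v 2 \<le> 1" "v 2 > 0" by (simp_all add: v_2)
  then have "v t * v 2 \<le> v t" by (simp add: mult_left_le)
  then have tB: "B < v t" using t by simp
  then have t1: "v t > 1" using B by simp
  obtain m' n' where mn: "m = Suc m'" "n = Suc n'" using assms(2,3) by (metis Suc_le_D One_nat_def)
  have va: "v (orbit t (Suc k) a) = v t ^ (2 ^ k)" and vb: "v (orbit t (Suc k) b) = v t ^ (2 ^ k)" for k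
    using v_orbit_escape[OF t1] B tB by (simp_all only: v_power)
  have "v t ^ (2 ^ m') = v t ^ (2 ^ n')" using va[of m'] vb[of n'] assms(4) mn by simp
  then have "(2::nat) ^ m' = 2 ^ n'" using t1 by (simp only: power_inject_exp)
  then have "m' = n'" by simp
  have "orbit t (Suc k) a \<noteq> orbit t (Suc k) b \<and>
      v (orbit t (Suc k) a - orbit t (Suc k) b) < v 2 * v (orbit t (Suc k) a)" for k
  proof (induction k)
    case 0
    have "v (a\<^sup>2 - b\<^sup>2) \<le> B" using v_diff[of "a\<^sup>2" "b\<^sup>2"] B by (simp add: v_power)
    also note t
    finally show ?case using assms(1) va[of 0] by (simp add: mult.commute)
  next
    case (Suc k)
    define u w where "u = orbit t (Suc k) a" and "w = orbit t (Suc k) b"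
    have uw: "u \<noteq> w" "v (u - w) < v 2 * v u" using Suc by (simp_all add: u_def w_def)
    have "v (u + w) = v (2 * u - (u - w))" by (simp add: algebra_simps)
    also have "\<dots> = v (2 * u)"
      using uw v_add_eq'[of "- (u - w)" "2 * u"] by (simp add: v_mult v_diff_commute)
    finally have sum: "v (u + w) = v 2 * v u" by (simp add: v_mult)
    have diff: "orbit t (Suc (Suc k)) a - orbit t (Suc (Suc k)) b = (u - w) * (u + w)"
      unfolding orbit_Suc[of t "Suc k"] u_def[symmetric] w_def[symmetric]
      by (simp add: power2_eq_square algebra_simps)
    have "v t > 0" using t1 by linarith
    then have vu: "v u > 0" unfolding u_def va by (rule zero_less_power)
    have "v (orbit t (Suc (Suc k)) a) = v u ^ 2"
      unfolding u_def va by (simp add: mult.commute flip: power_mult)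
    moreover have "v (u - w) * (v 2 * v u) < (v 2 * v u) * (v 2 * v u)"
      using uw vu v2 by (intro mult_strict_right_mono) auto
    moreover have "(v 2 * v u) * (v 2 * v u) \<le> v 2 * (v u)\<^sup>2"
      using v2 vu by (simp add: power2_eq_square mult_left_le)
    ultimately have "v (orbit t (Suc (Suc k)) a - orbit t (Suc (Suc k)) b) < v 2 * v (orbit t (Suc (Suc k)) a)"
      unfolding diff v_mult sum by simp
    moreover have "v ((u - w) * (u + w)) > 0" unfolding v_mult sum using uw vu v2 by simp
    then have "orbit t (Suc (Suc k)) a \<noteq> orbit t (Suc (Suc k)) b" using diff by auto
    ultimately show ?case by blast
  qed
  from this[of m'] show False using assms(4) mn \<open>m' = n'\<close> by simp
qed

end

section \<open>Frobenius modulo the maximal ideal\<close>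

context padic_abs_value
begin

lemma p_nonzero [simp]: "p \<noteq> 0" using p_gt_1 by simp

lemma zero_power_p_power [simp]: "(0::'a) ^ p ^ f = 0"
  by (simp add: power_0_left)

text \<open>Congruence modulo the maximal ideal of the valuation ring. Working with it directly avoids
  constructing the residue field.\<close>

definition vcong :: "'a \<Rightarrow> 'a \<Rightarrow> bool" (infix "\<cong>\<^sub>v" 50) where
  "x \<cong>\<^sub>v y \<longleftrightarrow> v (x - y) < 1"

lemma vcong_refl [simp]: "x \<cong>\<^sub>v x" by (simp add: vcong_def)
lemma vcong_sym: "x \<cong>\<^sub>v y \<Longrightarrow> y \<cong>\<^sub>v x" by (simp add: vcong_def v_diff_commute)
lemma vcong_trans [trans]: "x \<cong>\<^sub>v y \<Longrightarrow> y \<cong>\<^sub>v z \<Longrightarrow> x \<cong>\<^sub>v z"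
  using v_add[of "x - y" "y - z"] by (simp add: vcong_def)
lemma vcong_0_iff: "x \<cong>\<^sub>v 0 \<longleftrightarrow> v x < 1" by (simp add: vcong_def)

lemma vcong_add: "x \<cong>\<^sub>v x' \<Longrightarrow> y \<cong>\<^sub>v y' \<Longrightarrow> x + y \<cong>\<^sub>v x' + y'"
  using v_add[of "x - x'" "y - y'"] by (simp add: vcong_def algebra_simps)

lemma vcong_le_1: "x \<cong>\<^sub>v y \<Longrightarrow> v y \<le> 1 \<Longrightarrow> v x \<le> 1"
  using v_add[of "x - y" y] by (simp add: vcong_def)

lemma vcong_eq_1: "x \<cong>\<^sub>v y \<Longrightarrow> v y = 1 \<Longrightarrow> v x = 1"
  using v_add_eq[of "x - y" y] by (simp add: vcong_def)

lemma vcong_mult: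
  assumes "x \<cong>\<^sub>v x'" "y \<cong>\<^sub>v y'" "v x' \<le> 1" "v y' \<le> 1"
  shows "x * y \<cong>\<^sub>v x' * y'"
proof -
  have "x * y - x' * y' = (x - x') * y + x' * (y - y')" by (simp add: algebra_simps)
  moreover have "v ((x - x') * y) < 1"
    using vcong_le_1[OF assms(2,4)] assms(1) mult_left_le[of "v y" "v (x - x')"]
    by (auto simp: v_mult vcong_def)
  moreover have "v (x' * (y - y')) < 1"
    using assms(2,3) mult_left_le[of "v x'" "v (y - y')"] by (auto simp: v_mult vcong_def mult.commute)
  ultimately show ?thesis
    using v_add[of "(x - x') * y" "x' * (y - y')"] by (simp add: vcong_def)
qed

lemma v_power_le_1: "v x \<le> 1 \<Longrightarrow> v (x ^ n) \<le> 1"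
  by (simp add: v_power power_le_one)

lemma vcong_power:
  assumes "x \<cong>\<^sub>v y" "v y \<le> 1"
  shows "x ^ n \<cong>\<^sub>v y ^ n"
proof (induction n)
  case (Suc n)
  then have "x * x ^ n \<cong>\<^sub>v y * y ^ n" using assms by (intro vcong_mult v_power_le_1)
  then show ?case by simp
qed simp

lemma vcong_cancel:
  assumes "c * x \<cong>\<^sub>v c * y" "v c = 1"
  shows "x \<cong>\<^sub>v y"
  using assms by (simp add: vcong_def v_mult flip: right_diff_distrib)

lemma v_choose_less_1: "0 < k \<Longrightarrow> k < p \<Longrightarrow> v (of_nat (p choose k)) < 1"
  using dvd_choose_prime[of k p] prime v_of_int_less_1_iff[of "int (p choose k)"] p_gt_1
  by (auto simp: int_dvd_int_iff)

lemma frobenius_add: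
  assumes "v x \<le> 1" "v y \<le> 1"
  shows "(x + y) ^ p \<cong>\<^sub>v x ^ p + y ^ p"
proof -
  have "{..p} = insert 0 (insert p {0<..<p})" using p_gt_1 by auto
  then have "(x + y) ^ p = y ^ p + (x ^ p + (\<Sum>k\<in>{0<..<p}. of_nat (p choose k) * x ^ k * y ^ (p - k)))"
    using p_gt_1 by (simp add: binomial_ring)
  then have eq: "(x + y) ^ p - (x ^ p + y ^ p) = (\<Sum>k\<in>{0<..<p}. of_nat (p choose k) * x ^ k * y ^ (p - k))"
    by simp
  have "v (of_nat (p choose k) * x ^ k * y ^ (p - k)) < 1" if "k \<in> {0<..<p}" for k
  proof -
    have "v (x ^ k) * v (y ^ (p - k)) \<le> 1" using assms by (intro mult_le_one v_power_le_1) auto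
    then have "v (of_nat (p choose k)) * (v (x ^ k) * v (y ^ (p - k))) \<le> v (of_nat (p choose k))"
      by (intro mult_left_le) auto
    also have "\<dots> < 1" using that by (intro v_choose_less_1) auto
    finally show ?thesis by (simp add: v_mult mult.assoc)
  qed
  then show ?thesis unfolding vcong_def eq by (intro v_sum_less) auto
qed

lemma frobenius_power_add:
  assumes "v x \<le> 1" "v y \<le> 1"
  shows "(x + y) ^ (p ^ f) \<cong>\<^sub>v x ^ (p ^ f) + y ^ (p ^ f)"
proof (induction f)
  case (Suc f)
  have "v (x ^ p ^ f + y ^ p ^ f) \<le> 1"
    using v_add[of "x ^ p ^ f" "y ^ p ^ f"] v_power_le_1[OF assms(1), of "p ^ f"]
      v_power_le_1[OF assms(2), of "p ^ f"] by linarith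
  from vcong_power[OF Suc this, of p]
  have "(x + y) ^ (p ^ Suc f) \<cong>\<^sub>v (x ^ p ^ f + y ^ p ^ f) ^ p"
    by (simp add: mult.commute flip: power_mult)
  also have "\<dots> \<cong>\<^sub>v (x ^ p ^ f) ^ p + (y ^ p ^ f) ^ p"
    using assms by (intro frobenius_add v_power_le_1)
  finally show ?case by (simp add: mult.commute flip: power_mult)
qed simp

lemma frobenius_power_diff:
  assumes "v x \<le> 1" "v y \<le> 1"
  shows "(x - y) ^ (p ^ f) \<cong>\<^sub>v x ^ (p ^ f) - y ^ (p ^ f)"
proof -
  have "v (x - y) \<le> 1" using v_diff[of x y] assms by linarith
  from frobenius_power_add[OF this assms(2), of f]
  have "x ^ p ^ f - ((x - y) ^ p ^ f + y ^ p ^ f) \<cong>\<^sub>v 0" by (simp add: vcong_def)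
  then have "v (- (x ^ p ^ f - ((x - y) ^ p ^ f + y ^ p ^ f))) < 1" by (simp only: vcong_0_iff v_minus)
  then show ?thesis by (simp add: vcong_def algebra_simps)
qed

lemma frobenius_inject:
  assumes "v x \<le> 1" "v y \<le> 1" "x ^ (p ^ f) \<cong>\<^sub>v y ^ (p ^ f)"
  shows "x \<cong>\<^sub>v y"
proof -
  have "x ^ p ^ f - y ^ p ^ f \<cong>\<^sub>v 0" using assms(3) by (simp add: vcong_def)
  with frobenius_power_diff[OF assms(1,2), of f] have "(x - y) ^ p ^ f \<cong>\<^sub>v 0" by (rule vcong_trans)
  then have "v (x - y) ^ p ^ f < 1" by (simp add: vcong_0_iff v_power)
  then show ?thesis unfolding vcong_def by (meson linorder_not_le one_le_power)
qed

lemma frobenius_power_sum: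
  assumes "\<And>i. i \<in> I \<Longrightarrow> v (x i) \<le> 1"
  shows "(\<Sum>i\<in>I. x i) ^ (p ^ f) \<cong>\<^sub>v (\<Sum>i\<in>I. x i ^ (p ^ f))"
  using assms
proof (induction I rule: infinite_finite_induct)
  case (insert i I)
  have "(x i + sum x I) ^ p ^ f \<cong>\<^sub>v x i ^ p ^ f + (sum x I) ^ p ^ f"
    using insert by (intro frobenius_power_add v_sum_le) auto
  also have "\<dots> \<cong>\<^sub>v x i ^ p ^ f + (\<Sum>i\<in>I. x i ^ p ^ f)"
    using insert by (intro vcong_add) auto
  finally show ?case using insert by simp
qed (use p_gt_1 in auto)

lemma frobenius_of_small: "v x < 1 \<Longrightarrow> x ^ (p ^ f) \<cong>\<^sub>v x"
  by (rule vcong_trans[of _ 0]) (use p_gt_1 in \<open>auto simp: vcong_0_iff v_power power_less_one_iff intro: vcong_sym\<close>)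

lemma frobenius_of_nat: "of_nat n ^ (p ^ f) \<cong>\<^sub>v of_nat n"
proof (induction n)
  case (Suc n)
  have "(of_nat n + 1 :: 'a) ^ p ^ f \<cong>\<^sub>v of_nat n ^ p ^ f + 1 ^ p ^ f"
    by (intro frobenius_power_add v_of_nat_le_1) simp
  also have "\<dots> \<cong>\<^sub>v of_nat n + 1" using Suc by (intro vcong_add) auto
  finally show ?case by (simp add: add.commute)
qed (use p_gt_1 in simp)

lemma frobenius_of_int: "of_int n ^ (p ^ f) \<cong>\<^sub>v of_int n"
proof (cases "n \<ge> 0")
  case True
  then show ?thesis using frobenius_of_nat[of "nat n"] by simp
next
  case False
  have "(0 - of_nat (nat (- n)) :: 'a) ^ p ^ f \<cong>\<^sub>v 0 ^ p ^ f - of_nat (nat (- n)) ^ p ^ f"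
    by (intro frobenius_power_diff v_of_nat_le_1) simp
  also have "\<dots> \<cong>\<^sub>v - of_nat (nat (- n))"
    using vcong_sym[OF frobenius_of_nat[of "nat (- n)" f]] by (simp add: vcong_def)
  finally show ?thesis using False by simp
qed

text \<open>Fermat's little theorem for the rational units. For a fraction in lowest terms neither numerator nor
  denominator is divisible by \<open>p\<close>, so the denominator cancels.\<close>

lemma frobenius_of_rat:
  assumes "v (of_rat r) = 1"
  shows "of_rat r ^ (p ^ f) \<cong>\<^sub>v of_rat r"
proof -
  obtain n d where r: "quotient_of r = (n, d)" by force
  then have nd: "r = of_int n / of_int d" "d > 0" "coprime n d"
    by (auto simp: quotient_of_div quotient_of_denom_pos quotient_of_coprime)
  have eq: "of_int d * of_rat r = (of_int n :: 'a)"
    using nd by (simp add: of_rat_divide)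
  then have "v (of_int d) = v (of_int n)" using assms by (metis mult.right_neutral v_mult)
  moreover have "\<not> (int p dvd d \<and> int p dvd n)"
    using nd(3) by (metis coprime_common_divisor not_prime_unit prime prime_nat_int_transfer)
  ultimately have d1: "v (of_int d) = 1"
    using v_of_int_eq_1_iff[of d] v_of_int_eq_1_iff[of n] by auto
  have "of_int d * of_rat r ^ p ^ f \<cong>\<^sub>v of_int d ^ p ^ f * of_rat r ^ p ^ f"
    using assms d1 by (intro vcong_mult) (auto simp: v_power vcong_sym frobenius_of_int)
  also have "\<dots> = of_int n ^ p ^ f" by (simp add: eq flip: power_mult_distrib)
  also have "\<dots> \<cong>\<^sub>v of_int n" by (rule frobenius_of_int)
  also have "\<dots> = of_int d * of_rat r" by (simp add: eq)
  finally show ?thesis using d1 by (rule vcong_cancel)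
qed

lemma v_poly_le_1:
  assumes "\<And>i. v (coeff g i) \<le> 1" "v x \<le> 1"
  shows "v (poly g x) \<le> 1"
  unfolding poly_altdef
  by (intro v_sum_le) (auto simp: v_mult v_power assms power_le_one intro!: mult_le_one)

lemma v_coeff_synthetic_div_le_1:
  assumes "\<And>i. v (coeff g i) \<le> 1" "v x \<le> 1"
  shows "v (coeff (synthetic_div g x) i) \<le> 1"
  using assms(1)
proof (induction g arbitrary: i)
  case (pCons c g)
  have "v (coeff g i) \<le> 1" for i using pCons(3)[of "Suc i"] by simp
  then show ?case using pCons(2) v_poly_le_1 assms(2)
    by (simp add: coeff_pCons split: nat.splits)
qed simp

text \<open>The residue field form of the bound for the number of roots: a polynomial over the valuation ring
  that vanishes modulo the maximal ideal at more incongruent points than its degree has only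
  coefficients in the maximal ideal. Synthetic division splits off one root at a time; differences of
  incongruent points are units.\<close>

lemma approximate_roots_bound:
  assumes "\<And>i. v (coeff g i) \<le> 1" "finite X" "card X > degree g"
    and "\<And>x. x \<in> X \<Longrightarrow> v x \<le> 1 \<and> poly g x \<cong>\<^sub>v 0"
    and "\<And>x y. x \<in> X \<Longrightarrow> y \<in> X \<Longrightarrow> x \<cong>\<^sub>v y \<Longrightarrow> x = y"
  shows "v (coeff g i) < 1"
  using assms
proof (induction "degree g" arbitrary: g X i)
  case 0
  then obtain c where c: "g = [:c:]" by (metis degree_eq_zeroE)
  obtain x where "x \<in> X" using 0 by (metis card.empty equals0I not_less0)
  then have "v c < 1" using 0 c by (force simp: vcong_0_iff)
  then show ?case by (simp add: c coeff_pCons split: nat.splits)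
next
  case (Suc d)
  then have "X \<noteq> {}" by auto
  then obtain x0 where x0: "x0 \<in> X" by blast
  define h where "h = synthetic_div g x0"
  have g: "g = [:- x0, 1:] * h + [:poly g x0:]"
    using synthetic_div_correct'[of x0 g] by (simp add: h_def)
  have vx0: "v x0 \<le> 1" and gx0: "v (poly g x0) < 1" using Suc.prems(4)[OF x0] by (auto simp: vcong_0_iff)
  have h: "v (coeff h i) < 1" for i
  proof (rule Suc.hyps(1)[of h "X - {x0}"])
    show "d = degree h" using Suc.hyps(2) by (simp add: h_def degree_synthetic_div)
    then show "degree h < card (X - {x0})" using Suc x0 by simp
    show "v (coeff h i) \<le> 1" for i
      unfolding h_def by (intro v_coeff_synthetic_div_le_1 Suc.prems vx0)
    fix x assume x: "x \<in> X - {x0}"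
    have "poly g x = (x - x0) * poly h x + poly g x0" by (subst g) (simp add: algebra_simps)
    then have "(x - x0) * poly h x = poly g x - poly g x0" by simp
    moreover have "v (poly g x - poly g x0) < 1"
      using v_diff[of "poly g x" "poly g x0"] gx0 Suc.prems(4)[of x] x by (auto simp: vcong_0_iff)
    moreover have "\<not> x \<cong>\<^sub>v x0" using Suc.prems(5)[of x x0] x x0 by blast
    then have "v (x - x0) \<ge> 1" by (simp add: vcong_def)
    ultimately have "v (poly h x) < 1"
      by (smt (verit) mult_less_cancel_left1 mult_le_cancel_right1 v_mult v_nonneg)
    then show "v x \<le> 1 \<and> poly h x \<cong>\<^sub>v 0" using Suc.prems(4) x by (auto simp: vcong_0_iff)
  qed (use Suc.prems in auto)
  have "coeff g i = coeff (pCons 0 h) i - x0 * coeff h i + coeff [:poly g x0:] i"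
    by (subst g) (simp add: coeff_pCons split: nat.splits)
  moreover have "v (coeff (pCons 0 h) i) < 1" "v (coeff [:poly g x0:] i) < 1"
    using h gx0 by (auto simp: coeff_pCons split: nat.splits)
  moreover have "v (x0 * coeff h i) < 1"
    using h[of i] vx0 mult_left_le[of "v x0" "v (coeff h i)"] by (simp add: v_mult mult.commute)
  ultimately show ?case
    by (smt (verit) v_add v_diff)
qed

lemma frobenius_poly:
  assumes "\<And>i. v (coeff g i) \<le> 1" "\<And>i. coeff g i ^ (p ^ f) \<cong>\<^sub>v coeff g i" "v x \<le> 1" "poly g x \<cong>\<^sub>v 0"
  shows "poly g (x ^ (p ^ f)) \<cong>\<^sub>v 0"
proof -
  let ?q = "p ^ f"
  have eq: "poly g (x ^ ?q) = (\<Sum>i\<le>degree g. coeff g i * (x ^ i) ^ ?q)"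
    by (simp add: poly_altdef mult.commute flip: power_mult)
  have vsum: "(\<Sum>i\<in>I. F i) \<cong>\<^sub>v (\<Sum>i\<in>I. G i)" if "\<And>i. i \<in> I \<Longrightarrow> F i \<cong>\<^sub>v G i" for I :: "nat set" and F G
    using that by (induction I rule: infinite_finite_induct) (auto intro: vcong_add)
  have "(\<Sum>i\<le>degree g. coeff g i * (x ^ i) ^ ?q) \<cong>\<^sub>v (\<Sum>i\<le>degree g. coeff g i ^ ?q * (x ^ i) ^ ?q)"
    by (intro vsum vcong_mult vcong_sym[OF assms(2)] v_power_le_1 assms) simp
  also have "\<dots> = (\<Sum>i\<le>degree g. (coeff g i * x ^ i) ^ ?q)" by (simp add: power_mult_distrib)
  also have "\<dots> \<cong>\<^sub>v (\<Sum>i\<le>degree g. coeff g i * x ^ i) ^ ?q"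
    by (intro vcong_sym[OF frobenius_power_sum])
       (auto simp: v_mult v_power assms power_le_one intro!: mult_le_one)
  also have "\<dots> = poly g x ^ ?q" by (simp add: poly_altdef)
  also have "\<dots> \<cong>\<^sub>v 0 ^ ?q" using assms(4) by (intro vcong_power) auto
  finally show ?thesis by (simp add: eq)
qed

lemma frobenius_iterate_poly:
  assumes "\<And>i. v (coeff g i) \<le> 1" "\<And>i. coeff g i ^ (p ^ f) \<cong>\<^sub>v coeff g i" "v x \<le> 1" "poly g x \<cong>\<^sub>v 0"
  shows "poly g (x ^ (p ^ (f * k))) \<cong>\<^sub>v 0"
proof (induction k)
  case (Suc k)
  have "p ^ (f * Suc k) = p ^ (f * k) * p ^ f" by (simp add: power_add mult.commute)
  then show ?case
    using frobenius_poly[OF assms(1,2) v_power_le_1[OF assms(3)] Suc] by (simp add: power_mult)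
qed (use assms in simp)

end

section \<open>Orbits that become opposite\<close>

text \<open>This bounds the order of an odd \<open>q\<close> modulo \<open>2\<^sup>E\<close> from below by \<open>2\<^sup>E / (q\<^sup>2 - 1)\<close>. For odd \<open>r\<close>, \<open>Q\<^sup>r - 1\<close> is
  \<open>Q - 1\<close> times an odd number; and for even \<open>r\<close>, \<open>q\<^sup>r + 1\<close> is twice an odd number, so that doubling the
  exponent \<open>r\<close> gains exactly one factor \<open>2\<close>.\<close>

lemma two_power_dvd_order:
  fixes q s E :: nat
  assumes "odd q" "2 ^ E dvd q ^ s - 1"
  shows "2 ^ E dvd s * (q\<^sup>2 - 1)"
  using assms(2)
proof (induction s arbitrary: E rule: less_induct)
  case (less s)
  have q: "q \<ge> 1" using assms(1) by (cases q) auto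
  have odd_case: "2 ^ E dvd Q - 1" if "odd r" "2 ^ E dvd Q ^ r - 1" "odd Q" for r Q :: nat
  proof -
    define S where "S = (\<Sum>i<r. int Q ^ i)"
    have "odd (card {i. i < r \<and> odd (int Q ^ i)})"
      using that(1,3) by simp
    then have "odd S"
      unfolding S_def by (subst even_sum_iff) (auto simp: conj_commute)
    then have cop: "coprime ((2::int) ^ E) S" by simp
    have eq: "int Q ^ r - 1 = (int Q - 1) * S"
      using power_diff_1_eq[of "int Q" r] by (simp add: S_def)
    have "int (2 ^ E) dvd int (Q ^ r - 1)" using that(2) by (simp only: int_dvd_int_iff)
    moreover have "Q ^ r \<ge> 1" using that(3) by (cases Q) auto
    ultimately have "(2::int) ^ E dvd (int Q - 1) * S" by (simp add: of_nat_diff flip: eq)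
    then have "(2::int) ^ E dvd int Q - 1" by (simp only: coprime_dvd_mult_left_iff[OF cop])
    moreover have "int Q - 1 = int (Q - 1)" using that(3) by (cases Q) auto
    ultimately have "int (2 ^ E) dvd int (Q - 1)" by (simp only: of_nat_power of_nat_numeral)
    then show ?thesis by (simp only: int_dvd_int_iff)
  qed
  have qq: "q\<^sup>2 - 1 = (q - 1) * (q + 1)" using q by (simp add: power2_eq_square algebra_simps)
  show ?case
  proof (cases "odd s")
    case True
    then have "2 ^ E dvd q - 1" using odd_case less.prems assms(1) by blast
    then show ?thesis unfolding qq by (simp add: dvd_mult dvd_mult2)
  next
    case False
    then obtain r where r: "s = 2 * r" by auto
    show ?thesis
    proof (cases "odd r")
      case True
      have "2 ^ E dvd (q\<^sup>2) ^ r - 1" using less.prems by (simp add: r power_mult)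
      then have "2 ^ E dvd q\<^sup>2 - 1" using odd_case[OF True] assms(1) by simp
      then show ?thesis by simp
    next
      case False
      show ?thesis
      proof (cases "E = 0 \<or> r = 0")
        case True
        then show ?thesis by (auto simp: r)
      next
        case nz: False
        then obtain E' where E: "E = Suc E'" by (cases E) auto
        obtain k where k: "q ^ r = 4 * k + 1"
        proof -
          obtain r' where r': "r = 2 * r'" using False by auto
          obtain m where m: "q = 2 * m + 1" using assms(1) by (elim oddE)
          have "q ^ 2 = 4 * (m\<^sup>2 + m) + 1" by (simp add: m power2_eq_square algebra_simps)
          then have "q ^ 2 mod 4 = 1" by presburger
          then have "(q ^ 2) ^ r' mod 4 = 1" by (metis mod_mod_trivial power_mod power_one)
          then have "q ^ r mod 4 = 1" by (simp add: r' power_mult)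
          then have "q ^ r = 4 * (q ^ r div 4) + 1" by presburger
          then show thesis by (rule that)
        qed
        have "q ^ s - 1 = (4 * k) * (4 * k + 2)"
          by (simp add: r mult.commute[of 2] power_mult k power2_eq_square algebra_simps)
        also have "\<dots> = (2 * (4 * k)) * (2 * k + 1)" by (simp add: algebra_simps)
        finally have "2 * 2 ^ E' dvd (2 * (4 * k)) * (2 * k + 1)" using less.prems E by simp
        moreover have "coprime (2 * 2 ^ E') (2 * k + 1)"
          by simp
        ultimately have "2 * 2 ^ E' dvd 2 * (4 * k)" using coprime_dvd_mult_left_iff by blast
        then have "2 ^ E' dvd q ^ r - 1" by (simp add: k)
        then have "2 ^ E' dvd r * (q\<^sup>2 - 1)" using less.IH[of r E'] nz r by simp
        then show ?thesis by (simp add: E r mult.assoc)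
      qed
    qed
  qed
qed

context padic_abs_value
begin

context
  fixes t a b :: 'a and j :: nat
  assumes a: "v a > 1" and b: "v b \<le> 1"
    and opposite: "orbit t (Suc j) a = - orbit t (Suc j) b"
begin

text \<open>Otherwise the orbit of \<open>b\<close> stays in the unit disc while that of \<open>a\<close> stays outside of it.\<close>

lemma v_t_gt_1: "v t > 1"
proof (rule ccontr)
  assume t: "\<not> v t > 1"
  have "v (orbit t k b) \<le> 1" for k
  proof (induction k)
    case (Suc k)
    have "v ((orbit t k b)\<^sup>2) \<le> 1" using Suc by (rule v_power_le_1)
    then show ?case using t v_add[of "(orbit t k b)\<^sup>2" t] by simp
  qed (use b in simp)
  moreover have "v (orbit t k a) > 1" for k
  proof (induction k)
    case (Suc k)
    have "v ((orbit t k a)\<^sup>2) > 1" using Suc by (simp add: v_power one_less_power)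
    then show ?case using t by (subst orbit_Suc, subst v_add_eq') auto
  qed (use a in simp)
  ultimately show False using opposite by (metis linorder_not_le v_minus)
qed

lemma t_nonzero: "t \<noteq> 0" using v_t_gt_1 by auto

lemma v_orbit_b: "v (orbit t (Suc k) b) = v t ^ (2 ^ k)"
proof -
  have "v (b\<^sup>2) \<le> 1" using b by (rule v_power_le_1)
  then show ?thesis using v_t_gt_1 by (intro v_orbit_escape) auto
qed

lemma orbit_b_nonzero: "orbit t (Suc k) b \<noteq> 0"
proof
  assume "orbit t (Suc k) b = 0"
  then have "v t ^ (2 ^ k) = 0" using v_orbit_b[of k] by (simp del: orbit_Suc)
  then show False using t_nonzero by simp
qed

text \<open>Otherwise \<open>a\<close> dominates its orbit, and comparing \<open>\<bar>u\<bar> = \<bar>a\<bar> ^ 2\<^sup>j\<^sup>+\<^sup>1\<close> with \<open>\<bar>w\<bar> = \<bar>t\<bar> ^ 2\<^sup>j\<close> gives \<open>\<bar>a\<bar>\<^sup>2 = \<bar>t\<bar>\<close>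
  after all.\<close>

lemma v_a_square_le: "v a ^ 2 \<le> v t"
proof (rule ccontr)
  assume "\<not> v a ^ 2 \<le> v t"
  then have less: "v t < v a ^ 2" by simp
  have "v (orbit t (Suc k) a) = v a ^ (2 ^ Suc k)" for k
  proof (induction k)
    case 0
    then show ?case using less by (simp add: v_add_eq' v_power)
  next
    case (Suc k)
    have "v a ^ 2 \<le> v a ^ (2 ^ Suc (Suc k))"
      using a by (intro power_increasing) (auto simp: self_le_power)
    moreover have "v ((orbit t (Suc k) a)\<^sup>2) = v a ^ (2 ^ Suc (Suc k))"
      unfolding v_power Suc by (simp add: mult.commute flip: power_mult)
    ultimately show ?case using less by (subst orbit_Suc, subst v_add_eq') auto
  qed
  from this[of j] have "v a ^ (2 ^ Suc j) = v t ^ (2 ^ j)" using opposite v_orbit_b[of j] by (metis v_minus)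
  then have "(v a ^ 2) ^ (2 ^ j) = v t ^ (2 ^ j)" by (simp flip: power_mult)
  moreover have "v t ^ (2 ^ j) < (v a ^ 2) ^ (2 ^ j)"
    using less by (intro power_strict_mono) auto
  ultimately show False by simp
qed

text \<open>The relative difference \<open>s = u / w - 1\<close> of the two orbits. It evolves by \<open>s \<mapsto> s (s + 2) e\<close> with a factor
  \<open>e = w\<^sup>2 / (w\<^sup>2 + t)\<close> congruent to \<open>1\<close>, that is, \<open>u / w\<close> is squared up to a small error. Opposite orbits mean
  that \<open>s\<close> ends at \<open>- 2\<close>.\<close>

definition rel_diff :: "nat \<Rightarrow> 'a" where
  "rel_diff k = (orbit t (Suc k) a - orbit t (Suc k) b) / orbit t (Suc k) b"

definition sq_ratio :: "nat \<Rightarrow> 'a" where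
  "sq_ratio k = (orbit t (Suc k) b)\<^sup>2 / orbit t (Suc (Suc k)) b"

lemma rel_diff_Suc: "rel_diff (Suc k) = rel_diff k * (rel_diff k + 2) * sq_ratio k"
proof -
  define u w where "u = orbit t (Suc k) a" and "w = orbit t (Suc k) b"
  have w: "w \<noteq> 0" "w\<^sup>2 + t \<noteq> 0"
    using orbit_b_nonzero[of k] orbit_b_nonzero[of "Suc k"] by (simp_all add: w_def)
  have "rel_diff (Suc k) = (u\<^sup>2 - w\<^sup>2) / (w\<^sup>2 + t)" by (simp add: rel_diff_def u_def w_def)
  also have "\<dots> = ((u - w) / w) * ((u - w) / w + 2) * (w\<^sup>2 / (w\<^sup>2 + t))"
    using w by (simp add: divide_simps) (simp add: power2_eq_square algebra_simps)
  finally show ?thesis by (simp add: rel_diff_def sq_ratio_def u_def w_def)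
qed

lemma rel_diff_j: "rel_diff j = - 2"
  using orbit_b_nonzero[of j] unfolding rel_diff_def opposite by (simp add: field_simps del: orbit_Suc)

lemma v_sq_ratio: "v (sq_ratio k) = 1"
  unfolding sq_ratio_def v_divide v_power v_orbit_b using t_nonzero
  by (simp add: mult.commute flip: power_mult)

lemma sq_ratio_cong: "sq_ratio k \<cong>\<^sub>v 1"
proof -
  define w where "w = orbit t (Suc k) b"
  have w: "w\<^sup>2 + t \<noteq> 0" using orbit_b_nonzero[of "Suc k"] by (simp add: w_def)
  have "sq_ratio k - 1 = - (t / (w\<^sup>2 + t))"
    using w by (simp add: sq_ratio_def w_def[symmetric] field_simps del: orbit_Suc) (simp add: w_def)
  moreover have "v (w\<^sup>2 + t) = v t ^ (2 ^ Suc k)" using v_orbit_b[of "Suc k"] by (simp add: w_def)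
  moreover have "v t ^ 1 < v t ^ (2 ^ Suc k)"
    using v_t_gt_1 by (intro power_strict_increasing one_less_power) auto
  ultimately show ?thesis by (simp add: vcong_def v_divide divide_less_eq)
qed

lemma v_rel_diff_0: "v (rel_diff 0) = v a ^ 2 / v t"
proof -
  have "v (b\<^sup>2) \<le> 1" using b by (rule v_power_le_1)
  also have "1 < v (a\<^sup>2)" using a by (simp add: v_power one_less_power)
  finally have "v (a\<^sup>2 - b\<^sup>2) = v (a\<^sup>2)" using v_add_eq'[of "- b\<^sup>2" "a\<^sup>2"] by simp
  then show ?thesis unfolding rel_diff_def v_divide v_orbit_b by (simp add: v_power)
qed

lemma v_rel_diff_le_1: "v (rel_diff k) \<le> 1"
proof (induction k)
  case 0
  then show ?case using v_rel_diff_0 v_a_square_le t_nonzero by (simp add: divide_le_eq)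
next
  case (Suc k)
  have "v (rel_diff k + 2) \<le> 1" using v_add[of "rel_diff k" 2] Suc by (simp add: v_2 split: if_splits)
  then show ?case using Suc by (simp add: rel_diff_Suc v_mult v_sq_ratio mult_le_one)
qed

text \<open>The size of the relative difference never increases, starts at \<open>\<bar>a\<bar>\<^sup>2 / \<bar>t\<bar> \<le> 1\<close> and ends at \<open>\<bar>2\<bar> = 1\<close>.\<close>

lemma v_t_if_p_odd:
  assumes "p \<noteq> 2"
  shows "v t = v a ^ 2"
proof -
  have "v (rel_diff (Suc k)) \<le> v (rel_diff k)" for k
  proof -
    have "v (rel_diff k + 2) \<le> 1" using v_add[of "rel_diff k" 2] v_rel_diff_le_1[of k] by (simp add: v_2 split: if_splits)
    then show ?thesis by (simp add: rel_diff_Suc v_mult v_sq_ratio mult_left_le)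
  qed
  then have "v (rel_diff j) \<le> v (rel_diff 0)" by (rule lift_Suc_antimono_le) simp
  then have "v (rel_diff 0) \<ge> 1" using assms by (simp add: rel_diff_j v_2)
  then show ?thesis using v_rel_diff_0 v_a_square_le t_nonzero v_t_gt_1 by (simp add: le_divide_eq)
qed

text \<open>As long as \<open>\<bar>s\<bar> > \<bar>2\<bar>\<close>, the factor \<open>s + 2\<close> has size \<open>\<bar>s\<bar>\<close> and so \<open>\<bar>s\<bar>\<close> is squared exactly. Once
  \<open>\<bar>s\<bar> \<le> \<bar>2\<bar>\<close>, the next value is at most \<open>\<bar>2\<bar>\<^sup>2\<close> and stays there, so \<open>\<bar>s\<bar> > \<bar>2\<bar>\<close> holds
  at all steps before the last one.\<close>

lemma v_t_if_p_eq_2: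
  assumes "p = 2"
  shows "v t ^ (2 ^ j) = 2 * (v a ^ 2) ^ (2 ^ j)"
proof -
  have v2: "v 2 = 1 / 2" using assms by (simp add: v_2)
  have small: "v (rel_diff (Suc k)) \<le> 1 / 4" if "v (rel_diff k) \<le> 1 / 2" for k
  proof -
    have "v (rel_diff k + 2) \<le> 1 / 2" using v_add[of "rel_diff k" 2] that v2 by simp
    then have "v (rel_diff k) * v (rel_diff k + 2) \<le> (1 / 2) * (1 / 2)" using that by (intro mult_mono) auto
    then show ?thesis by (simp add: rel_diff_Suc v_mult v_sq_ratio)
  qed
  have stay: "v (rel_diff (Suc k + l)) \<le> 1 / 4" if "v (rel_diff k) \<le> 1 / 2" for k l
  proof (induction l)
    case (Suc l)
    then show ?case using small[of "Suc k + l"] by simp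
  qed (use small[OF that] in simp)
  have large: "v (rel_diff k) > 1 / 2" if "k < j" for k
  proof (rule ccontr)
    assume "\<not> v (rel_diff k) > 1 / 2"
    then have "v (rel_diff (Suc k + (j - Suc k))) \<le> 1 / 4" by (intro stay) simp
    then show False using that v2 by (simp add: rel_diff_j)
  qed
  have "v (rel_diff k) = v (rel_diff 0) ^ (2 ^ k)" if "k \<le> j" for k
    using that
  proof (induction k)
    case (Suc k)
    have "v (rel_diff k + 2) = v (rel_diff k)" using large[of k] Suc v2 by (intro v_add_eq') simp
    then have "v (rel_diff (Suc k)) = v (rel_diff k) ^ 2" by (simp add: rel_diff_Suc v_mult v_sq_ratio power2_eq_square)
    with Suc show ?case by (simp add: mult.commute flip: power_mult)
  qed simp
  from this[of j] have "1 / 2 = (v a ^ 2 / v t) ^ (2 ^ j)" by (simp add: rel_diff_j v2 v_rel_diff_0)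
  then show ?thesis using t_nonzero by (simp add: power_divide field_simps)
qed

text \<open>Modulo the maximal ideal, \<open>u / w\<close> is squared in every step, starts at \<open>1 + a\<^sup>2 / t\<close> (as \<open>b\<^sup>2 / t\<close> is small) and
  ends at \<open>- 1\<close>.\<close>

lemma root_of_minus_one:
  assumes "p \<noteq> 2"
  shows "(1 + a\<^sup>2 / t) ^ (2 ^ j) \<cong>\<^sub>v - 1"
proof -
  define r where "r k = 1 + rel_diff k" for k
  have r1: "v (r k) \<le> 1" for k using v_add[of 1 "rel_diff k"] v_rel_diff_le_1[of k] by (simp add: r_def)
  have step: "r (Suc k) \<cong>\<^sub>v r k ^ 2" for k
  proof -
    have "r (Suc k) = 1 + (r k ^ 2 - 1) * sq_ratio k"
      unfolding r_def rel_diff_Suc by (simp add: power2_eq_square algebra_simps)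
    moreover have "v (r k ^ 2 - 1) \<le> 1"
      using v_diff[of "r k ^ 2" 1] v_power_le_1[OF r1, of k 2] by simp
    then have "(r k ^ 2 - 1) * sq_ratio k \<cong>\<^sub>v (r k ^ 2 - 1) * 1" by (intro vcong_mult sq_ratio_cong) auto
    then have "1 + (r k ^ 2 - 1) * sq_ratio k \<cong>\<^sub>v 1 + (r k ^ 2 - 1)" by (intro vcong_add) auto
    ultimately show ?thesis by simp
  qed
  have pow: "r k \<cong>\<^sub>v r 0 ^ (2 ^ k)" for k
  proof (induction k)
    case (Suc k)
    have "r k ^ 2 \<cong>\<^sub>v (r 0 ^ (2 ^ k)) ^ 2" using Suc by (intro vcong_power v_power_le_1 r1)
    with step have "r (Suc k) \<cong>\<^sub>v (r 0 ^ (2 ^ k)) ^ 2" by (rule vcong_trans)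
    then show ?case by (simp add: mult.commute flip: power_mult)
  qed simp
  define w where "w = orbit t (Suc 0) b"
  have w: "w \<noteq> 0" "v w = v t" "w = b\<^sup>2 + t"
    using orbit_b_nonzero[of 0] v_orbit_b[of 0] by (simp_all add: w_def)
  have "(1 + a\<^sup>2 / t) - r 0 = (a\<^sup>2 + t) * b\<^sup>2 / (t * w)"
    using w(1) t_nonzero unfolding r_def rel_diff_def w_def[symmetric]
    by (simp add: field_simps) (simp add: w_def power2_eq_square algebra_simps)
  moreover have "v (a\<^sup>2 + t) \<le> v t" using v_add[of "a\<^sup>2" t] v_a_square_le by (simp add: v_power)
  then have "v ((a\<^sup>2 + t) * b\<^sup>2) \<le> v t * 1"
    using v_power_le_1[OF b, of 2] unfolding v_mult by (intro mult_mono) auto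
  then have "v ((a\<^sup>2 + t) * b\<^sup>2) / (v t * v t) \<le> v t * 1 / (v t * v t)"
    by (intro divide_right_mono) auto
  ultimately have "v ((1 + a\<^sup>2 / t) - r 0) \<le> v t / (v t * v t)"
    by (simp only: v_divide v_mult[of t w] w(2) mult_1_right)
  also have "\<dots> < 1" using v_t_gt_1 by (simp add: divide_less_eq)
  finally have "1 + a\<^sup>2 / t \<cong>\<^sub>v r 0" by (simp add: vcong_def)
  then have "(1 + a\<^sup>2 / t) ^ (2 ^ j) \<cong>\<^sub>v r 0 ^ (2 ^ j)" by (intro vcong_power r1)
  also have "\<dots> \<cong>\<^sub>v r j" by (rule vcong_sym[OF pow])
  also have "r j = - 1" by (simp add: r_def rel_diff_j)
  finally show ?thesis .
qed

end

end

section \<open>The degree of a parameter with opposite orbits\<close>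

lemma nonneg_finite_support_attains_max:
  fixes f :: "nat \<Rightarrow> real"
  assumes "\<And>i. i > n \<Longrightarrow> f i = 0" "\<And>i. f i \<ge> 0"
  shows "\<exists>i0. \<forall>i. f i \<le> f i0"
proof -
  have "Max (f ` {..n}) \<in> f ` {..n}" by (intro Max_in) auto
  then obtain i0 where i0: "Max (f ` {..n}) = f i0" by (elim imageE)
  have "f i \<le> f i0" for i
  proof (cases "i \<le> n")
    case True
    then have "f i \<le> Max (f ` {..n})" by (intro Max_ge) auto
    then show ?thesis by (simp add: i0)
  qed (use assms in simp)
  then show ?thesis by blast
qed

lemma of_rat_power_int: "of_rat (x powi k) = (of_rat x powi k :: 'a::field_char_0)"
  by (simp add: power_int_def of_rat_power of_rat_inverse)

context padic_abs_value
begin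

text \<open>Ramification: \<open>\<bar>t\<bar> ^ N = 2 \<bar>a\<bar> ^ 2N\<close> where \<open>\<bar>a\<bar>\<close> has a power of exponent \<open>e\<close> in the value group \<open>2\<^sup>\<int>\<close>. A rational
  polynomial with root \<open>t\<close> has two terms of equal size, so \<open>\<bar>t\<bar>\<^sup>m\<close> lies in \<open>2\<^sup>\<int>\<close> for some \<open>m\<close> between \<open>1\<close> and its
  degree; then \<open>N\<close> divides \<open>e m\<close>.\<close>

lemma degree_bound_p_eq_2:
  assumes "p = 2" "v a > 1" "v b \<le> 1" "orbit t (Suc j) a = - orbit t (Suc j) b"
    and e: "e > 0" "v a ^ e = real p powi k"
    and P: "P \<noteq> 0" "poly (map_poly of_rat P) t = 0"
  shows "2 ^ j \<le> e * degree P"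
proof -
  define N where "N = (2::nat) ^ j"
  have t: "t \<noteq> 0" by (rule t_nonzero[OF assms(2-4)])
  have vt: "v t ^ N = 2 * v a ^ (2 * N)"
    using v_t_if_p_eq_2[OF assms(2-4,1)] by (simp add: N_def power_mult)
  have sum: "(\<Sum>i\<le>degree P. of_rat (coeff P i) * t ^ i) = 0"
    using P(2) by (simp add: poly_altdef degree_map_poly coeff_map_poly)
  obtain i0 i1 where i01: "i0 \<in> {..degree P}" "i1 \<in> {..degree P}" "i0 \<noteq> i1"
      "v (of_rat (coeff P i0) * t ^ i0) = v (of_rat (coeff P i1) * t ^ i1)"
      "of_rat (coeff P i0) * t ^ i0 \<noteq> 0" "of_rat (coeff P i1) * t ^ i1 \<noteq> 0"
    by (rule two_maximal_terms[OF _ sum, of "degree P"]) (use P t in auto)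
  have "N \<le> e * degree P"
    if less: "i0 < i1" and "i1 \<le> degree P" and eq: "v (of_rat (coeff P i0) * t ^ i0) = v (of_rat (coeff P i1) * t ^ i1)"
      and nz: "of_rat (coeff P i0) * t ^ i0 \<noteq> 0" "of_rat (coeff P i1) * t ^ i1 \<noteq> 0" for i0 i1
  proof -
    obtain k0 k1 where kl: "v (of_rat (coeff P i0)) = real p powi k0" "v (of_rat (coeff P i1)) = real p powi k1"
      using nz v_of_rat_power by (metis mult_eq_0_iff of_rat_0)
    define m z where "m = i1 - i0" and "z = k0 - k1"
    have "v t ^ i1 = v t ^ m * v t ^ i0" using that(1) by (simp add: m_def flip: power_add)
    then have "real p powi k0 = real p powi k1 * v t ^ m"
      using eq kl t by (simp add: v_mult v_power)
    then have vtm: "v t ^ m = real p powi z"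
      using p_gt_1 by (simp add: z_def power_int_diff field_simps)
    have "real p powi (z * int (N * e)) = (v t ^ m) ^ (N * e)"
      unfolding vtm by (simp add: power_int_mult power_mult)
    also have "\<dots> = (v t ^ N) ^ (e * m)" by (simp add: mult_ac flip: power_mult)
    also have "\<dots> = (real p powi 1) ^ (e * m) * (v a ^ e) ^ (2 * N * m)"
      unfolding vt power_mult_distrib using assms(1) by (simp add: mult_ac flip: power_mult)
    also have "\<dots> = real p powi (int (e * m) + k * int (2 * N * m))"
      unfolding e(2) using p_gt_1
      by (subst power_int_add) (simp, simp only: power_int_mult power_int_of_nat power_int_1_right)
    finally have "z * int (N * e) = int (e * m) + k * int (2 * N * m)"
      by (simp only: powi_p_inject)
    then have "int (e * m) = int N * (z * int e - k * int (2 * m))"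
      by (simp add: algebra_simps)
    then have "int N dvd int (e * m)" by simp
    then have "N dvd e * m" by (simp only: int_dvd_int_iff)
    moreover have "e * m > 0" using e(1) that(1) by (simp add: m_def)
    ultimately have "N \<le> e * m" by (rule dvd_imp_le)
    also have "m \<le> degree P" using that(2) unfolding m_def by linarith
    then have "e * m \<le> e * degree P" by (rule mult_le_mono2)
    finally show ?thesis .
  qed
  from this[of i0 i1] this[of i1 i0] i01 show ?thesis
    unfolding N_def by (metis atMost_iff linorder_neqE_nat)
qed

text \<open>The residue of \<open>\<alpha>\<close> lies in a finite field. Explicitly, \<open>\<alpha>\<close> is a root of a rational polynomial scaled to
  have coefficients of size at most \<open>1\<close>, with equality for one of them. The iterated Frobenius images
  of \<open>\<alpha>\<close> are approximate roots, too, so two of them are congruent.\<close>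

lemma unit_frobenius_fixed:
  assumes "algebraic \<alpha>" "v \<alpha> = 1"
  obtains f where "f > 0" "\<alpha> ^ (p ^ f) \<cong>\<^sub>v \<alpha>"
proof -
  obtain P :: "rat poly" where P: "P \<noteq> 0" "poly (map_poly of_rat P) \<alpha> = 0"
    using assms algebraic_iff_rat_poly by blast
  let ?c = "\<lambda>i. v (of_rat (coeff P i))"
  have "\<exists>i0. \<forall>i. ?c i \<le> ?c i0"
    by (rule nonneg_finite_support_attains_max[of "degree P"]) (simp_all add: coeff_eq_0)
  then obtain i0 where i0: "\<And>i. ?c i \<le> ?c i0" by blast
  have "coeff P i0 \<noteq> 0"
  proof
    assume "coeff P i0 = 0"
    then have "?c i = 0" for i using i0[of i] v_nonneg[of "of_rat (coeff P i)"] by simp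
    then show False using P(1) by (metis leading_coeff_0_iff of_rat_eq_0_iff v_eq_0_iff)
  qed
  define g :: "'a poly" where "g = map_poly (\<lambda>c. of_rat (c / coeff P i0)) P"
  have coeff_g: "coeff g i = of_rat (coeff P i / coeff P i0)" for i
    by (simp add: g_def coeff_map_poly)
  have "v (coeff g i) \<le> 1" for i
    using i0[of i] \<open>coeff P i0 \<noteq> 0\<close> by (simp add: coeff_g of_rat_divide v_divide divide_le_eq)
  note g1 = this
  have gfix: "coeff g i ^ (p ^ 1) \<cong>\<^sub>v coeff g i" for i
  proof (cases "v (coeff g i) = 1")
    case True
    then show ?thesis unfolding coeff_g by (intro frobenius_of_rat) auto
  next
    case False
    then have "v (coeff g i) < 1" using g1[of i] by simp
    then show ?thesis by (rule frobenius_of_small)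
  qed
  have "g = smult (inverse (of_rat (coeff P i0))) (map_poly of_rat P)"
    by (rule poly_eqI) (simp add: coeff_g coeff_map_poly of_rat_divide field_simps)
  then have "poly g \<alpha> \<cong>\<^sub>v 0" using P(2) by simp
  then have root: "poly g (\<alpha> ^ (p ^ (1 * k))) \<cong>\<^sub>v 0" for k
    using assms(2) by (intro frobenius_iterate_poly g1 gfix) auto
  define X where "X = (\<lambda>k. \<alpha> ^ (p ^ k)) ` {..degree g}"
  have "\<exists>k l. k < l \<and> \<alpha> ^ (p ^ k) \<cong>\<^sub>v \<alpha> ^ (p ^ l)"
  proof (rule ccontr)
    assume neg: "\<not> ?thesis"
    have neg': "k = l" if "\<alpha> ^ (p ^ k) \<cong>\<^sub>v \<alpha> ^ (p ^ l)" for k l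
      using neg that vcong_sym[OF that] by (metis linorder_neqE_nat)
    have "inj_on (\<lambda>k. \<alpha> ^ (p ^ k)) {..degree g}"
      by (intro inj_onI neg') simp
    then have "card X > degree g" by (simp add: X_def card_image)
    then have "v (coeff g i0) < 1"
      using root neg' assms(2)
      by (intro approximate_roots_bound[OF g1, of X]) (auto simp: X_def v_power)
    then show False using \<open>coeff P i0 \<noteq> 0\<close> by (simp add: coeff_g)
  qed
  then obtain k l where kl: "k < l" "\<alpha> ^ (p ^ k) \<cong>\<^sub>v \<alpha> ^ (p ^ l)" by blast
  have "p ^ l = p ^ (l - k) * p ^ k" using kl(1) by (simp flip: power_add)
  then have cong: "(\<alpha> ^ (p ^ (l - k))) ^ (p ^ k) \<cong>\<^sub>v \<alpha> ^ (p ^ k)"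
    using vcong_sym[OF kl(2)] by (simp add: power_mult)
  have "\<alpha> ^ (p ^ (l - k)) \<cong>\<^sub>v \<alpha>"
    by (rule frobenius_inject[OF _ _ cong]) (simp_all add: v_power assms(2))
  then show thesis using that kl(1) by (metis zero_less_diff)
qed

lemma vcong_one_power_int:
  assumes "x \<cong>\<^sub>v 1"
  shows "x powi l \<cong>\<^sub>v 1"
proof -
  have vx: "v x = 1" using assms by (rule vcong_eq_1) simp
  have "x * inverse x \<cong>\<^sub>v x * 1" using assms vx by (cases "x = 0") (auto simp: vcong_sym)
  then have "inverse x \<cong>\<^sub>v 1" using vx by (rule vcong_cancel)
  then show ?thesis
    using vcong_power[of x 1] vcong_power[of "inverse x" 1] assms
    by (auto simp: power_int_def)
qed

text \<open>One power of Frobenius fixes the residues of all units of the form \<open>r a\<^sup>l\<close>. With \<open>E\<close> the least positive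
  exponent such that \<open>\<bar>a\<bar> ^ E\<close> is a power of \<open>p\<close>, and \<open>\<alpha>\<close> the corresponding unit \<open>a\<^sup>E p\<^sup>k\<close>, every such unit
  is a rational unit times a power of \<open>\<alpha>\<close>; so an exponent that works for \<open>\<alpha>\<close> works for all of them.
  The uniformity matters because these units appear as coefficients of polynomials of unbounded
  degree.\<close>

lemma uniform_frobenius_exponent:
  assumes "algebraic a" "a \<noteq> 0"
  obtains f where "f > 0"
    "\<And>r l. v (of_rat r * a powi l) = 1 \<Longrightarrow> (of_rat r * a powi l) ^ (p ^ f) \<cong>\<^sub>v of_rat r * a powi l"
proof -
  define D where "D e \<longleftrightarrow> e > 0 \<and> (\<exists>k. v a ^ e = real p powi k)" for e
  define E where "E = Least D"
  have "\<exists>e. D e" using algebraic_abs_value_power[OF assms(1,2)] unfolding D_def by metis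
  then have "D E" unfolding E_def by (rule LeastI_ex)
  then obtain k where E: "E > 0" "v a ^ E = real p powi k" unfolding D_def by blast
  have min: "\<not> (e > 0 \<and> (\<exists>k. v a ^ e = real p powi k))" if "e < E" for e
    
  proof -
    have "\<not> D e" using that not_less_Least unfolding E_def by blast
    then show ?thesis unfolding D_def .
  qed
  have v_p_powi: "v (of_rat (of_nat p powi i)) = real p powi (- i)" for i
    by (simp add: of_rat_power_int v_power_int v_p power_int_minus power_int_divide_distrib field_simps)
  define \<alpha> where "\<alpha> = a ^ E * of_rat (of_nat p powi k)"
  have v\<alpha>: "v \<alpha> = 1"
    using p_gt_1 by (simp add: \<alpha>_def v_mult v_power E v_p_powi power_int_minus)
  obtain f where f: "f > 0" "\<alpha> ^ (p ^ f) \<cong>\<^sub>v \<alpha>"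
    using unit_frobenius_fixed[of \<alpha>] v\<alpha> algebraic_add_mult(2)[OF algebraic_power[OF assms(1)] algebraic_of_rat]
    unfolding \<alpha>_def by metis
  have q1: "p ^ f = Suc (p ^ f - 1)" using p_gt_1 by simp
  have "\<alpha> * \<alpha> ^ (p ^ f - 1) \<cong>\<^sub>v \<alpha> * 1" using f(2) by (subst (asm) q1) simp
  then have \<alpha>1: "\<alpha> ^ (p ^ f - 1) \<cong>\<^sub>v 1" using v\<alpha> by (rule vcong_cancel)
  have "(of_rat r * a powi l) ^ (p ^ f) \<cong>\<^sub>v of_rat r * a powi l"
    if unit: "v (of_rat r * a powi l) = 1" for r l
  proof -
    have "r \<noteq> 0" using unit by auto
    then obtain z where z: "v (of_rat r) = real p powi z" using v_of_rat_power by blast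
    have va: "v a powi l = real p powi (- z)"
      using unit z p_gt_1 by (simp add: v_mult v_power_int power_int_minus field_simps)
    define m h where "m = nat (l mod int E)" and "h = l div int E"
    have l: "l = int E * h + int m" using E(1) by (simp add: m_def h_def)
    have va0: "v a \<noteq> 0" using assms(2) by simp
    have "v a ^ m = v a powi l * v a powi (int E * (- h))"
      using va0 by (subst power_int_add[symmetric]) (auto simp: l)
    also have "v a powi (int E * (- h)) = (v a ^ E) powi (- h)"
      by (simp only: power_int_mult power_int_of_nat)
    also have "\<dots> = real p powi (- (k * h))"
      by (simp only: E(2) power_int_mult[symmetric] mult_minus_right)
    also have "v a powi l * real p powi (- (k * h)) = real p powi (- z - k * h)"
      using p_gt_1 by (simp add: va power_int_add[symmetric])
    finally have "v a ^ m = real p powi (- z - k * h)" .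
    moreover have "m < E" using E(1) by (simp add: m_def nat_less_iff)
    ultimately have m: "m = 0" using min[of m] by (metis neq0_conv)
    define R where "R = r * of_nat p powi (- (k * h))"
    have x: "of_rat r * a powi l = of_rat R * \<alpha> powi h"
    proof -
      have "\<alpha> powi h = a powi l * of_rat (of_nat p powi (k * h))"
        using m by (simp add: \<alpha>_def l power_int_mult_distrib power_int_mult of_rat_power_int)
      then show ?thesis
        using p_gt_1 by (simp add: R_def of_rat_mult of_rat_power_int power_int_minus of_rat_inverse)
    qed
    then have vR: "v (of_rat R) = 1" using unit by (simp add: v_mult v_power_int v\<alpha>)
    have "(of_rat R * \<alpha> powi h) ^ (p ^ f) = of_rat R ^ (p ^ f) * (\<alpha> powi h * (\<alpha> ^ (p ^ f - 1)) powi h)"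
    proof -
      have "(\<alpha> powi h) ^ (p ^ f) = (\<alpha> ^ (p ^ f)) powi h"
        by (metis power_int_mult mult.commute power_int_of_nat)
      also have "\<alpha> ^ (p ^ f) = \<alpha> * \<alpha> ^ (p ^ f - 1)" by (subst q1) simp
      finally show ?thesis by (simp add: power_mult_distrib power_int_mult_distrib)
    qed
    also have "\<dots> \<cong>\<^sub>v of_rat R * (\<alpha> powi h * 1)"
      using vR v\<alpha> by (intro vcong_mult frobenius_of_rat vcong_one_power_int \<alpha>1)
        (auto simp: v_power_int v_mult)
    finally show ?thesis by (simp add: x)
  qed
  with that f(1) show thesis by blast
qed

text \<open>The order of \<open>\<rho>\<close> in the residue field is exactly \<open>2\<^sup>j\<^sup>+\<^sup>1\<close>, since \<open>- 1\<close> and \<open>1\<close> are incongruent. For the proof,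
  write \<open>M = 2\<^sup>i m\<close> with \<open>m\<close> odd and \<open>i \<le> j\<close>, and raise \<open>\<rho>\<close> to the power \<open>2\<^sup>j m\<close> in two ways.\<close>

lemma minus_one_root_order:
  assumes "p \<noteq> 2" "\<rho> ^ (2 ^ j) \<cong>\<^sub>v - 1" "\<rho> ^ M \<cong>\<^sub>v 1"
  shows "2 ^ Suc j dvd M"
proof (rule ccontr)
  assume nd: "\<not> 2 ^ Suc j dvd M"
  then have "M \<noteq> 0" by (metis dvd_0_right)
  then obtain m where m: "M = 2 ^ multiplicity 2 M * m" "odd m"
    using multiplicity_decompose'[of M 2] by (metis mult.commute not_prime_unit two_is_prime_nat)
  define i where "i = multiplicity 2 M"
  have ij: "i \<le> j"
  proof (rule ccontr)
    assume "\<not> i \<le> j"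
    then have "(2::nat) ^ Suc j dvd 2 ^ i" by (intro le_imp_power_dvd) simp
    then show False using nd m(1) by (metis dvd_mult2 i_def)
  qed
  have "M * 2 ^ (j - i) = 2 ^ j * m"
    using ij by (subst m(1)) (simp add: i_def[symmetric] mult_ac flip: power_add)
  then have "(\<rho> ^ M) ^ (2 ^ (j - i)) = (\<rho> ^ (2 ^ j)) ^ m" by (simp flip: power_mult)
  moreover have "(\<rho> ^ M) ^ (2 ^ (j - i)) \<cong>\<^sub>v 1 ^ (2 ^ (j - i))" using assms(3) by (intro vcong_power) auto
  moreover have "(\<rho> ^ (2 ^ j)) ^ m \<cong>\<^sub>v (- 1) ^ m" using assms(2) by (intro vcong_power) auto
  ultimately have "1 \<cong>\<^sub>v (- 1 :: 'a)" using m(2) by (metis power_one power_minus_odd vcong_sym vcong_trans)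
  then show False using assms(1) by (simp add: vcong_def v_2)
qed

text \<open>With \<open>c = a\<^sup>2 / t\<close>, the equation \<open>P(t) = 0\<close> says that \<open>1/c\<close> is a root of the polynomial \<open>g\<close> with
  coefficients \<open>P\<^sub>i a\<^sup>2\<^sup>i\<close>, scaled by the largest one. A power of Frobenius, \<open>x \<mapsto> x\<^sup>q\<close> with \<open>q = p\<^sup>f\<close>, fixes the
  residues of these coefficients, so it maps approximate roots of \<open>g\<close> to approximate roots. The
  images of \<open>1/c\<close> are as many as those of \<open>\<rho> = 1 + c\<close>, an element of order \<open>2\<^sup>j\<^sup>+\<^sup>1\<close> in the residue field, and
  there are at least \<open>2\<^sup>j\<^sup>+\<^sup>1 / (q\<^sup>2 - 1)\<close> of them.\<close>

lemma degree_bound_p_odd: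
  assumes "p \<noteq> 2" "v a > 1" "v b \<le> 1" "orbit t (Suc j) a = - orbit t (Suc j) b"
    and f: "f > 0"
      "\<And>r l. v (of_rat r * a powi l) = 1 \<Longrightarrow> (of_rat r * a powi l) ^ (p ^ f) \<cong>\<^sub>v of_rat r * a powi l"
    and P: "P \<noteq> 0" "poly (map_poly of_rat P) t = 0"
  shows "2 ^ j \<le> ((p ^ f)\<^sup>2 - 1) * degree P"
proof -
  define q where "q = p ^ f"
  have t: "t \<noteq> 0" by (rule t_nonzero[OF assms(2-4)])
  have a0: "a \<noteq> 0" using assms(2) by auto
  have vt: "v t = v a ^ 2" by (rule v_t_if_p_odd[OF assms(2-4,1)])
  define c where "c = a\<^sup>2 / t"
  have c0: "c \<noteq> 0" using a0 t by (simp add: c_def)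
  have vc: "v c = 1" using t a0 by (simp add: c_def v_divide v_power vt)
  define \<rho> where "\<rho> = 1 + c"
  have \<rho>: "\<rho> ^ (2 ^ j) \<cong>\<^sub>v - 1"
    unfolding \<rho>_def c_def by (rule root_of_minus_one[OF assms(2-4,1)])
  have v\<rho>: "v \<rho> = 1"
  proof -
    have "v \<rho> ^ (2 ^ j) = 1" using vcong_eq_1[OF \<rho>] by (simp add: v_power)
    then show ?thesis using power_eq_imp_eq_base[of "v \<rho>" "2 ^ j" 1] by simp
  qed
  let ?c = "\<lambda>i. v (of_rat (coeff P i) * t ^ i)"
  have "\<exists>i0. \<forall>i. ?c i \<le> ?c i0"
    by (rule nonneg_finite_support_attains_max[of "degree P"]) (simp_all add: coeff_eq_0)
  then obtain i0 where i0: "\<And>i. ?c i \<le> ?c i0" by blast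
  have P0: "coeff P i0 \<noteq> 0"
  proof
    assume "coeff P i0 = 0"
    then have "?c (degree P) \<le> 0" using i0[of "degree P"] by simp
    then have "of_rat (lead_coeff P) * t ^ degree P = 0" by (metis antisym v_nonneg v_eq_0_iff)
    then show False using P(1) t by simp
  qed
  \<comment> \<open>Normalised so that the coefficient with index \<open>i0\<close> is \<open>1\<close>, and written with \<open>a\<close> in place of \<open>t\<close>, which has the size of \<open>a\<^sup>2\<close>.\<close>
  define \<beta> where "\<beta> i = of_rat (coeff P i / coeff P i0) * a powi (2 * (int i - int i0))" for i
  define g where "g = (\<Sum>i\<le>degree P. monom (\<beta> i) i)"
  have coeff_g: "coeff g i = \<beta> i" for i
    by (auto simp: g_def coeff_sum if_distrib \<beta>_def coeff_eq_0 not_le cong: if_cong)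
  have v_a_powi: "v (a powi (2 * (int i - int i0))) = v t ^ i / v t ^ i0" for i
    using a0 by (simp add: v_power_int v_divide v_power vt power_int_mult power_int_diff flip: power_mult)
  have v\<beta>: "v (\<beta> i) \<le> 1" for i
  proof -
    have "v (\<beta> i) = ?c i / ?c i0"
      by (simp only: \<beta>_def v_mult v_a_powi of_rat_divide v_divide v_power times_divide_times_eq)
    moreover have "?c i0 > 0" using P0 t by simp
    ultimately show ?thesis using i0[of i] by (simp only: divide_le_eq_1_pos)
  qed
  have \<beta>fix: "\<beta> i ^ (p ^ f) \<cong>\<^sub>v \<beta> i" for i
  proof (cases "v (\<beta> i) = 1")
    case True
    then show ?thesis unfolding \<beta>_def by (intro f(2))
  next
    case False
    then have "v (\<beta> i) < 1" using v\<beta>[of i] by simp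
    then show ?thesis by (rule frobenius_of_small)
  qed
  have "poly g (inverse c) = (\<Sum>i\<le>degree P. \<beta> i * inverse c ^ i)"
    by (simp add: g_def poly_sum poly_monom)
  also have "\<dots> = (\<Sum>i\<le>degree P. inverse (of_rat (coeff P i0) * a powi (2 * int i0)) * (of_rat (coeff P i) * t ^ i))"
  proof (rule sum.cong[OF refl])
    fix i
    have "a powi (2 * (int i - int i0)) = (a\<^sup>2) ^ i / a powi (2 * int i0)"
      using a0 by (simp add: power_int_diff right_diff_distrib power_int_mult flip: power_mult)
    then have "\<beta> i * inverse c ^ i
      = of_rat (coeff P i / coeff P i0) * ((a\<^sup>2) ^ i / a powi (2 * int i0)) * (t / a\<^sup>2) ^ i"
      by (simp only: \<beta>_def c_def inverse_divide)
    also have "\<dots> = (of_rat (coeff P i) / of_rat (coeff P i0)) * (t ^ i / a powi (2 * int i0))"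
      using a0 by (simp add: of_rat_divide power_divide)
    finally show "\<beta> i * inverse c ^ i = inverse (of_rat (coeff P i0) * a powi (2 * int i0)) * (of_rat (coeff P i) * t ^ i)"
      by (simp only: divide_inverse inverse_mult_distrib ac_simps)
  qed
  also have "\<dots> = inverse (of_rat (coeff P i0) * a powi (2 * int i0)) * poly (map_poly of_rat P) t"
    by (simp add: sum_distrib_left poly_altdef degree_map_poly coeff_map_poly)
  finally have "poly g (inverse c) \<cong>\<^sub>v 0" using P(2) by simp
  then have root: "poly g (inverse c ^ (p ^ (f * k))) \<cong>\<^sub>v 0" for k
    using vc by (intro frobenius_iterate_poly) (auto simp: coeff_g v\<beta> \<beta>fix v_inverse)
  show ?thesis
  proof (rule ccontr)
    assume "\<not> ?thesis"
    then have less: "(q\<^sup>2 - 1) * degree P < 2 ^ j" by (simp add: q_def)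
    \<comment> \<open>A coincidence of two images is a relation for the order of \<open>\<rho>\<close>, as Frobenius is additive.\<close>
    have distinct: "k = l" if cong: "inverse c ^ (p ^ (f * k)) \<cong>\<^sub>v inverse c ^ (p ^ (f * l))"
      and kl: "k \<le> l" "l \<le> degree P" for k l
    proof -
      define A B where "A = p ^ (f * k)" and "B = p ^ (f * l)"
      have "c ^ A * c ^ B * inverse c ^ A \<cong>\<^sub>v c ^ A * c ^ B * inverse c ^ B"
        using cong vc unfolding A_def[symmetric] B_def[symmetric]
        by (intro vcong_mult) (auto simp: v_mult v_power v_inverse)
      then have "c ^ B \<cong>\<^sub>v c ^ A" using c0 by (simp add: field_simps)
      then have cong_c: "1 ^ A + c ^ A \<cong>\<^sub>v 1 ^ B + c ^ B" by (intro vcong_add) (auto dest: vcong_sym)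
      have "\<rho> ^ A \<cong>\<^sub>v 1 ^ A + c ^ A" unfolding \<rho>_def A_def using vc by (intro frobenius_power_add) auto
      also note cong_c
      also have "1 ^ B + c ^ B \<cong>\<^sub>v \<rho> ^ B"
        unfolding \<rho>_def B_def using vc by (intro vcong_sym[OF frobenius_power_add]) auto
      finally have "\<rho> ^ A * 1 \<cong>\<^sub>v \<rho> ^ A * \<rho> ^ (B - A)"
        using kl(1) p_gt_1 by (simp add: A_def B_def flip: power_add)
      then have "1 \<cong>\<^sub>v \<rho> ^ (B - A)" by (rule vcong_cancel) (simp add: v_power v\<rho>)
      then have "2 ^ Suc j dvd B - A" by (intro minus_one_root_order[OF assms(1) \<rho>]) (rule vcong_sym)
      moreover have "B - A = A * (q ^ (l - k) - 1)"
        using kl(1) by (simp add: A_def B_def q_def algebra_simps flip: power_mult power_add)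
      moreover have podd: "odd p" using prime assms(1) primes_dvd_imp_eq two_is_prime_nat by blast
      moreover have "coprime (2 ^ Suc j) A" using podd by (simp add: A_def)
      ultimately have "2 ^ Suc j dvd q ^ (l - k) - 1"
        using coprime_dvd_mult_right_iff by metis
      then have dvd: "2 ^ Suc j dvd (l - k) * (q\<^sup>2 - 1)"
        using podd by (intro two_power_dvd_order) (auto simp: q_def)
      have "(l - k) * (q\<^sup>2 - 1) \<le> degree P * (q\<^sup>2 - 1)" using kl(2) by (intro mult_right_mono) auto
      also have "\<dots> < 2 ^ Suc j" using less by (simp add: mult.commute)
      finally have "(l - k) * (q\<^sup>2 - 1) = 0" using dvd by (meson dvd_imp_le linorder_not_le neq0_conv)
      moreover have "q > 1" unfolding q_def using f(1) p_gt_1 by (intro one_less_power)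
      then have "q\<^sup>2 > 1" by (intro one_less_power) auto
      ultimately show "k = l" using kl(1) by auto
    qed
    have distinct': "k = l" if "inverse c ^ (p ^ (f * k)) \<cong>\<^sub>v inverse c ^ (p ^ (f * l))"
      "k \<le> degree P" "l \<le> degree P" for k l
      using distinct[OF that(1) _ that(3)] distinct[OF vcong_sym[OF that(1)] _ that(2)] by (metis nat_le_linear)
    define X where "X = (\<lambda>k. inverse c ^ (p ^ (f * k))) ` {..degree P}"
    have "inj_on (\<lambda>k. inverse c ^ (p ^ (f * k))) {..degree P}"
      by (intro inj_onI distinct') auto
    moreover have "degree g \<le> degree P"
      unfolding g_def by (intro degree_sum_le order.trans[OF degree_monom_le]) auto
    ultimately have "card X > degree g" by (simp add: X_def card_image)
    then have "v (coeff g i0) < 1"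
      using root distinct' vc
      by (intro approximate_roots_bound[of g X]) (auto simp: X_def v_power v_inverse coeff_g v\<beta>)
    then show False using P0 by (simp add: coeff_g \<beta>_def)
  qed
qed

theorem opposite_orbits_degree_bound:
  assumes "algebraic a" "v a > 1"
  obtains C where "C > 0"
    "\<And>t b j P. v b \<le> 1 \<Longrightarrow> orbit t (Suc j) a = - orbit t (Suc j) b \<Longrightarrow> P \<noteq> 0 \<Longrightarrow>
       poly (map_poly of_rat P) t = 0 \<Longrightarrow> 2 ^ j \<le> C * degree P"
proof (cases "p = 2")
  case True
  have "a \<noteq> 0" using assms(2) by auto
  then obtain e k where e: "e > 0" "v a ^ e = real p powi k"
    using algebraic_abs_value_power assms(1) by metis
  show thesis
    using that[OF e(1)] degree_bound_p_eq_2[OF True assms(2) _ _ e] by blast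
next
  case False
  have "a \<noteq> 0" using assms(2) by auto
  then obtain f where f: "f > 0"
    "\<And>r l. v (of_rat r * a powi l) = 1 \<Longrightarrow> (of_rat r * a powi l) ^ (p ^ f) \<cong>\<^sub>v of_rat r * a powi l"
    using uniform_frobenius_exponent assms(1) by metis
  have "p ^ f > 1" using f(1) p_gt_1 by (intro one_less_power)
  then have "(p ^ f)\<^sup>2 > 1" by (rule one_less_power) simp
  then show thesis
    using that[of "(p ^ f)\<^sup>2 - 1"] degree_bound_p_odd[OF False assms(2) _ _ f] by simp
qed

end

section \<open>Archimedean estimates\<close>

text \<open>Once \<open>t\<close> is large, the orbits have essentially equal size \<open>\<bar>t\<bar>\<close> after one step and square from then
  on, so an orbit that is ahead by at least one step stays ahead. The factor \<open>2\<close> kept in the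
  induction absorbs the contribution of \<open>t\<close> in each step.\<close>

lemma archimedean_growth:
  fixes t a b :: complex
  assumes B: "B \<ge> 1" "cmod a ^ 2 \<le> B" "cmod b ^ 2 \<le> B" and t: "cmod t > 16 * B"
  shows "cmod (orbit t (Suc n) a) < cmod (orbit t (Suc (n + Suc k)) b)"
proof -
  define T where "T = cmod t"
  have T: "T > 16 * B" "T > 16" using t B by (simp_all add: T_def)
  have up: "cmod (z\<^sup>2 + t) \<le> cmod z ^ 2 + T" and low: "cmod z ^ 2 - T \<le> cmod (z\<^sup>2 + t)"
    and low': "T - cmod z ^ 2 \<le> cmod (z\<^sup>2 + t)" for z
    using norm_triangle_ineq[of "z\<^sup>2" t] norm_diff_ineq[of "z\<^sup>2" t] norm_diff_ineq[of t "z\<^sup>2"]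
    by (simp_all add: T_def norm_power add.commute)
  have step_low: "cmod (orbit t n c) ^ 2 - T \<le> cmod (orbit t (Suc n) c)"
    and step_up: "cmod (orbit t (Suc n) c) \<le> cmod (orbit t n c) ^ 2 + T" for n c
    using low up by (simp_all only: orbit_Suc)
  have big: "cmod (orbit t (Suc n) c) \<ge> T / 2" if "cmod c ^ 2 \<le> B" for c n
  proof (induction n)
    case 0
    then show ?case using low'[of c] that T by simp
  next
    case (Suc n)
    have "(T / 2) ^ 2 \<le> cmod (orbit t (Suc n) c) ^ 2" using Suc T by (intro power_mono) auto
    moreover have "(T / 2) ^ 2 \<ge> 4 * T" using T by (simp add: power2_eq_square)
    ultimately show ?case using step_low[where n = "Suc n" and c = c] T by linarith
  qed
  have first: "cmod (orbit t (Suc (Suc m)) b) \<ge> 3 * T" for m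
  proof -
    have "(T / 2) ^ 2 \<le> cmod (orbit t (Suc m) b) ^ 2" using big[OF B(3), of m] T by (intro power_mono) auto
    moreover have "(T / 2) ^ 2 \<ge> 4 * T" using T by (simp add: power2_eq_square)
    ultimately show ?thesis using step_low[where n = "Suc m" and c = b] by linarith
  qed
  have "2 * cmod (orbit t (Suc n) a) \<le> cmod (orbit t (Suc (n + Suc k)) b)"
  proof (induction n)
    case 0
    have "cmod (orbit t (Suc 0) a) \<le> B + T" using up[of a] B by simp
    then show ?case using first[of k] T by simp
  next
    case (Suc n)
    define u w where "u = cmod (orbit t (Suc n) a)" and "w = cmod (orbit t (Suc (n + Suc k)) b)"
    have u: "u \<ge> T / 2" unfolding u_def by (rule big[OF B(2)])
    have "(2 * u) ^ 2 \<le> w ^ 2" using Suc u T by (intro power_mono) (auto simp: u_def w_def)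
    moreover have "8 * (T / 2) \<le> u * u" using u T by (intro mult_mono) auto
    ultimately have "2 * (u ^ 2 + T) \<le> w ^ 2 - T"
      unfolding power_mult_distrib using T by (simp add: power2_eq_square)
    have "2 * cmod (orbit t (Suc (Suc n)) a) \<le> 2 * (u ^ 2 + T)"
      unfolding u_def by (intro mult_left_mono step_up) simp
    also have "\<dots> \<le> w ^ 2 - T" by fact
    also have "\<dots> \<le> cmod (orbit t (Suc (Suc n + Suc k)) b)"
      unfolding w_def add_Suc by (rule step_low)
    finally show ?case .
  qed
  moreover have "cmod (orbit t (Suc n) a) > 0" using big[OF B(2), of n] T by linarith
  ultimately show ?thesis by linarith
qed

lemma archimedean_bound:
  fixes t a b :: complex
  assumes B: "B \<ge> 1" "cmod a ^ 2 \<le> B" "cmod b ^ 2 \<le> B"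
    and mn: "m \<ge> 1" "n \<ge> 1" "m \<noteq> n" "orbit t m a = orbit t n b"
  shows "cmod t \<le> 16 * B"
proof (rule ccontr)
  assume "\<not> cmod t \<le> 16 * B"
  then have t: "cmod t > 16 * B" by simp
  show False
  proof (cases "m < n")
    case True
    define i k where "i = m - 1" and "k = n - m - 1"
    have "m = Suc i" "n = Suc (i + Suc k)" using True mn(1) by (auto simp: i_def k_def)
    then show False using archimedean_growth[OF B t, of i k] mn(4) by (simp del: orbit_Suc)
  next
    case False
    define i k where "i = n - 1" and "k = m - n - 1"
    have "n = Suc i" "m = Suc (i + Suc k)" using False mn(2,3) by (auto simp: i_def k_def)
    then show False using archimedean_growth[OF B(1,3,2) t, of i k] mn(4) by (simp del: orbit_Suc)
  qed
qed

definition sq_norm :: "complex poly \<Rightarrow> real" where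
  "sq_norm p = (\<Sum>i\<le>degree p. (cmod (coeff p i))\<^sup>2)"

lemma sq_norm_eq_sum: "degree p \<le> n \<Longrightarrow> sq_norm p = (\<Sum>i\<le>n. (cmod (coeff p i))\<^sup>2)"
  unfolding sq_norm_def by (intro sum.mono_neutral_left) (auto simp: coeff_eq_0)

text \<open>The key to Landau's inequality: reflecting a root in the unit circle preserves the sum of the
  squared absolute values, because both sides have the same mixed terms.\<close>

lemma sq_norm_reflect_root: "sq_norm ([:- y, 1:] * p) = sq_norm ([:- 1, cnj y:] * p)"
proof -
  define n where "n = Suc (degree p)"
  define c where "c i = coeff (pCons 0 p) i" for i
  have deg: "degree ([:- y, 1:] * p) \<le> n" "degree ([:- 1, cnj y:] * p) \<le> n"
    unfolding n_def by (rule order.trans[OF degree_mult_le], simp)+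
  have sq_diff: "(cmod (x - z))\<^sup>2 = (cmod x)\<^sup>2 + (cmod z)\<^sup>2 - 2 * Re (x * cnj z)" for x z
    by (simp only: cmod_power2) (simp add: power2_eq_square algebra_simps)
  have coeff1: "coeff ([:- y, 1:] * p) i = c i - y * coeff p i" for i
    by (simp add: c_def)
  have coeff2: "coeff ([:- 1, cnj y:] * p) i = cnj y * c i - coeff p i" for i
    by (simp add: c_def coeff_pCons split: nat.splits)
  have term1: "(cmod (coeff ([:- y, 1:] * p) i))\<^sup>2
      = (cmod (c i))\<^sup>2 + (cmod y)\<^sup>2 * (cmod (coeff p i))\<^sup>2 - 2 * Re (c i * cnj (y * coeff p i))" for i
    by (simp only: coeff1 sq_diff norm_mult power_mult_distrib)
  have term2: "(cmod (coeff ([:- 1, cnj y:] * p) i))\<^sup>2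
      = (cmod y)\<^sup>2 * (cmod (c i))\<^sup>2 + (cmod (coeff p i))\<^sup>2 - 2 * Re (c i * cnj (y * coeff p i))" for i
  proof -
    have "cnj y * c i * cnj (coeff p i) = c i * cnj (y * coeff p i)" by simp
    then show ?thesis
      by (simp only: coeff2 sq_diff norm_mult power_mult_distrib complex_mod_cnj)
  qed
  have shift: "(\<Sum>i\<le>n. (cmod (c i))\<^sup>2) = (\<Sum>i\<le>n. (cmod (coeff p i))\<^sup>2)"
  proof -
    have "(\<Sum>i\<le>n. (cmod (c i))\<^sup>2) = (\<Sum>i\<le>degree p. (cmod (coeff p i))\<^sup>2)"
      unfolding n_def c_def by (subst sum.atMost_Suc_shift) simp
    then show ?thesis by (simp add: n_def coeff_eq_0)
  qed
  show ?thesis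
    unfolding sq_norm_eq_sum[OF deg(1)] sq_norm_eq_sum[OF deg(2)] term1 term2
    by (simp add: sum.distrib sum_subtractf shift flip: sum_distrib_left)
qed

lemma lead_coeff_le_sq_norm: "(cmod (lead_coeff p))\<^sup>2 \<le> sq_norm p"
  unfolding sq_norm_def by (rule member_le_sum) auto

text \<open>Reflecting all roots outside of the unit circle multiplies the leading coefficient by the
  product of their absolute values, but does not change the norm.\<close>

lemma landau_inequality:
  assumes "finite Y"
  shows "(cmod (lead_coeff p) * (\<Prod>y\<in>Y. max 1 (cmod y)))\<^sup>2 \<le> sq_norm ((\<Prod>y\<in>Y. [:- y, 1:]) * p)"
  using assms
proof (induction Y arbitrary: p rule: finite_induct)
  case empty
  then show ?case using lead_coeff_le_sq_norm by simp
next
  case (insert y Y)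
  let ?R = "\<Prod>y\<in>Y. [:- y, 1:]"
  have eq: "(\<Prod>y\<in>insert y Y. [:- y, 1:]) * p = [:- y, 1:] * (?R * p)"
    by (simp only: prod.insert[OF insert.hyps] mult.assoc)
  show ?case
  proof (cases "cmod y \<le> 1")
    case True
    have "lead_coeff ([:- y, 1:] * p) = lead_coeff p" by (simp only: lead_coeff_mult) simp
    moreover have "(\<Prod>y\<in>insert y Y. [:- y, 1:]) * p = ?R * ([:- y, 1:] * p)"
      unfolding eq by (simp only: ac_simps)
    ultimately show ?thesis using insert.IH[of "[:- y, 1:] * p"] insert.hyps True
      by (simp only: prod.insert) (simp add: max_def)
  next
    case False
    have "lead_coeff ([:- 1, cnj y:] * p) = cnj y * lead_coeff p"
      using False by (simp only: lead_coeff_mult) auto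
    moreover have "sq_norm ((\<Prod>y\<in>insert y Y. [:- y, 1:]) * p) = sq_norm (?R * ([:- 1, cnj y:] * p))"
      unfolding eq sq_norm_reflect_root by (simp only: ac_simps)
    ultimately show ?thesis using insert.IH[of "[:- 1, cnj y:] * p"] insert.hyps False
      by (simp only: prod.insert norm_mult complex_mod_cnj) (simp add: max_def mult_ac)
  qed
qed

lemma prod_roots_dvd:
  fixes F :: "complex poly"
  assumes "finite Y" "\<And>y. y \<in> Y \<Longrightarrow> poly F y = 0"
  shows "(\<Prod>y\<in>Y. [:- y, 1:]) dvd F"
  using assms
proof (induction Y rule: finite_induct)
  case (insert y Y)
  then obtain G where G: "F = (\<Prod>y\<in>Y. [:- y, 1:]) * G" by (auto elim: dvdE)
  have "poly (\<Prod>y\<in>Y. [:- y, 1:]) y \<noteq> 0"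
    using insert.hyps by (auto simp: poly_prod)
  moreover have "poly F y = 0" using insert.prems by simp
  ultimately have "poly G y = 0" by (simp add: G)
  then have "[:- y, 1:] dvd G" by (simp add: poly_eq_0_iff_dvd)
  then have "[:- y, 1:] * (\<Prod>y\<in>Y. [:- y, 1:]) dvd G * (\<Prod>y\<in>Y. [:- y, 1:])"
    by (rule mult_dvd_mono) simp
  then show ?case by (simp only: prod.insert[OF insert.hyps] G mult.commute[of G])
qed simp

lemma mahler_bound:
  fixes F :: "complex poly"
  assumes "finite Y" "\<And>y. y \<in> Y \<Longrightarrow> poly F y = 0" "cmod (lead_coeff F) \<ge> 1"
  shows "(\<Prod>y\<in>Y. max 1 (cmod y)) \<le> sqrt (sq_norm F)"
proof -
  obtain G where G: "F = (\<Prod>y\<in>Y. [:- y, 1:]) * G" using prod_roots_dvd[OF assms(1,2)] by (auto elim: dvdE)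
  have "lead_coeff (\<Prod>y\<in>Y. [:- y, 1:]) = 1" by (simp add: lead_coeff_prod)
  then have "lead_coeff G = lead_coeff F" by (simp only: G lead_coeff_mult mult_1)
  let ?M = "\<Prod>y\<in>Y. max 1 (cmod y)"
  have M: "?M \<ge> 0" by (intro prod_nonneg) auto
  have "?M \<le> cmod (lead_coeff G) * ?M"
    using assms(3) M \<open>lead_coeff G = lead_coeff F\<close> mult_right_mono[of 1 "cmod (lead_coeff G)" ?M] by simp
  moreover have "(cmod (lead_coeff G) * ?M)\<^sup>2 \<le> sq_norm F"
    unfolding G by (rule landau_inequality[OF assms(1)])
  then have "cmod (lead_coeff G) * ?M \<le> sqrt (sq_norm F)" by (rule real_le_rsqrt)
  ultimately show ?thesis by linarith
qed

definition orbit_poly :: "nat \<Rightarrow> complex \<Rightarrow> complex poly" where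
  "orbit_poly n a = orbit [:0, 1:] n [:a:]"

lemma poly_orbit_poly: "poly (orbit_poly n a) t = orbit t n a"
  unfolding orbit_poly_def by (induction n) simp_all

lemma orbit_poly_monic: "degree (orbit_poly (Suc n) a) = 2 ^ n \<and> coeff (orbit_poly (Suc n) a) (2 ^ n) = 1"
proof (induction n)
  case 0
  have "orbit_poly (Suc 0) a = [:a\<^sup>2, 1:]"
    by (simp add: orbit_poly_def power2_eq_square)
  then show ?case by simp
next
  case (Suc n)
  define g where "g = orbit_poly (Suc n) a"
  have g: "degree g = 2 ^ n" "coeff g (2 ^ n) = 1" using Suc unfolding g_def by blast+
  then have g0: "g \<noteq> 0" by auto
  have deg: "degree (g\<^sup>2) = 2 ^ Suc n" using g g0 by (simp add: degree_power_eq)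
  have "lead_coeff (g\<^sup>2) = 1" unfolding lead_coeff_power using g by simp
  then have lead: "coeff (g\<^sup>2) (2 ^ Suc n) = 1" by (simp only: deg)
  have eq: "orbit_poly (Suc (Suc n)) a = g\<^sup>2 + [:0, 1:]"
    by (simp add: orbit_poly_def g_def)
  have "1 < (2::nat) ^ Suc n" by (rule one_less_power) simp_all
  moreover have "degree [:0, 1::complex:] = 1" by simp
  ultimately have less: "degree [:0, 1::complex:] < 2 ^ Suc n" by (simp only:)
  then have "degree (g\<^sup>2 + [:0, 1:]) = 2 ^ Suc n" using deg by (subst degree_add_eq_left) simp_all
  moreover have "coeff [:0, 1::complex:] (2 ^ Suc n) = 0" using less by (rule coeff_eq_0)
  ultimately show ?case unfolding eq coeff_add lead by simp
qed

definition l1_norm :: "complex poly \<Rightarrow> real" where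
  "l1_norm p = (\<Sum>i\<le>degree p. cmod (coeff p i))"

lemma l1_norm_eq_sum: "degree p \<le> n \<Longrightarrow> l1_norm p = (\<Sum>i\<le>n. cmod (coeff p i))"
  unfolding l1_norm_def by (intro sum.mono_neutral_left) (auto simp: coeff_eq_0)

lemma l1_norm_nonneg: "l1_norm p \<ge> 0"
  by (simp add: l1_norm_def sum_nonneg)

lemma l1_norm_add: "l1_norm (p + q) \<le> l1_norm p + l1_norm q"
proof -
  define n where "n = max (degree p) (degree q)"
  have d: "degree p \<le> n" "degree q \<le> n" "degree (p + q) \<le> n"
    by (auto simp: n_def degree_add_le_max)
  show ?thesis
    unfolding l1_norm_eq_sum[OF d(1)] l1_norm_eq_sum[OF d(2)] l1_norm_eq_sum[OF d(3)]
    by (simp flip: sum.distrib add: sum_mono norm_triangle_ineq)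
qed

lemma l1_norm_pCons: "l1_norm (pCons c p) = cmod c + l1_norm p"
proof -
  have "l1_norm (pCons c p) = (\<Sum>i\<le>Suc (degree p). cmod (coeff (pCons c p) i))"
    by (rule l1_norm_eq_sum) (simp add: degree_pCons_le)
  also have "\<dots> = cmod c + l1_norm p" by (subst sum.atMost_Suc_shift) (simp add: l1_norm_def)
  finally show ?thesis .
qed

lemma l1_norm_smult: "l1_norm (smult c p) = cmod c * l1_norm p"
  by (cases "c = 0") (simp_all add: l1_norm_def norm_mult sum_distrib_left)

lemma l1_norm_mult: "l1_norm (p * q) \<le> l1_norm p * l1_norm q"
proof (induction p)
  case (pCons c p)
  have "l1_norm (pCons c p * q) \<le> l1_norm (smult c q) + l1_norm (pCons 0 (p * q))"
    by (simp add: l1_norm_add)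
  also have "\<dots> \<le> cmod c * l1_norm q + l1_norm p * l1_norm q"
    using pCons by (simp add: l1_norm_smult l1_norm_pCons)
  finally show ?case by (simp add: l1_norm_pCons algebra_simps)
qed (simp add: l1_norm_def)

lemma sq_norm_le_l1_norm: "sqrt (sq_norm p) \<le> l1_norm p"
proof (rule real_le_lsqrt)
  show "sq_norm p \<le> (l1_norm p)\<^sup>2"
    unfolding sq_norm_def l1_norm_def power2_eq_square[of "sum _ _"] sum_distrib_right
  proof (rule sum_mono)
    fix i assume i: "i \<in> {..degree p}"
    have "cmod (coeff p i) \<le> (\<Sum>i\<le>degree p. cmod (coeff p i))"
      using i by (intro member_le_sum) auto
    then show "(cmod (coeff p i))\<^sup>2 \<le> cmod (coeff p i) * (\<Sum>i\<le>degree p. cmod (coeff p i))"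
      by (simp add: power2_eq_square mult_left_mono)
  qed
qed (simp add: l1_norm_nonneg)

lemma l1_norm_orbit_poly: "l1_norm (orbit_poly n a) \<le> (cmod a + 2) ^ (2 ^ n) - 1"
proof (induction n)
  case 0
  show ?case by (simp add: orbit_poly_def l1_norm_pCons) (simp add: l1_norm_def)
next
  case (Suc n)
  define X where "X = (cmod a + 2) ^ (2 ^ n)"
  have "cmod a + 2 \<le> X" unfolding X_def by (rule self_le_power) auto
  then have "1 * 2 \<le> X" using norm_ge_zero[of a] by linarith
  have "orbit_poly (Suc n) a = orbit_poly n a * orbit_poly n a + [:0, 1:]"
    by (simp add: orbit_poly_def power2_eq_square)
  then have "l1_norm (orbit_poly (Suc n) a) \<le> l1_norm (orbit_poly n a * orbit_poly n a) + l1_norm [:0, 1:]"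
    using l1_norm_add by metis
  also have "l1_norm [:0, 1:] = 1" by (simp add: l1_norm_def)
  also have "l1_norm (orbit_poly n a * orbit_poly n a) \<le> l1_norm (orbit_poly n a) * l1_norm (orbit_poly n a)"
    by (rule l1_norm_mult)
  also have "\<dots> \<le> (X - 1) * (X - 1)"
    using Suc l1_norm_nonneg[of "orbit_poly n a"] by (intro mult_mono) (auto simp: X_def)
  also have "(X - 1) * (X - 1) + 1 \<le> X\<^sup>2 - 1"
    using \<open>1 * 2 \<le> X\<close> by (simp add: power2_eq_square algebra_simps)
  finally show ?case by (simp add: X_def mult.commute flip: power_mult)
qed

text \<open>The points of \<open>Y\<close> are roots of a polynomial of degree \<open>2\<^sup>j\<close> with leading coefficient \<open>1 + 1 = 2\<close>; in
  particular the two leading terms do not cancel, and the Mahler measure bounds the roots.\<close>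

lemma sum_ln_opposite_roots:
  fixes a b :: complex
  assumes "finite Y" "\<And>t. t \<in> Y \<Longrightarrow> orbit t (Suc j) a = - orbit t (Suc j) b"
    and R: "cmod a + 2 \<le> R" "cmod b + 2 \<le> R"
  shows "(\<Sum>t\<in>Y. ln (max 1 (cmod t))) \<le> 4 * 2 ^ j * ln R"
proof -
  define F where "F = orbit_poly (Suc j) a + orbit_poly (Suc j) b"
  have root: "poly F t = 0" if "t \<in> Y" for t
    using assms(2)[OF that] by (simp add: F_def poly_orbit_poly del: orbit_Suc)
  have lc: "coeff F (2 ^ j) = 2"
    using orbit_poly_monic[of j a] orbit_poly_monic[of j b] by (simp add: F_def)
  have "degree F \<le> 2 ^ j"
    unfolding F_def using orbit_poly_monic[of j a] orbit_poly_monic[of j b] by (intro degree_add_le) auto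
  moreover have "degree F \<ge> 2 ^ j" using lc by (intro le_degree) auto
  ultimately have "lead_coeff F = 2" using lc by (metis antisym)
  have R2: "R \<ge> 2" using R(1) norm_ge_zero[of a] by linarith
  have pow: "(cmod c + 2) ^ (2 ^ Suc j) \<le> R ^ (2 ^ Suc j)" if "cmod c + 2 \<le> R" for c
    using that by (intro power_mono) auto
  have "l1_norm F \<le> R ^ (2 ^ Suc j) + R ^ (2 ^ Suc j)"
    unfolding F_def
    using l1_norm_add[of "orbit_poly (Suc j) a" "orbit_poly (Suc j) b"]
      l1_norm_orbit_poly[of "Suc j" a] l1_norm_orbit_poly[of "Suc j" b] pow[OF R(1)] pow[OF R(2)]
    by linarith
  also have "\<dots> = 2 * R ^ (2 ^ Suc j)" by simp
  also have "\<dots> \<le> R ^ (2 ^ Suc j) * R ^ (2 ^ Suc j)"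
    using R2 self_le_power[of R "2 ^ Suc j"] by (intro mult_right_mono) auto
  also have "\<dots> = R ^ (4 * 2 ^ j)" by (simp flip: power_add)
  finally have l1: "l1_norm F \<le> R ^ (4 * 2 ^ j)" .
  have "(\<Prod>t\<in>Y. max 1 (cmod t)) \<le> sqrt (sq_norm F)"
    by (rule mahler_bound[OF assms(1) root]) (simp_all add: \<open>lead_coeff F = 2\<close>)
  also note sq_norm_le_l1_norm
  also note l1
  finally have "ln (\<Prod>t\<in>Y. max 1 (cmod t)) \<le> ln (R ^ (4 * 2 ^ j))"
    by (intro ln_mono prod_pos) auto
  then show ?thesis using assms(1) R2 by (simp add: ln_prod ln_realpow)
qed

section \<open>Bounded height\<close>

context padic_abs_value
begin

text \<open>If \<open>\<bar>x\<bar> > 1\<close>, the leading term would be strictly larger than all others.\<close>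

lemma v_le_1_if_root:
  assumes P: "poly (map_poly of_int P) x = 0" and lc: "\<not> int p dvd lead_coeff P"
  shows "v x \<le> 1"
proof (rule ccontr)
  assume "\<not> v x \<le> 1"
  then have x: "v x > 1" by simp
  define d where "d = degree P"
  have "(\<Sum>i\<le>d. of_int (coeff P i) * x ^ i) = 0"
    using P by (simp add: poly_altdef degree_map_poly coeff_map_poly d_def)
  then have eq: "of_int (coeff P d) * x ^ d = - (\<Sum>i<d. of_int (coeff P i) * x ^ i)"
    by (simp add: lessThan_Suc_atMost[symmetric] add_eq_0_iff)
  have "v (of_int (coeff P i) * x ^ i) < v x ^ d" if "i < d" for i
  proof -
    have "v (of_int (coeff P i)) * v x ^ i \<le> 1 * v x ^ i"
      by (intro mult_right_mono v_of_int_le_1) auto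
    also have "\<dots> < v x ^ d" using x that by simp
    finally show ?thesis by (simp add: v_mult v_power)
  qed
  then have "v (\<Sum>i<d. of_int (coeff P i) * x ^ i) < v x ^ d"
    using x by (intro v_sum_less zero_less_power) auto
  moreover have "v (of_int (coeff P d)) = 1" using lc by (simp add: v_of_int_eq_1_iff d_def)
  then have "v (of_int (coeff P d) * x ^ d) = v x ^ d" by (simp add: v_mult v_power)
  ultimately show False by (simp add: eq)
qed

end

lemma padic_abs_value_qbar:
  assumes "prime p"
  shows "padic_abs_value p (\<lambda>x. padic_abs_ext p (complex_of_qbar x))"
  using assms is_padic_extension_padic_abs_ext[OF assms]
  by unfold_locales
     (auto simp: is_padic_extension_def times_qbar.rep_eq plus_qbar.rep_eq zero_qbar.rep_eq
        simp flip: complex_of_qbar_inject)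

lemma complex_of_qbar_orbit:
  "complex_of_qbar (orbit t n a) = orbit (complex_of_qbar t) n (complex_of_qbar a)"
  by (induction n) (simp_all add: plus_qbar.rep_eq)

lemma qbar_cases:
  assumes "algebraic x"
  obtains X where "x = complex_of_qbar X"
  using assms Abs_qbar_inverse[of x] by (metis mem_Collect_eq)

lemma complex_of_qbar_poly_of_int:
  "complex_of_qbar (poly (map_poly of_int P) x) = poly (map_poly of_int P) (complex_of_qbar x)"
  by (induction P) (simp_all add: map_poly_pCons zero_qbar.rep_eq plus_qbar.rep_eq times_qbar.rep_eq)

lemma padic_abs_ext_le_1_if_root:
  assumes "prime p" "algebraic x" "poly (map_poly of_int P) x = 0" "\<not> int p dvd lead_coeff P"
  shows "padic_abs_ext p x \<le> 1"
proof -
  interpret padic_abs_value p "\<lambda>x. padic_abs_ext p (complex_of_qbar x)"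
    by (rule padic_abs_value_qbar[OF assms(1)])
  obtain X where X: "x = complex_of_qbar X" using assms(2) by (rule qbar_cases)
  have "poly (map_poly of_int P) X = 0"
    using assms(3) by (simp add: X zero_qbar.rep_eq flip: complex_of_qbar_inject complex_of_qbar_poly_of_int)
  from v_le_1_if_root[OF this assms(4)] show ?thesis by (simp add: X)
qed

lemma padic_abs_ext_le_1_if_algebraic_int:
  assumes "prime p" "algebraic_int x"
  shows "padic_abs_ext p x \<le> 1"
proof -
  obtain P where P: "poly (map_poly of_int P) x = 0" "lead_coeff P = 1"
    using assms(2) algebraic_int_altdef_ipoly by blast
  have "\<not> int p dvd lead_coeff P" using assms(1) P(2) by (auto simp: prime_nat_iff)
  then show ?thesis
    using padic_abs_ext_le_1_if_root[OF assms(1) _ P(1)] assms(2) by blast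
qed

lemma conjugates_int_poly:
  assumes "y \<in> conjugates x" "poly (map_poly of_int P) x = 0"
  shows "poly (map_poly of_int P) y = 0"
proof -
  have eq: "map_poly of_rat (map_poly of_int P :: rat poly) = (map_poly of_int P :: complex poly)"
    by (simp add: poly_eq_iff coeff_map_poly)
  show ?thesis using assms unfolding conjugates_def by (metis (mono_tags, lifting) eq mem_Collect_eq)
qed

lemma algebraic_int_conjugate:
  assumes "y \<in> conjugates x" "algebraic_int x"
  shows "algebraic_int y"
  using assms conjugates_int_poly[OF assms(1)] unfolding algebraic_int_altdef_ipoly by blast

lemma finite_bad_primes:
  assumes "algebraic x"
  shows "finite {p. prime p \<and> (\<exists>y\<in>conjugates x. padic_abs_ext p y > 1)}"
proof -
  obtain P :: "int poly" where P: "poly (map_poly of_int P) x = 0" "P \<noteq> 0"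
    using assms by (rule algebraicE')
  have "{p. prime p \<and> (\<exists>y\<in>conjugates x. padic_abs_ext p y > 1)} \<subseteq> {p. int p dvd lead_coeff P}"
  proof
    fix p assume "p \<in> {p. prime p \<and> (\<exists>y\<in>conjugates x. padic_abs_ext p y > 1)}"
    then obtain y where p: "prime p" "y \<in> conjugates x" "padic_abs_ext p y > 1" by blast
    then have "int p dvd lead_coeff P"
      using padic_abs_ext_le_1_if_root[OF p(1) algebraic_conjugate[OF p(2) assms] conjugates_int_poly[OF p(2) P(1)]]
      by linarith
    then show "p \<in> {p. int p dvd lead_coeff P}" by simp
  qed
  moreover have "{p. int p dvd lead_coeff P} \<subseteq> {..nat \<bar>lead_coeff P\<bar>}"
  proof
    fix p assume "p \<in> {p. int p dvd lead_coeff P}"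
    then have "int p \<le> \<bar>lead_coeff P\<bar>" using P(2) by (intro zdvd_imp_le) auto
    then show "p \<in> {..nat \<bar>lead_coeff P\<bar>}" by simp
  qed
  ultimately show ?thesis by (meson finite_atMost finite_subset)
qed

lemma subring_set_padic_integers:
  assumes "prime p"
  shows "subring_set {x. algebraic x \<and> padic_abs_ext p x \<le> 1}"
proof -
  interpret padic_abs_value p "\<lambda>x. padic_abs_ext p (complex_of_qbar x)"
    by (rule padic_abs_value_qbar[OF assms])
  have "algebraic (x - y) \<and> padic_abs_ext p (x - y) \<le> 1 \<and> algebraic (x * y) \<and> padic_abs_ext p (x * y) \<le> 1"
    if xy: "algebraic x" "padic_abs_ext p x \<le> 1" "algebraic y" "padic_abs_ext p y \<le> 1" for x y
  proof -
    obtain X Y where XY: "x = complex_of_qbar X" "y = complex_of_qbar Y"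
      using xy qbar_cases by metis
    have "x - y = complex_of_qbar (X - Y)" "x * y = complex_of_qbar (X * Y)"
      by (simp_all add: XY minus_qbar.rep_eq times_qbar.rep_eq)
    moreover have "padic_abs_ext p (complex_of_qbar (X - Y)) \<le> 1"
      using v_diff[of X Y] xy XY by auto
    moreover have "padic_abs_ext p (complex_of_qbar (X * Y)) \<le> 1"
      unfolding v_mult using xy XY v_nonneg by (intro mult_le_one) auto
    ultimately show ?thesis by simp
  qed
  moreover have "padic_abs_ext p 1 \<le> 1" using v_1 by (simp add: one_qbar.rep_eq)
  ultimately show ?thesis by (auto simp: subring_set_def)
qed

lemma padic_abs_gt_1_if_not_int:
  assumes "r \<notin> \<int>"
  obtains p where "prime p" "padic_abs p r > 1"
proof -
  obtain n d where nd: "quotient_of r = (n, d)" by force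
  then have r: "r = of_int n / of_int d" "d > 0" "coprime n d"
    by (auto simp: quotient_of_div quotient_of_denom_pos quotient_of_coprime)
  have "d \<noteq> 1" using r(1) assms by auto
  then have "\<not> is_unit d" using r(2) by simp
  then obtain q where q: "prime q" "q dvd d" using r(2) by (metis prime_divisor_exists less_irrefl)
  define p where "p = nat q"
  have pq: "int p = q" using prime_ge_0_int[OF q(1)] by (simp add: p_def)
  have p: "prime p" "int p = q" using q(1) pq prime_nat_int_transfer[of p] by simp_all
  have "\<not> q dvd n" using q r(3) by (meson coprime_common_divisor not_prime_unit)
  then have "multiplicity q n = 0" by (rule not_dvd_imp_multiplicity_0)
  moreover have "multiplicity q d > 0"
    using q r(2) by (subst multiplicity_gt_zero_iff) auto
  moreover have "r \<noteq> 0" using assms by auto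
  ultimately have "padic_abs p r = real p ^ multiplicity q d"
    by (simp add: padic_abs_def nd p(2))
  also have "\<dots> > 1"
    using \<open>multiplicity q d > 0\<close> prime_gt_1_nat[OF p(1)] by (intro one_less_power) auto
  finally show thesis using that p(1) by blast
qed

text \<open>If all conjugates of \<open>a\<close> were integral at all primes, so would be the coefficients of its minimal
  polynomial, which are then integers.\<close>

lemma exists_large_conjugate:
  assumes "algebraic a" "\<not> algebraic_int a"
  obtains p y where "prime p" "y \<in> conjugates a" "padic_abs_ext p y > 1"
proof -
  obtain P :: "rat poly" where P: "lead_coeff P = 1" "poly (map_poly of_rat P) a = 0"
    "map_poly of_rat P = (\<Prod>y\<in>conjugates a. [:- y, 1:])" "finite (conjugates a)"
    by (rule minimal_polynomial[OF assms(1)]) blast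
  have "\<exists>i. coeff P i \<notin> \<int>"
  proof (rule ccontr)
    assume "\<not> ?thesis"
    then have int: "coeff P i \<in> \<int>" for i by blast
    have "coeff (map_poly of_rat P) i \<in> (\<int> :: complex set)" for i
      using int[of i] by (elim Ints_cases) (simp add: coeff_map_poly)
    moreover have "lead_coeff (map_poly of_rat P) = (1 :: complex)"
      using P(1) by (simp add: degree_map_poly coeff_map_poly)
    ultimately have "algebraic_int a" using P(2) by (intro algebraic_int.intros allI)
    with assms(2) show False by simp
  qed
  then obtain i where i: "coeff P i \<notin> \<int>" by blast
  then obtain p where p: "prime p" "padic_abs p (coeff P i) > 1"
    by (rule padic_abs_gt_1_if_not_int)
  define A where "A = {x. algebraic x \<and> padic_abs_ext p x \<le> 1}"
  have A: "subring_set A" unfolding A_def by (rule subring_set_padic_integers[OF p(1)])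
  have "\<exists>y\<in>conjugates a. y \<notin> A"
  proof (rule ccontr)
    assume neg: "\<not> ?thesis"
    have "\<forall>i. coeff (\<Prod>y\<in>Y. [:- y, 1:]) i \<in> A" if "finite Y" "Y \<subseteq> conjugates a" for Y
      using that
    proof (induction Y rule: finite_induct)
      case empty
      then show ?case using subring_set_closed[OF A] by (auto simp: coeff_1)
    next
      case (insert y Y)
      have "coeff [:- y, 1:] i \<in> A" for i
        using insert.prems neg subring_set_closed[OF A] by (auto simp: coeff_pCons split: nat.splits)
      then have "coeff ([:- y, 1:] * (\<Prod>y\<in>Y. [:- y, 1:])) i \<in> A" for i
        unfolding coeff_mult using insert
        by (intro subring_set_sum[OF A] subring_set_closed(4)[OF A]) auto
      then show ?case by (simp only: prod.insert[OF insert.hyps]) blast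
    qed
    from this[OF P(4)] have "of_rat (coeff P i) \<in> A"
      by (simp flip: P(3) add: coeff_map_poly)
    moreover have "padic_abs_ext p (of_rat (coeff P i)) = padic_abs p (coeff P i)"
      using is_padic_extension_padic_abs_ext[OF p(1)] by (simp add: is_padic_extension_def)
    ultimately show False using p(2) by (simp add: A_def)
  qed
  then obtain y where "y \<in> conjugates a" "padic_abs_ext p y > 1"
    using algebraic_conjugate[OF _ assms(1)] by (auto simp: A_def)
  with that p(1) show thesis by blast
qed

lemma padic_orbit_bound:
  assumes p: "prime p" and alg: "algebraic t" "algebraic a" "algebraic b"
    and neq: "a\<^sup>2 \<noteq> b\<^sup>2" and mn: "m \<ge> 1" "n \<ge> 1" "orbit t m a = orbit t n b"
    and B: "B \<ge> 1" "padic_abs_ext p a ^ 2 \<le> B" "padic_abs_ext p b ^ 2 \<le> B"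
  shows "padic_abs_ext p t \<le> (if p = 2 then 2 * B else B)"
proof -
  interpret padic_abs_value p "\<lambda>x. padic_abs_ext p (complex_of_qbar x)"
    by (rule padic_abs_value_qbar[OF p])
  obtain T X Y where TXY: "t = complex_of_qbar T" "a = complex_of_qbar X" "b = complex_of_qbar Y"
    using alg qbar_cases by metis
  have "X\<^sup>2 \<noteq> Y\<^sup>2" using neq by (auto simp: TXY simp flip: complex_of_qbar_power)
  moreover have "orbit T m X = orbit T n Y"
    using mn(3) by (simp add: TXY complex_of_qbar_orbit flip: complex_of_qbar_inject)
  ultimately show ?thesis
    using nonarchimedean_bound[of X Y m n T B] mn B by (simp add: v_2 TXY split: if_splits)
qed

lemma conjugate_degree_bound:
  assumes p: "prime p" and a: "algebraic a" "padic_abs_ext p a > 1"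
  obtains C where "C > 0" "\<And>t b j. algebraic t \<Longrightarrow> algebraic b \<Longrightarrow> padic_abs_ext p b \<le> 1 \<Longrightarrow>
    orbit t (Suc j) a = - orbit t (Suc j) b \<Longrightarrow> 2 ^ j \<le> C * card (conjugates t)"
proof -
  interpret padic_abs_value p "\<lambda>x. padic_abs_ext p (complex_of_qbar x)"
    by (rule padic_abs_value_qbar[OF p])
  obtain X where X: "a = complex_of_qbar X" using a(1) by (rule qbar_cases)
  obtain C where C: "C > 0"
    "\<And>t b j P. padic_abs_ext p (complex_of_qbar b) \<le> 1 \<Longrightarrow> orbit t (Suc j) X = - orbit t (Suc j) b \<Longrightarrow> P \<noteq> 0 \<Longrightarrow>
       poly (map_poly of_rat P) t = 0 \<Longrightarrow> 2 ^ j \<le> C * degree P"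
    using opposite_orbits_degree_bound[of X] algebraic_qbar a(2) X by metis
  have "2 ^ j \<le> C * card (conjugates t)"
    if t: "algebraic t" "algebraic b" "padic_abs_ext p b \<le> 1" "orbit t (Suc j) a = - orbit t (Suc j) b" for t b j
  proof -
    obtain T Y where TY: "t = complex_of_qbar T" "b = complex_of_qbar Y"
      using t qbar_cases by metis
    obtain P :: "rat poly" where P: "P \<noteq> 0" "poly (map_poly of_rat P) t = 0" "degree P = card (conjugates t)"
      by (rule minimal_polynomial[OF t(1)]) blast
    have "poly (map_poly of_rat P) T = 0"
      using P(2) by (simp add: TY zero_qbar.rep_eq flip: complex_of_qbar_poly complex_of_qbar_inject)
    moreover have "orbit T (Suc j) X = - orbit T (Suc j) Y"
      using t(4) by (simp add: TY X complex_of_qbar_orbit uminus_qbar.rep_eq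
          flip: complex_of_qbar_inject del: orbit_Suc)
    ultimately have "2 ^ j \<le> C * degree P" using C(2) P(1) t(3) TY by metis
    then show ?thesis by (simp add: P(3))
  qed
  with C(1) that show thesis by blast
qed

lemma (in embed) phi_orbit:
  assumes "t \<in> K" "a \<in> K"
  shows "orbit t n a \<in> K \<and> \<phi> (orbit t n a) = orbit (\<phi> t) n (\<phi> a)"
proof (induction n)
  case (Suc n)
  then show ?case using assms
    by (auto simp: phi_add phi_power K_closed intro!: K_closed(6) K_closed(7)[of "orbit t n a"])
qed (use assms in simp)

text \<open>Equality of two iterates means that the previous ones agree up to sign. Going back in time, the
  sign must be negative at some point, because the orbits differ after the first step.\<close>

lemma eventually_opposite:
  fixes a b t :: complex
  assumes "a\<^sup>2 \<noteq> b\<^sup>2" "orbit t (Suc m) a = orbit t (Suc m) b"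
  shows "\<exists>j. orbit t (Suc j) a = - orbit t (Suc j) b"
  using assms(2)
proof (induction m)
  case (Suc m)
  then have "(orbit t (Suc m) a)\<^sup>2 = (orbit t (Suc m) b)\<^sup>2" by simp
  then show ?case using Suc.IH by (metis power2_eq_iff)
qed (use assms(1) in simp)

lemma sum_UN_le:
  fixes f :: "'b \<Rightarrow> real"
  assumes "finite I" "\<And>i. i \<in> I \<Longrightarrow> finite (A i)" "\<And>x. f x \<ge> 0"
  shows "sum f (\<Union>i\<in>I. A i) \<le> (\<Sum>i\<in>I. sum f (A i))"
  using assms(1,2)
proof (induction I rule: finite_induct)
  case (insert i I)
  have "sum f (A i \<union> (\<Union>i\<in>I. A i)) \<le> sum f (A i) + sum f (\<Union>i\<in>I. A i)"
    using sum.union_inter[of "A i" "\<Union>i\<in>I. A i" f] sum_nonneg[of "A i \<inter> (\<Union>i\<in>I. A i)" f] insert assms(3)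
    by simp
  then show ?case using insert by simp
qed simp

text \<open>The infinite sum in the height is supported on \<open>P0\<close>.\<close>

lemma weil_height_le:
  assumes fin: "finite (conjugates t)" and P0: "finite P0" "P0 \<subseteq> {p. prime p}"
    and arch: "(\<Sum>y\<in>conjugates t. ln (max 1 (cmod y))) \<le> real (card (conjugates t)) * X"
    and bad: "\<And>p y. p \<in> P0 \<Longrightarrow> y \<in> conjugates t \<Longrightarrow> ln (max 1 (padic_abs_ext p y)) \<le> L p"
    and good: "\<And>p y. prime p \<Longrightarrow> p \<notin> P0 \<Longrightarrow> y \<in> conjugates t \<Longrightarrow> padic_abs_ext p y \<le> 1"
  shows "0 \<le> weil_height t \<and> weil_height t \<le> X + (\<Sum>p\<in>P0. L p)"
proof -
  let ?d = "real (card (conjugates t))"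
  have d: "?d > 0" using fin conjugates_self[of t] by (auto simp: card_gt_0_iff)
  let ?f = "\<lambda>p. \<Sum>y\<in>conjugates t. ln (max 1 (padic_abs_ext p y))"
  have "(\<Sum>\<^sub>\<infinity>p\<in>{p::nat. prime p}. ?f p) = (\<Sum>\<^sub>\<infinity>p\<in>P0. ?f p)"
    by (rule infsum_cong_neutral) (use P0 good in \<open>auto simp: max_absorb1 intro!: sum.neutral\<close>)
  also have "\<dots> = (\<Sum>p\<in>P0. ?f p)" using P0(1) by simp
  finally have inf: "(\<Sum>\<^sub>\<infinity>p\<in>{p::nat. prime p}. ?f p) = (\<Sum>p\<in>P0. ?f p)" .
  have "?f p \<le> ?d * L p" if "p \<in> P0" for p
    using sum_mono[of "conjugates t" "\<lambda>y. ln (max 1 (padic_abs_ext p y))" "\<lambda>_. L p"] bad[OF that] by simp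
  then have "(\<Sum>p\<in>P0. ?f p) \<le> (\<Sum>p\<in>P0. ?d * L p)" by (rule sum_mono)
  also have "\<dots> = ?d * (\<Sum>p\<in>P0. L p)" by (simp add: sum_distrib_left)
  finally have "weil_height t \<le> (?d * X + ?d * (\<Sum>p\<in>P0. L p)) / ?d"
    unfolding weil_height_def inf using arch d by (intro divide_right_mono) auto
  also have "\<dots> = X + (\<Sum>p\<in>P0. L p)" using d by (simp add: field_simps)
  finally have "weil_height t \<le> X + (\<Sum>p\<in>P0. L p)" .
  moreover have "0 \<le> weil_height t"
    unfolding weil_height_def inf by (intro divide_nonneg_nonneg add_nonneg_nonneg sum_nonneg) auto
  ultimately show ?thesis by blast
qed

text \<open>All constants below depend only on the finitely many conjugates of \<open>a\<close> and \<open>b\<close>: the bound at a prime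
  in \<open>P0\<close> on their p-adic absolute values, the archimedean bound on their size \<open>R\<close>, and the degree bound
  on one conjugate \<open>a0\<close> of \<open>a\<close> that is large at some prime.\<close>

lemma bounded_height_orbit_collisions:
  assumes a: "algebraic a" "\<not> algebraic_int a" and b: "algebraic_int b"
  shows "bounded_height {t. algebraic t \<and> (\<exists>m n. m \<ge> 1 \<and> n \<ge> 1 \<and> orbit t m a = orbit t n b)}"
proof -
  have balg: "algebraic b" using b by blast
  define CA CB where "CA = conjugates a" and "CB = conjugates b"
  have fin: "finite CA" "finite CB"
    unfolding CA_def CB_def using minimal_polynomial a(1) balg by metis+
  obtain p0 a0 where p0: "prime p0" "a0 \<in> CA" "padic_abs_ext p0 a0 > 1"
    unfolding CA_def using exists_large_conjugate[OF a] by blast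
  have a0: "algebraic a0" using p0(2) a(1) algebraic_conjugate CA_def by blast
  obtain C0 where C0: "C0 > 0"
    "\<And>t b j. algebraic t \<Longrightarrow> algebraic b \<Longrightarrow> padic_abs_ext p0 b \<le> 1 \<Longrightarrow>
      orbit t (Suc j) a0 = - orbit t (Suc j) b \<Longrightarrow> 2 ^ j \<le> C0 * card (conjugates t)"
    using conjugate_degree_bound[OF p0(1) a0 p0(3)] by metis
  define R where "R = 2 + (\<Sum>x\<in>CA \<union> CB. cmod x)"
  have R: "cmod x + 2 \<le> R" if "x \<in> CA \<union> CB" for x
    using member_le_sum[OF that, of cmod] fin by (simp add: R_def)
  have R2: "R \<ge> 2" by (simp add: R_def sum_nonneg)
  \<comment> \<open>The prime \<open>2\<close> is included because the p-adic bound loses a factor \<open>\<bar>2\<bar>\<close>.\<close>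
  define P0 where "P0 = insert 2 ({p. prime p \<and> (\<exists>y\<in>conjugates a. padic_abs_ext p y > 1)} \<union>
    {p. prime p \<and> (\<exists>y\<in>conjugates b. padic_abs_ext p y > 1)})"
  have P0: "finite P0" "P0 \<subseteq> {p. prime p}"
    using finite_bad_primes[OF a(1)] finite_bad_primes[OF balg] by (auto simp: P0_def two_is_prime_nat)
  have v_nonneg: "padic_abs_ext p x \<ge> 0" if "prime p" "x \<in> CA \<union> CB" for p x
  proof -
    have "algebraic x" using that(2) algebraic_conjugate a(1) balg unfolding CA_def CB_def by blast
    then show ?thesis using is_padic_extension_padic_abs_ext[OF that(1)] by (simp add: is_padic_extension_def)
  qed
  define B where "B p = 1 + (\<Sum>x\<in>CA \<union> CB. padic_abs_ext p x ^ 2)" for p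
  have B: "padic_abs_ext p x ^ 2 \<le> B p" if "x \<in> CA \<union> CB" for p x
    using member_le_sum[OF that, of "\<lambda>x. padic_abs_ext p x ^ 2"] fin by (simp add: B_def)
  have B_ge_1: "B p \<ge> 1" for p by (simp add: B_def sum_nonneg)
  define L where "L p = ln (2 * B p)" for p
  define X where "X = ln (16 * R ^ 2) + real (card CA * card CB) * (4 * C0 * ln R)"
  have lnR: "ln R \<ge> 0" "ln (16 * R ^ 2) \<ge> 0" using R2 by (auto intro!: ln_ge_zero mult_ge1_I one_le_power)
  have main: "0 \<le> weil_height t \<and> weil_height t \<le> X + (\<Sum>p\<in>P0. L p)"
    if t: "algebraic t" and mn: "m \<ge> 1" "n \<ge> 1" "orbit t m a = orbit t n b" for t m n
  proof -
    have fint: "finite (conjugates t)" using minimal_polynomial[OF t] by metis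
    define d where "d = card (conjugates t)"
    have ab: "a'\<^sup>2 \<noteq> b'\<^sup>2" if "a' \<in> CA" "b' \<in> CB" for a' b'
    proof
      assume "a'\<^sup>2 = b'\<^sup>2"
      moreover have "algebraic_int b'" using algebraic_int_conjugate that(2) b by (auto simp: CB_def)
      ultimately have "algebraic_int a'" by (metis algebraic_int_minus_iff power2_eq_iff)
      moreover have "a \<in> conjugates a'" using that(1) conjugates_eq[of a' a] conjugates_self[of a] by (simp add: CA_def)
      ultimately show False using algebraic_int_conjugate a(2) by blast
    qed
    have conj: "\<exists>a'\<in>CA. \<exists>b'\<in>CB. orbit y m a' = orbit y n b' \<and>
        (\<forall>j. orbit t (Suc j) a = - orbit t (Suc j) b \<longrightarrow> orbit y (Suc j) a' = - orbit y (Suc j) b')"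
      if y: "y \<in> conjugates t" for y
    proof -
      obtain K \<phi> where K: "embedding K \<phi>" "t \<in> K" "a \<in> K" "b \<in> K" "\<phi> t = y"
        using exists_embedding[OF t a(1) balg y] by metis
      interpret embed K \<phi> by unfold_locales (rule K)
      have "\<phi> a \<in> CA" "\<phi> b \<in> CB" using phi_conjugates K by (auto simp: CA_def CB_def)
      moreover have "orbit y k (\<phi> a) = \<phi> (orbit t k a)" "orbit y k (\<phi> b) = \<phi> (orbit t k b)" for k
        using phi_orbit K by auto
      ultimately show ?thesis using mn(3) phi_minus phi_orbit[OF K(2,4)] by metis
    qed
    have y_alg: "algebraic y" if "y \<in> conjugates t" for y using algebraic_conjugate that t by blast
    have padic: "padic_abs_ext p y \<le> (if p = 2 then 2 * D else D)"
      if p: "prime p" and y: "y \<in> conjugates t" and D: "D \<ge> 1" "\<And>x. x \<in> CA \<union> CB \<Longrightarrow> padic_abs_ext p x ^ 2 \<le> D" for p y D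
    proof -
      obtain a' b' where ab': "a' \<in> CA" "b' \<in> CB" "orbit y m a' = orbit y n b'"
        using conj[OF y] by blast
      have "algebraic a'" "algebraic b'"
        using ab' algebraic_conjugate a(1) balg by (auto simp: CA_def CB_def)
      then show ?thesis
        using ab' D by (intro padic_orbit_bound[OF p y_alg[OF y] _ _ ab[OF ab'(1,2)] mn(1,2)]) auto
    qed
    have bad: "ln (max 1 (padic_abs_ext p y)) \<le> L p" if "p \<in> P0" "y \<in> conjugates t" for p y
    proof -
      have "padic_abs_ext p y \<le> (if p = 2 then 2 * B p else B p)"
        using that P0(2) by (intro padic B B_ge_1) auto
      also have "\<dots> \<le> 2 * B p" using B_ge_1[of p] by simp
      finally show ?thesis unfolding L_def using B_ge_1[of p] by (subst ln_le_cancel_iff) auto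
    qed
    have good: "padic_abs_ext p y \<le> 1" if p: "prime p" "p \<notin> P0" "y \<in> conjugates t" for p y
    proof -
      have "padic_abs_ext p x ^ 2 \<le> 1" if "x \<in> CA \<union> CB" for x
        using p(1,2) that v_nonneg[OF p(1) that] by (intro power_le_one) (auto simp: P0_def CA_def CB_def not_less)
      then have "padic_abs_ext p y \<le> (if p = 2 then 2 * 1 else 1)" using p by (intro padic) auto
      moreover have "p \<noteq> 2" using p(2) by (auto simp: P0_def)
      ultimately show ?thesis by simp
    qed
    have arch: "(\<Sum>y\<in>conjugates t. ln (max 1 (cmod y))) \<le> real d * X"
    proof (cases "m = n")
      case False
      have "ln (max 1 (cmod y)) \<le> X" if y: "y \<in> conjugates t" for y
      proof -
        obtain a' b' where ab': "a' \<in> CA" "b' \<in> CB" "orbit y m a' = orbit y n b'"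
          using conj[OF y] by blast
        have sq: "cmod x ^ 2 \<le> R ^ 2" if "x \<in> CA \<union> CB" for x
          using R[OF that] by (intro power_mono) auto
        have "cmod y \<le> 16 * R ^ 2"
          using R2 ab' sq mn False by (intro archimedean_bound[of _ a' b' m n]) auto
        moreover have "1 \<le> 16 * R ^ 2" using one_le_power[of R 2] R2 by linarith
        ultimately have "ln (max 1 (cmod y)) \<le> ln (16 * R ^ 2)" by (subst ln_le_cancel_iff) auto
        also have "\<dots> \<le> X" unfolding X_def using lnR by simp
        finally show ?thesis .
      qed
      then have "(\<Sum>y\<in>conjugates t. ln (max 1 (cmod y))) \<le> (\<Sum>y\<in>conjugates t. X)" by (rule sum_mono)
      then show ?thesis by (simp add: d_def)
    next
      case True
      obtain m' where "m = Suc m'" using mn(1) by (cases m) auto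
      then obtain j where j: "orbit t (Suc j) a = - orbit t (Suc j) b"
        using eventually_opposite[of a b t m'] ab[of a b] True mn(3) conjugates_self by (auto simp: CA_def CB_def simp del: orbit_Suc)
      \<comment> \<open>The degree bound applies after moving \<open>a\<close> to its large conjugate \<open>a0\<close>; the degree of \<open>t\<close> does not change.\<close>
      have deg: "2 ^ j \<le> C0 * d"
      proof -
        obtain K \<phi> where K: "embedding K \<phi>" "a \<in> K" "t \<in> K" "b \<in> K" "\<phi> a = a0"
          using exists_embedding[OF a(1) t balg] p0(2) unfolding CA_def by metis
        interpret embed K \<phi> by unfold_locales (rule K)
        have "\<phi> t \<in> conjugates t" "\<phi> b \<in> conjugates b" using phi_conjugates K by auto
        then have conjs: "algebraic (\<phi> t)" "algebraic (\<phi> b)" "algebraic_int (\<phi> b)" "conjugates (\<phi> t) = conjugates t"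
          using algebraic_conjugate t balg algebraic_int_conjugate b conjugates_eq by blast+
        have "\<phi> (orbit t (Suc j) a) = - \<phi> (orbit t (Suc j) b)"
          using phi_minus phi_orbit[OF K(3,4)] by (metis j)
        then have "orbit (\<phi> t) (Suc j) a0 = - orbit (\<phi> t) (Suc j) (\<phi> b)"
          using phi_orbit K by metis
        from C0(2)[OF conjs(1,2) padic_abs_ext_le_1_if_algebraic_int[OF p0(1) conjs(3)] this]
        show ?thesis by (simp add: d_def conjs(4))
      qed
      \<comment> \<open>Different conjugates of \<open>t\<close> may come with different conjugates of \<open>a\<close> and \<open>b\<close>; group them accordingly.\<close>
      define Y where "Y = (\<lambda>(a', b'). {y \<in> conjugates t. orbit y (Suc j) a' = - orbit y (Suc j) b'})"
      have Ysum: "(\<Sum>y\<in>Y (a', b'). ln (max 1 (cmod y))) \<le> 4 * 2 ^ j * ln R"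
        if "a' \<in> CA" "b' \<in> CB" for a' b'
        by (rule sum_ln_opposite_roots) (use that R fint in \<open>auto simp: Y_def simp del: orbit_Suc\<close>)
      have "(\<Sum>y\<in>conjugates t. ln (max 1 (cmod y))) \<le> (\<Sum>y\<in>(\<Union>ab\<in>CA \<times> CB. Y ab). ln (max 1 (cmod y)))"
      proof (rule sum_mono2)
        show "finite (\<Union>ab\<in>CA \<times> CB. Y ab)"
          using fint by (rule rev_finite_subset) (auto simp: Y_def)
        show "conjugates t \<subseteq> (\<Union>ab\<in>CA \<times> CB. Y ab)"
        proof
          fix y assume y: "y \<in> conjugates t"
          then obtain a' b' where "a' \<in> CA" "b' \<in> CB" "orbit y (Suc j) a' = - orbit y (Suc j) b'"
            using conj[OF y] j by blast
          then show "y \<in> (\<Union>ab\<in>CA \<times> CB. Y ab)" using y by (auto simp: Y_def simp del: orbit_Suc)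
        qed
      qed auto
      also have "\<dots> \<le> (\<Sum>ab\<in>CA \<times> CB. \<Sum>y\<in>Y ab. ln (max 1 (cmod y)))"
        using fin fint by (intro sum_UN_le) (auto simp: Y_def)
      also have "\<dots> \<le> (\<Sum>ab\<in>CA \<times> CB. 4 * 2 ^ j * ln R)"
        by (intro sum_mono) (use Ysum in auto)
      also have "\<dots> = real (card CA * card CB) * (4 * real (2 ^ j) * ln R)"
        by (simp add: card_cartesian_product)
      also have "real (2 ^ j) \<le> real (C0 * d)" using deg by (simp only: of_nat_le_iff)
      then have "real (card CA * card CB) * (4 * real (2 ^ j) * ln R)
          \<le> real (card CA * card CB) * (4 * real (C0 * d) * ln R)"
        using lnR(1) by (intro mult_left_mono mult_right_mono) auto
      also have "\<dots> = real d * (real (card CA * card CB) * (4 * C0 * ln R))" by simp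
      also have "\<dots> \<le> real d * X" unfolding X_def using lnR by (intro mult_left_mono) auto
      finally show ?thesis .
    qed
    show ?thesis
      using weil_height_le[OF fint P0 _ bad good] arch by (simp add: d_def)
  qed
  show ?thesis
    unfolding bounded_height_def
  proof (intro conjI)
    show "bounded (weil_height ` {t. algebraic t \<and> (\<exists>m n. m \<ge> 1 \<and> n \<ge> 1 \<and> orbit t m a = orbit t n b)})"
      unfolding bounded_iff
      by (rule exI[of _ "X + (\<Sum>p\<in>P0. L p)"]) (use main in fastforce)
  qed auto
qed

theorem theorem1p1:
  fixes a b :: complex and f g :: "complex \<Rightarrow> complex \<Rightarrow> complex"
  assumes "f = quad_map" and "g = quad_map"
    and "algebraic a" and "algebraic b"
    and "(algebraic_int a \<and> \<not> algebraic_int b) \<or> (\<not> algebraic_int a \<and> algebraic_int b)"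
  shows "bounded_height
    {t. algebraic t \<and> (\<exists>m n. m \<ge> 1 \<and> n \<ge> 1 \<and> (f t ^^ m) a = (g t ^^ n) b)}"
proof -
  have orbit: "(quad_map t ^^ n) z = orbit t n z" for t n z
    by (simp add: orbit_def quad_map_def[abs_def])
  show ?thesis
    using assms(5)
  proof
    assume "\<not> algebraic_int a \<and> algebraic_int b"
    then show ?thesis
      using bounded_height_orbit_collisions[of a b] assms(3) by (simp add: assms(1,2) orbit)
  next
    assume "algebraic_int a \<and> \<not> algebraic_int b"
    then have "bounded_height {t. algebraic t \<and> (\<exists>m n. m \<ge> 1 \<and> n \<ge> 1 \<and> orbit t m b = orbit t n a)}"
      using bounded_height_orbit_collisions[of b a] assms(4) by blast
    moreover have "{t. algebraic t \<and> (\<exists>m n. m \<ge> 1 \<and> n \<ge> 1 \<and> orbit t m b = orbit t n a)}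
      = {t. algebraic t \<and> (\<exists>m n. m \<ge> 1 \<and> n \<ge> 1 \<and> (f t ^^ m) a = (g t ^^ n) b)}"
      unfolding assms(1,2) orbit by metis
    ultimately show ?thesis by simp
  qed
qed

end
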